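(* Let $n\ge 1$ and $r\ge 4$ be integers, and let $\mathcal Z'$ be a commutative $\mathbb Z[q,q^{-1}]$-algebra in which $2$ is invertible. Then the $q$-Schur$^{1.5}$ algebra $\mathcal S_q^{1.5}(n,r;\mathcal Z')$ is free (as a $\mathcal Z'$-module), and base change induces an isomorphism $$\mathcal S_q^{1.5}(n,r)\otimes_{\mathbb Z[q,q^{-1}]}\mathcal Z'\;\cong\;\mathcal S_q^{1.5}(n,r;\mathcal Z').$$
   Context: Let $W$ be the Weyl group of type $B_r$ with Coxeter generators $s_0,s_1,\dots,s_{r-1}$ ($s_0s_1$ of order $4$; $s_is_{i+1}$ of order $3$ for $i\ge 1$; other pairs commute). Put $\bar W=\langle s_1,\dots,s_{r-1}\rangle\cong\mathfrak S_r$, $t_1=s_0$, $t_i=s_{i-1}t_{i-1}s_{i-1}$ and $u_i=t_1t_i$ ($2\le i\le r$). Put $u=s_0s_1s_0$; the subgroup $\check W=\langle u,s_1,\dots,s_{r-1}\rangle$ is the Weyl group of type $D_r$ with Coxeter generating set $\check S=\{u,s_1,\dots,s_{r-1}\}$; it contains $\bar W$ and all $u_i$. $\check{\mathcal H}$ is the generic Hecke algebra of $(\check W,\check S)$ over $\mathcal Z=\mathbb Z[q,q^{-1}]$: it has standard basis $\{T_w\}_{w\in\check W}$, with $T_s^2=(q-1)T_s+q$ for $s\in\check S$ and $T_wT_s=T_{ws}$ if $ws$ is longer than $w$ (lengths with respect to $\check S$). For a commutative $\mathcal Z$-algebra $\mathcal Z'$ put $\check{\mathcal H}'=\check{\mathcal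 H}\otimes_{\mathcal Z}\mathcal Z'$. $\Lambda(m,k)$ is the set of compositions of $k$ with $m$ parts (zeros allowed). Put $n_r=\max(n,r)$ and $\Pi_2(n,r)=\bigcup_{r_1+r_2=r}\Lambda(n_r,r_1)\times\Lambda(n,r_2)$; elements are written $\lambda=(\lambda^{(1)},\lambda^{(2)})$, and $|\lambda^{(i)}|$ denotes the sum of the parts of $\lambda^{(i)}$. Put $\Pi_{1.5}(n,r)=\{\lambda\in\Pi_2(n,r): |\lambda^{(1)}|\ge|\lambda^{(2)}|\}$. For $\lambda\in\Pi_2(n,r)$, $\bar W_\lambda\subseteq\bar W$ is the standard Young subgroup of the composition obtained by juxtaposing $\lambda^{(1)}$ and $\lambda^{(2)}$, and $\bar x_\lambda=\sum_{w\in\bar W_\lambda}T_w$. Let $\check\pi_0=\check\pi_1=1$, $\check\pi_a=\prod_{i=2}^a(q^{i-1}+T_{u_i})$ for $2\le a\le r$, and $\check x_\lambda=\check\pi_{|\lambda^{(1)}|}\bar x_\lambda\in\check{\mathcal H}'$. The $q$-Schur$^{1.5}$ algebra is $\mathcal S_q^{1.5}(n,r;\mathcal Z')=\mathrm{End}_{\check{\mathcal H}'}\big(\bigoplus_{\lambda\in\Pi_{1.5}(n,r)}\check x_\lambda\check{\mathcal H}'\big)$ (right modules), and $\mathcal S_q^{1.5}(n,r)=\mathcal S_q^{1.5}(n,r;\mathcal Z)$. *)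

theory Defs
  imports
    Complex_Main
    "HOL-Library.Poly_Mapping"
    "HOL-Library.Function_Algebras"
    "HOL-Computational_Algebra.Group_Closure"
    "HOL-Combinatorics.Perm"
    "HOL-Algebra.Module"
    "HOL-Algebra.QuotRing"
begin

unbundle permutation_syntax

text \<open>
  The group of type B is realised as the signed permutations, inside the finitely supported
  permutations of the integers; \<open>sgen 0\<close> is the sign change of \<open>1\<close> and
  \<open>sgen i\<close> exchanges \<open>i\<close> with \<open>i + 1\<close> and \<open>-i\<close> with \<open>-(i + 1)\<close>.
\<close>

definition sgen :: "nat \<Rightarrow> int perm" where
  "sgen i = (if i = 0 then \<langle>1 \<leftrightarrow> - 1\<rangle>
     else \<langle>int i \<leftrightarrow> int i + 1\<rangle> * \<langle>- int i \<leftrightarrow> - (int i + 1)\<rangle>)"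

text \<open>
  All generating sets below consist of involutions, so the set of all products of generators
  (the generated submonoid) is the generated subgroup.
\<close>

definition generated :: "int perm set \<Rightarrow> int perm set" where
  "generated X = prod_list ` lists X"

fun tref :: "nat \<Rightarrow> int perm" where
  "tref i = (if i \<le> 1 then sgen 0 else sgen (i - 1) * tref (i - 1) * sgen (i - 1))"

declare tref.simps [simp del]

definition uelt :: "nat \<Rightarrow> int perm" where
  "uelt i = tref 1 * tref i"

definition dgens :: "nat \<Rightarrow> int perm set" where
  "dgens r = insert (sgen 0 * sgen 1 * sgen 0) (sgen ` {1..<r})"

definition dgroup :: "nat \<Rightarrow> int perm set" where
  "dgroup r = generated (dgens r)"

definition dlength :: "nat \<Rightarrow> int perm \<Rightarrow> nat" where
  "dlength r w = (LEAST k. \<exists>xs \<in> lists (dgens r). length xs = k \<and> prod_list xs = w)"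

definition reduced_word :: "nat \<Rightarrow> int perm \<Rightarrow> int perm list" where
  "reduced_word r w =
     (SOME xs. xs \<in> lists (dgens r) \<and> length xs = dlength r w \<and> prod_list xs = w)"

text \<open>
  The group \<open>dgroup r\<close> is finite, so the sums over it below are genuine.
\<close>

lemma sgen_apply_outside:
  assumes "i < r" "int r < \<bar>a\<bar>"
  shows "sgen i \<langle>$\<rangle> a = a"
  using assms by (auto simp: sgen_def apply_times)

lemma finite_perms_supported:
  assumes "finite A"
  shows "finite {w :: 'a perm. affected w \<subseteq> A}"
proof -
  have "inj_on (\<lambda>w :: 'a perm. restrict (apply w) A) {w. affected w \<subseteq> A}"
  proof (rule inj_onI, rule perm_eqI)
    fix v w :: "'a perm" and a
    assume *: "v \<in> {w. affected w \<subseteq> A}" "w \<in> {w. affected w \<subseteq> A}"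
      "restrict (apply v) A = restrict (apply w) A"
    show "v \<langle>$\<rangle> a = w \<langle>$\<rangle> a"
    proof (cases "a \<in> A")
      case True
      with *(3) show ?thesis by (metis restrict_apply')
    next
      case False
      with * show ?thesis by (metis in_affected mem_Collect_eq subsetD)
    qed
  qed
  moreover have "(\<lambda>w :: 'a perm. restrict (apply w) A) ` {w. affected w \<subseteq> A} \<subseteq> A \<rightarrow>\<^sub>E A"
  proof safe
    fix w :: "'a perm" and a
    assume w: "affected w \<subseteq> A" and a: "a \<in> A"
    have "w \<langle>$\<rangle> a \<in> A"
    proof (cases "w \<langle>$\<rangle> a = a")
      case False
      then have "w \<langle>$\<rangle> (w \<langle>$\<rangle> a) \<noteq> w \<langle>$\<rangle> a" by (simp add: apply_inj)
      with w show ?thesis by (auto simp: in_affected)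
    qed (use a in simp)
    then show "restrict (apply w) A a \<in> A" using a by simp
  qed (auto simp: restrict_def)
  ultimately show ?thesis
    using assms by (meson finite_PiE finite_imageD finite_subset)
qed

lemma finite_dgroup:
  assumes "1 < r"
  shows "finite (dgroup r)"
proof -
  have "prod_list xs \<langle>$\<rangle> a = a" if "xs \<in> lists (dgens r)" "int r < \<bar>a\<bar>" for xs a
    using that
  proof (induction xs)
    case (Cons x xs)
    then have "x \<langle>$\<rangle> a = a"
      using assms by (auto simp: dgens_def apply_times sgen_apply_outside[of _ r])
    with Cons show ?case by (simp add: apply_times)
  qed simp
  then have *: "w \<langle>$\<rangle> a = a" if "w \<in> dgroup r" "int r < \<bar>a\<bar>" for w a
    using that unfolding dgroup_def generated_def by blast
  have "affected w \<subseteq> {- int r..int r}" if "w \<in> dgroup r" for w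
  proof
    fix a assume "a \<in> affected w"
    with *[OF that] have "\<not> int r < \<bar>a\<bar>" by (auto simp: in_affected)
    then show "a \<in> {- int r..int r}" by auto
  qed
  then have "dgroup r \<subseteq> {w. affected w \<subseteq> {- int r..int r}}" by blast
  then show ?thesis
    by (rule finite_subset) (rule finite_perms_supported, simp)
qed

text \<open>
  Over a commutative ring \<open>'a\<close> with parameter \<open>q\<close>, the element with coordinates
  \<open>h w\<close> in the standard basis is the function \<open>h\<close>, vanishing outside \<open>dgroup r\<close>.
\<close>

definition hscale :: "'a::comm_ring_1 \<Rightarrow> ('i \<Rightarrow> 'a) \<Rightarrow> 'i \<Rightarrow> 'a" where
  "hscale c h = (\<lambda>w. c * h w)"

definition hecke :: "nat \<Rightarrow> (int perm \<Rightarrow> 'a::comm_ring_1) set" where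
  "hecke r = {h. \<forall>w. w \<notin> dgroup r \<longrightarrow> h w = 0}"

definition hT :: "int perm \<Rightarrow> int perm \<Rightarrow> 'a::comm_ring_1" where
  "hT w = (\<lambda>v. if v = w then 1 else 0)"

text \<open>
  If \<open>w * s\<close> is shorter than \<open>w\<close>, then
  \<open>T\<^sub>w T\<^sub>s = T\<^bsub>ws\<^esub> T\<^sub>s\<^sup>2 = q T\<^bsub>ws\<^esub> + (q - 1) T\<^sub>w\<close>.
\<close>

definition hmult_gen ::
  "nat \<Rightarrow> 'a::comm_ring_1 \<Rightarrow> (int perm \<Rightarrow> 'a) \<Rightarrow> int perm \<Rightarrow> int perm \<Rightarrow> 'a" where
  "hmult_gen r q h s = (\<Sum>w\<in>dgroup r. hscale (h w)
     (if dlength r w < dlength r (w * s) then hT (w * s)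
      else hscale q (hT (w * s)) + hscale (q - 1) (hT w)))"

text \<open>
  As \<open>T\<^sub>y\<close> is the product of the \<open>T\<^sub>s\<close> along a reduced word of \<open>y\<close>, right multiplication
  by \<open>T\<^sub>y\<close> is the composite of the corresponding \<open>hmult_gen\<close>; by Matsumoto's theorem it does
  not depend on the reduced word chosen.
\<close>

definition hmult ::
  "nat \<Rightarrow> 'a::comm_ring_1 \<Rightarrow> (int perm \<Rightarrow> 'a) \<Rightarrow> (int perm \<Rightarrow> 'a) \<Rightarrow> int perm \<Rightarrow> 'a" where
  "hmult r q g h = (\<Sum>y\<in>dgroup r. hscale (h y) (foldl (hmult_gen r q) g (reduced_word r y)))"

text \<open>
  The ring of Laurent polynomials is the group ring of the integers, i.e. the finitely
  supported functions under convolution.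
\<close>

type_synonym laurent = "int \<Rightarrow>\<^sub>0 int"

definition laurent_q :: laurent where
  "laurent_q = Poly_Mapping.single 1 1"

text \<open>
  Scalar extension along a ring homomorphism \<open>\<phi>\<close> acts on coordinates.  It carries the structure
  constants for parameter \<open>q\<close> to those for parameter \<open>\<phi> q\<close>, so \<open>hecke r\<close> over
  \<open>'a\<close> with \<open>hmult r (\<phi> laurent_q)\<close> is the tensor product of the generic Hecke algebra
  with \<open>'a\<close>, in coordinates with respect to the standard basis.
\<close>

lemma hmult_base_change:
  fixes \<phi> :: "'z::comm_ring_1 \<Rightarrow> 'a::comm_ring_1"
  assumes one: "\<phi> 1 = 1" and add: "\<And>x y. \<phi> (x + y) = \<phi> x + \<phi> y"
    and mult: "\<And>x y. \<phi> (x * y) = \<phi> x * \<phi> y"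
  shows "\<phi> \<circ> hmult r q g h = hmult r (\<phi> q) (\<phi> \<circ> g) (\<phi> \<circ> h)"
proof -
  have zero: "\<phi> 0 = 0" using add[of 0 0] by simp
  have diff: "\<phi> (x - y) = \<phi> x - \<phi> y" for x y using add[of "x - y" y] by simp
  have sum_apply: "(\<Sum>i\<in>A. f i) x = (\<Sum>i\<in>A. f i x)"
    for A :: "int perm set" and f :: "int perm \<Rightarrow> int perm \<Rightarrow> 'c::comm_ring_1" and x
    by (induction A rule: infinite_finite_induct) auto
  have sum: "\<phi> \<circ> (\<Sum>i\<in>A. f i) = (\<Sum>i\<in>A. \<phi> \<circ> f i)"
    for A :: "int perm set" and f :: "int perm \<Rightarrow> int perm \<Rightarrow> 'z"
    by (induction A rule: infinite_finite_induct) (auto simp: fun_eq_iff zero add)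
  have scale: "\<phi> \<circ> hscale c k = hscale (\<phi> c) (\<phi> \<circ> k)" for c and k :: "int perm \<Rightarrow> 'z"
    by (auto simp: hscale_def mult)
  have T: "\<phi> \<circ> hT w = hT w" for w
    by (auto simp: hT_def one zero)
  have plus: "\<phi> \<circ> (k + l) = (\<phi> \<circ> k) + (\<phi> \<circ> l)" for k l :: "int perm \<Rightarrow> 'z"
    by (auto simp: add)
  have gen: "\<phi> \<circ> hmult_gen r q k s = hmult_gen r (\<phi> q) (\<phi> \<circ> k) s" for k s
    unfolding hmult_gen_def sum
    by (rule sum.cong) (auto simp: scale T plus diff one)
  have "\<phi> \<circ> foldl (hmult_gen r q) k xs = foldl (hmult_gen r (\<phi> q)) (\<phi> \<circ> k) xs" for k xs
    by (induction xs arbitrary: k) (auto simp: gen)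
  then show ?thesis
    by (auto simp: hmult_def sum scale)
qed

definition compositions :: "nat \<Rightarrow> nat \<Rightarrow> nat list set" where
  "compositions m k = {xs. length xs = m \<and> sum_list xs = k}"

type_synonym bicomp = "nat list \<times> nat list"

definition Pi2 :: "nat \<Rightarrow> nat \<Rightarrow> bicomp set" where
  "Pi2 n r = (\<Union>(r1, r2) \<in> {(r1, r2). r1 + r2 = r}.
     compositions (max n r) r1 \<times> compositions n r2)"

definition Pi15 :: "nat \<Rightarrow> nat \<Rightarrow> bicomp set" where
  "Pi15 n r = {l \<in> Pi2 n r. sum_list (fst l) \<ge> sum_list (snd l)}"

text \<open>
  The Young subgroup of a composition of \<open>r\<close> omits exactly the \<open>sgen i\<close> for which \<open>i\<close>
  is a partial sum of the composition.
\<close>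

definition young :: "nat \<Rightarrow> nat list \<Rightarrow> int perm set" where
  "young r c = generated (sgen ` ({1..<r} - (\<lambda>k. sum_list (take k c)) ` {..length c}))"

definition xbar :: "nat \<Rightarrow> bicomp \<Rightarrow> int perm \<Rightarrow> 'a::comm_ring_1" where
  "xbar r l = (\<Sum>w\<in>young r (fst l @ snd l). hT w)"

definition hpi :: "nat \<Rightarrow> 'a::comm_ring_1 \<Rightarrow> nat \<Rightarrow> int perm \<Rightarrow> 'a" where
  "hpi r q a = foldl (\<lambda>h i. hmult r q h (hscale (q ^ (i - 1)) (hT 1) + hT (uelt i)))
     (hT 1) [2..<Suc a]"

definition xcheck :: "nat \<Rightarrow> 'a::comm_ring_1 \<Rightarrow> bicomp \<Rightarrow> int perm \<Rightarrow> 'a" where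
  "xcheck r q l = hmult r q (hpi r q (sum_list (fst l))) (xbar r l)"

text \<open>
  Elements of the direct sum are families of Hecke algebra elements which are zero outside the
  index set.
\<close>

type_synonym 'a family = "bicomp \<Rightarrow> int perm \<Rightarrow> 'a"

definition xsum :: "nat \<Rightarrow> nat \<Rightarrow> 'a::comm_ring_1 \<Rightarrow> 'a family set" where
  "xsum n r q = {v. (\<forall>l\<in>Pi15 n r. v l \<in> hmult r q (xcheck r q l) ` hecke r) \<and>
                    (\<forall>l. l \<notin> Pi15 n r \<longrightarrow> v l = 0)}"

definition fam_scale :: "'a::comm_ring_1 \<Rightarrow> 'a family \<Rightarrow> 'a family" where
  "fam_scale c v = (\<lambda>l. hscale c (v l))"

definition fam_act :: "nat \<Rightarrow> 'a::comm_ring_1 \<Rightarrow> 'a family \<Rightarrow> (int perm \<Rightarrow> 'a) \<Rightarrow> 'a family" where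
  "fam_act r q v h = (\<lambda>l. hmult r q (v l) h)"

text \<open>
  Endomorphisms of \<open>xsum n r q\<close> are represented by functions which take the value zero outside
  \<open>xsum n r q\<close>; this makes the representation unique, and compatible with pointwise addition,
  scaling and composition.  Linearity over the scalars is the case of multiples of \<open>hT 1\<close>.
\<close>

type_synonym 'a endo = "'a family \<Rightarrow> 'a family"

definition endos :: "nat \<Rightarrow> nat \<Rightarrow> 'a::comm_ring_1 \<Rightarrow> 'a endo set" where
  "endos n r q = {F. (\<forall>v\<in>xsum n r q. F v \<in> xsum n r q) \<and>
     (\<forall>v\<in>xsum n r q. \<forall>w\<in>xsum n r q. F (v + w) = F v + F w) \<and>
     (\<forall>v\<in>xsum n r q. \<forall>h\<in>hecke r. F (fam_act r q v h) = fam_act r q (F v) h) \<and>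
     (\<forall>v. v \<notin> xsum n r q \<longrightarrow> F v = 0)}"

definition endo_scale :: "'a::comm_ring_1 \<Rightarrow> 'a endo \<Rightarrow> 'a endo" where
  "endo_scale c F = (\<lambda>v. fam_scale c (F v))"

lemma module_endo_scale: "Modules.module endo_scale"
  by unfold_locales
    (auto simp: endo_scale_def fam_scale_def hscale_def fun_eq_iff algebra_simps)

definition schur15 :: "nat \<Rightarrow> nat \<Rightarrow> 'a::comm_ring_1 \<Rightarrow> ('a, 'a endo) module" where
  "schur15 n r q = \<lparr>carrier = endos n r q, mult = (\<circ>),
     one = (\<lambda>v. if v \<in> xsum n r q then v else 0),
     zero = 0, add = (+), smult = endo_scale\<rparr>"

text \<open>
  For an algebra \<open>A\<close> over \<open>'z\<close> and a ring homomorphism \<open>\<phi>\<close> from \<open>'z\<close> to \<open>'a\<close>,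
  the tensor product of \<open>A\<close> with \<open>'a\<close> is the free abelian group on pairs \<open>(x, a)\<close>
  modulo the usual bilinearity and balancing relations; its elements are the congruence classes.
\<close>

definition tensor_relators ::
  "('z \<Rightarrow> 'a::comm_ring_1) \<Rightarrow> ('z, 's) module \<Rightarrow> ('s \<times> 'a \<Rightarrow>\<^sub>0 int) set" where
  "tensor_relators \<phi> A =
     {frag_of (x \<oplus>\<^bsub>A\<^esub> y, a) - frag_of (x, a) - frag_of (y, a) | x y a.
        x \<in> carrier A \<and> y \<in> carrier A} \<union>
     {frag_of (x, a + b) - frag_of (x, a) - frag_of (x, b) | x a b. x \<in> carrier A} \<union>
     {frag_of (c \<odot>\<^bsub>A\<^esub> x, a) - frag_of (x, \<phi> c * a) | c x a. x \<in> carrier A}"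

definition tensor_free :: "('z, 's) module \<Rightarrow> ('s \<times> 'a \<Rightarrow>\<^sub>0 int) set" where
  "tensor_free A = {X. Poly_Mapping.keys X \<subseteq> carrier A \<times> UNIV}"

definition tensor_cong ::
  "('z \<Rightarrow> 'a::comm_ring_1) \<Rightarrow> ('z, 's) module \<Rightarrow> ('s \<times> 'a \<Rightarrow>\<^sub>0 int) rel" where
  "tensor_cong \<phi> A = {(X, Y). X \<in> tensor_free A \<and> Y \<in> tensor_free A \<and>
     X - Y \<in> group_closure (tensor_relators \<phi> A)}"

definition pure_tensor ::
  "('z \<Rightarrow> 'a::comm_ring_1) \<Rightarrow> ('z, 's) module \<Rightarrow> 's \<Rightarrow> 'a \<Rightarrow> ('s \<times> 'a \<Rightarrow>\<^sub>0 int) set" where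
  "pure_tensor \<phi> A x a = tensor_cong \<phi> A `` {frag_of (x, a)}"

definition free_mult ::
  "('z, 's) module \<Rightarrow> ('s \<times> 'a::comm_ring_1 \<Rightarrow>\<^sub>0 int) \<Rightarrow> ('s \<times> 'a \<Rightarrow>\<^sub>0 int) \<Rightarrow> ('s \<times> 'a \<Rightarrow>\<^sub>0 int)" where
  "free_mult A X Y =
     frag_extend (\<lambda>(x, a). frag_extend (\<lambda>(y, b). frag_of (x \<otimes>\<^bsub>A\<^esub> y, a * b)) Y) X"

definition free_smult :: "'a::comm_ring_1 \<Rightarrow> ('s \<times> 'a \<Rightarrow>\<^sub>0 int) \<Rightarrow> ('s \<times> 'a \<Rightarrow>\<^sub>0 int)" where
  "free_smult c X = frag_extend (\<lambda>(x, a). frag_of (x, c * a)) X"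

definition base_change ::
  "('z \<Rightarrow> 'a::comm_ring_1) \<Rightarrow> ('z, 's) module \<Rightarrow> ('a, ('s \<times> 'a \<Rightarrow>\<^sub>0 int) set) module" where
  "base_change \<phi> A = \<lparr>carrier = tensor_free A // tensor_cong \<phi> A,
     mult = (\<lambda>P Q. \<Union>X\<in>P. \<Union>Y\<in>Q. tensor_cong \<phi> A `` {free_mult A X Y}),
     one = pure_tensor \<phi> A \<one>\<^bsub>A\<^esub> 1,
     zero = tensor_cong \<phi> A `` {0},
     add = (\<lambda>P Q. \<Union>X\<in>P. \<Union>Y\<in>Q. tensor_cong \<phi> A `` {X + Y}),
     smult = (\<lambda>c P. \<Union>X\<in>P. tensor_cong \<phi> A `` {free_smult c X})\<rparr>"

definition fam_map :: "('z \<Rightarrow> 'a) \<Rightarrow> 'z family \<Rightarrow> 'a family" where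
  "fam_map \<phi> v = (\<lambda>l w. \<phi> (v l w))"

end

theory Submission
  imports Defs
begin

text \<open>
  For \<open>a = |\<lambda>\<^sup>(\<^sup>1\<^sup>)|\<close> the element \<open>\<pi>\<^sub>a\<close> commutes with \<open>T\<^bsub>s\<^sub>i\<^esub>\<close> for \<open>i \<noteq> a\<close> and satisfies \<open>T\<^sub>u \<pi>\<^sub>a = T\<^bsub>s\<^sub>1\<^esub> \<pi>\<^sub>a\<close>.
  These properties characterise the ideals generated by \<open>\<pi>\<^sub>a\<close>: an element \<open>z\<close> is a left multiple of \<open>\<pi>\<^sub>a\<close> if and only if
  \<open>T\<^sub>u\<close> and \<open>T\<^bsub>s\<^sub>1\<^esub>\<close> act in the same way on all \<open>z h\<close> with \<open>h\<close> in the Hecke algebra of the parabolic subgroup of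
  type \<open>D\<^sub>a \<times> A\<^bsub>r-a-1\<^esub>\<close>.  With the equations \<open>z T\<^sub>s = q z\<close> for \<open>s\<close> in the Young subgroup of \<open>\<lambda>\<close> added, the
  solutions are the left multiples of \<open>x\<^sub>\<lambda>\<close>.  Homomorphisms from \<open>x\<^sub>\<lambda> H\<close> to \<open>x\<^sub>\<mu> H\<close> are therefore the solutions of a
  system of linear equations, the one for \<open>\<lambda>\<close> from the right and the one for \<open>\<mu>\<close> from the left.

  A solution is determined by its coefficients at suitable representatives of double cosets modulo even sign
  changes, since the equations allow to propagate zeros with pivots \<open>1\<close> and \<open>q\<close>; and these coefficients can
  be prescribed arbitrarily, subject to being constant on the orbits of the Young subgroups.  The coefficients at
  one representative of each orbit are thus coordinates on the homomorphisms over every coefficient ring in which \<open>q\<close>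
  is a unit, and they are compatible with base change.
\<close>

section \<open>Inversions and the length function\<close>

text \<open>Endomorphisms form the kernel of a linear system, and kernels need not commute with base
  change; here they do, because elimination uses only unit pivots. The annihilator of a generator is
  never computed. A homomorphism is known by the image z of the generator for \<lambda>; relations
  that the generator satisfies from the right pass to z, and the equations for \<lambda> are such
  relations. Conversely every solution is g times the generator for some g, and left multiplication
  by g is the homomorphism. This factorisation comes from constructing enough solutions that are
  visibly multiples: a solution vanishing on the representatives is zero, so the constructed ones
  span. The representatives are defined in the group alone, hence are the same for all coefficient
  rings. The equations make \<open>gen 0\<close> and \<open>gen 1\<close> act alike and are stable
  under the generators other than \<open>gen a\<close>; with \<open>a = 1\<close> one of the two
  would be missing. This is where \<open>4 \<le> r\<close> enters: it gives \<open>2 \<le> a\<close>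
  for all indices in \<open>Pi15\<close>. The value \<open>a = 0\<close> switches the equations of
  one side off.\<close>

lemma apply_swap_if: "\<langle>a \<leftrightarrow> b\<rangle> \<langle>$\<rangle> x = (if x = a then b else if x = b then a else x)"
  by transfer (simp add: transpose_def)

text \<open>
  Write \<open>e\<^sub>i\<close> for the standard basis and \<open>e\<^bsub>-i\<^esub> = - e\<^sub>i\<close>.  The generator \<open>gen 0\<close> is the element \<open>u\<close>, and
  \<open>gen k\<close> is the reflection in the simple root \<open>e\<^bsub>hi k\<^esub> - e\<^bsub>lo k\<^esub>\<close>, so that \<open>up x k\<close> says that
  \<open>x * gen k\<close> is longer than \<open>x\<close>.
\<close>

definition gen :: "nat \<Rightarrow> int perm" where
  "gen k = (if k = 0 then sgen 0 * sgen 1 * sgen 0 else sgen k)"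

definition lo :: "nat \<Rightarrow> int" where
  "lo k = (if k = 0 then - 1 else int k)"

definition hi :: "nat \<Rightarrow> int" where
  "hi k = (if k = 0 then 2 else int k + 1)"

definition up :: "int perm \<Rightarrow> nat \<Rightarrow> bool" where
  "up x k \<longleftrightarrow> x \<langle>$\<rangle> (lo k) < x \<langle>$\<rangle> (hi k)"

lemma apply_sgen0: "sgen 0 \<langle>$\<rangle> x = (if \<bar>x\<bar> = 1 then - x else x)"
  by (auto simp: sgen_def apply_swap_if)

lemma apply_gen:
  "gen k \<langle>$\<rangle> x = (if x = lo k then hi k else if x = hi k then lo k
     else if x = - lo k then - hi k else if x = - hi k then - lo k else x)"
  by (auto simp: gen_def sgen_def lo_def hi_def apply_times apply_swap_if)

lemma gen_gen [simp]: "gen k * gen k = 1"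
  by (rule perm_eqI) (auto simp: apply_times apply_gen lo_def hi_def)

lemma gen_gen_left [simp]: "gen k * (gen k * x) = x"
  by (simp flip: mult.assoc)

lemma gen_gen_right [simp]: "x * gen k * gen k = x"
  by (simp add: mult.assoc)

lemma inverse_gen [simp]: "inverse (gen k) = gen k"
  by (metis gen_gen perm.left_inverse mult.assoc mult_1 mult_1_right)

lemma sgen0_sgen0 [simp]: "sgen 0 * sgen 0 = 1"
  by (rule perm_eqI) (auto simp: apply_times apply_sgen0)

lemma inverse_sgen0 [simp]: "inverse (sgen 0) = sgen 0"
  by (metis sgen0_sgen0 perm.left_inverse mult.assoc mult_1 mult_1_right)

lemma gen_ne_one [simp]: "gen k \<noteq> 1"
proof
  assume "gen k = 1"
  then have "gen k \<langle>$\<rangle> (lo k) = lo k" by simp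
  then show False by (auto simp: apply_gen lo_def hi_def split: if_splits)
qed

lemma dgens_eq: "0 < r \<Longrightarrow> dgens r = gen ` {..<r}"
  unfolding dgens_def by (auto simp: gen_def image_iff Bex_def)

text \<open>A simple reflection permutes the positive roots other than its own. A pair
  \<open>a < b\<close> stands for the positive root \<open>e_b - e_a\<close>; the two excluded pairs
  are the two names of the simple root.\<close>

lemma gen_mono:
  assumes "a < b" "a \<noteq> 0" "b \<noteq> 0" "a + b \<noteq> 0" "(a, b) \<noteq> (lo k, hi k)" "(a, b) \<noteq> (- hi k, - lo k)"
  shows "gen k \<langle>$\<rangle> a < gen k \<langle>$\<rangle> b"
  using assms unfolding apply_gen lo_def hi_def prod.inject by (cases "k = 0") (simp_all, smt+)

lemma lo_hi:
  "lo k \<noteq> 0" "hi k \<noteq> 0" "lo k < hi k" "lo k + hi k \<noteq> 0" "lo k \<noteq> - lo k" "hi k \<noteq> - hi k"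
  "lo k \<noteq> - hi k" "hi k \<noteq> - lo k" "lo k \<noteq> hi k"
  by (auto simp: lo_def hi_def)

text \<open>The whole group of type B, not only \<open>dgroup r\<close>: products such as
  \<open>tw \<epsilon> * x * tw \<delta>\<close> below may have an odd number of sign changes and
  need the same lemmas.\<close>

definition signed :: "nat \<Rightarrow> int perm set" where
  "signed r = {w. (\<forall>i. w \<langle>$\<rangle> (- i) = - (w \<langle>$\<rangle> i)) \<and> (\<forall>i. int r < \<bar>i\<bar> \<longrightarrow> w \<langle>$\<rangle> i = i)}"

lemma signed_minus: "w \<in> signed r \<Longrightarrow> w \<langle>$\<rangle> (- i) = - (w \<langle>$\<rangle> i)"
  by (simp add: signed_def)

lemma signed_zero [simp]: "w \<in> signed r \<Longrightarrow> w \<langle>$\<rangle> 0 = 0"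
  using signed_minus[of w r 0] by simp

lemma signed_eq_0_iff [simp]: "w \<in> signed r \<Longrightarrow> w \<langle>$\<rangle> i = 0 \<longleftrightarrow> i = 0"
  by (metis apply_inj signed_zero)

lemma signed_outside: "w \<in> signed r \<Longrightarrow> int r < \<bar>i\<bar> \<Longrightarrow> w \<langle>$\<rangle> i = i"
  by (simp add: signed_def)

lemma signed_abs_eq: "w \<in> signed r \<Longrightarrow> \<bar>i\<bar> = \<bar>j\<bar> \<Longrightarrow> \<bar>w \<langle>$\<rangle> i\<bar> = \<bar>w \<langle>$\<rangle> j\<bar>"
  by (auto simp: abs_eq_iff signed_minus)

lemma signed_abs_eq_iff: "w \<in> signed r \<Longrightarrow> \<bar>w \<langle>$\<rangle> i\<bar> = \<bar>w \<langle>$\<rangle> j\<bar> \<longleftrightarrow> \<bar>i\<bar> = \<bar>j\<bar>"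
  by (simp add: abs_eq_iff apply_inj flip: signed_minus)

lemma signed_inside: "w \<in> signed r \<Longrightarrow> \<bar>w \<langle>$\<rangle> i\<bar> \<le> int r \<longleftrightarrow> \<bar>i\<bar> \<le> int r"
  by (metis apply_inj linorder_not_less signed_outside)

lemma one_signed [simp]: "1 \<in> signed r"
  by (simp add: signed_def)

lemma times_signed: "v \<in> signed r \<Longrightarrow> w \<in> signed r \<Longrightarrow> v * w \<in> signed r"
  by (simp add: signed_def apply_times)

lemma inverse_apply [simp]: "inverse w \<langle>$\<rangle> (w \<langle>$\<rangle> i) = i" "w \<langle>$\<rangle> (inverse w \<langle>$\<rangle> i) = i"
  for w :: "'a perm"
  using apply_times[of "inverse w" w, THEN fun_cong, of i] apply_times[of w
    "inverse w", THEN fun_cong, of i]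
  by simp_all

lemma inverse_signed:
  assumes w: "w \<in> signed r"
  shows "inverse w \<in> signed r"
proof -
  have "inverse w \<langle>$\<rangle> (- i) = - (inverse w \<langle>$\<rangle> i)" for i
    using signed_minus[OF w, of "inverse w \<langle>$\<rangle> i"] by (metis inverse_apply)
  moreover have "inverse w \<langle>$\<rangle> i = i" if "int r < \<bar>i\<bar>" for i
    using signed_outside[OF w that] by (metis inverse_apply(1))
  ultimately show ?thesis by (simp add: signed_def)
qed

lemma perm_cancel_left [simp]: "inverse w * (w * v) = v" "w * (inverse w * v) = v" for w v :: "'a perm"
  by (simp_all flip: mult.assoc)

lemma perm_cancel_right [simp]: "v * w * inverse w = v" "v * inverse w * w = v" for w v :: "'a perm"
  by (simp_all add: mult.assoc)

lemma gen_signed: "k < r \<Longrightarrow> 2 \<le> r \<Longrightarrow> gen k \<in> signed r"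
  by (auto simp: signed_def apply_gen lo_def hi_def)

lemma sgen0_signed: "1 \<le> r \<Longrightarrow> sgen 0 \<in> signed r"
  by (auto simp: signed_def apply_sgen0)

text \<open>
  The pairs \<open>(a, b)\<close> and \<open>(- b, - a)\<close> stand for the same root, so the cardinality below is twice the length.
\<close>

definition Inv :: "nat \<Rightarrow> int perm \<Rightarrow> (int \<times> int) set" where
  "Inv r x = {(a, b). a < b \<and> a \<noteq> 0 \<and> b \<noteq> 0 \<and> a + b \<noteq> 0 \<and> \<bar>a\<bar> \<le> int r \<and> \<bar>b\<bar> \<le> int r \<and>
     x \<langle>$\<rangle> b < x \<langle>$\<rangle> a}"

lemma finite_Inv [simp]: "finite (Inv r x)"
  by (rule finite_subset[of _ "{- int r..int r} \<times> {- int r..int r}"]) (auto simp: Inv_def)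

text \<open>Relabelling pairs by \<open>gen k\<close> matches the inversions of \<open>x\<close>
  with those of \<open>x * gen k\<close> other than the simple root, which becomes an inversion.
  Both names of that root are counted, whence \<open>2\<close>.\<close>

lemma card_Inv_up:
  assumes x: "x \<in> signed r" and k: "k < r" and r: "2 \<le> r" and u: "up x k"
  shows "card (Inv r (x * gen k)) = card (Inv r x) + 2"
proof -
  let ?g = "gen k"
  let ?m = "map_prod (apply ?g) (apply ?g)"
  let ?D = "{(lo k, hi k), (- hi k, - lo k)}"
  have gs: "?g \<in> signed r" using k r by (rule gen_signed)
  have gg: "?g \<langle>$\<rangle> (?g \<langle>$\<rangle> i) = i" for i
    using apply_times[of ?g ?g, THEN fun_cong, of i] by simp
  have inj: "inj ?m" by (rule prod.inj_map) (auto intro: injI simp: apply_inj)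
  have bnd: "\<bar>lo k\<bar> \<le> int r" "\<bar>hi k\<bar> \<le> int r" using k r by (auto simp: lo_def hi_def)
  have ulo: "?g \<langle>$\<rangle> (lo k) = hi k" "?g \<langle>$\<rangle> (hi k) = lo k" "?g \<langle>$\<rangle> (- lo k) = - hi k"
    "?g \<langle>$\<rangle> (- hi k) = - lo k"
    by (auto simp: apply_gen lo_def hi_def)
  have D: "?D \<subseteq> Inv r (x * ?g)" "Inv r x \<inter> ?D = {}"
    using lo_hi[of k] bnd u by (auto simp: Inv_def apply_times ulo up_def signed_minus[OF x])
  have sub: "?m p \<in> Inv r y" if "p \<in> Inv r (y * ?g)" "p \<notin> ?D" for p y
  proof -
    obtain a b where p: "p = (a, b)" by fastforce
    have ab: "a < b" "a \<noteq> 0" "b \<noteq> 0" "a + b \<noteq> 0" "\<bar>a\<bar> \<le> int r" "\<bar>b\<bar> \<le> int r"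
      "y \<langle>$\<rangle> (?g \<langle>$\<rangle> b) < y \<langle>$\<rangle> (?g \<langle>$\<rangle> a)"
      using that p by (auto simp: Inv_def apply_times)
    have "?g \<langle>$\<rangle> a < ?g \<langle>$\<rangle> b" using ab that p by (intro gen_mono) auto
    moreover have "?g \<langle>$\<rangle> a + ?g \<langle>$\<rangle> b \<noteq> 0"
    proof
      assume "?g \<langle>$\<rangle> a + ?g \<langle>$\<rangle> b = 0"
      then have "?g \<langle>$\<rangle> a = ?g \<langle>$\<rangle> (- b)" by (simp add: signed_minus[OF gs])
      then show False using ab by (simp add: apply_inj)
    qed
    ultimately show ?thesis using ab gs by (simp add: p Inv_def signed_inside)
  qed
  \<comment> \<open>\<open>?m\<close> reaches \<open>?D\<close> only from the reversed pairs, and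
    these violate \<open>a < b\<close>, so no inversion is sent there.\<close>
  have mD: "?m p \<in> ?D \<longleftrightarrow> ?m p \<in> ?D \<and> p \<in> {(hi k, lo k), (- lo k, - hi k)}" for p
    using gg[of "fst p"] gg[of "snd p"] by (cases p) (auto simp: ulo)
  have "?m ` (Inv r (x * ?g) - ?D) = Inv r x"
  proof (intro equalityI subsetI)
    fix p assume "p \<in> ?m ` (Inv r (x * ?g) - ?D)"
    then obtain p' where p': "p = ?m p'" "p' \<in> Inv r (x * ?g)" "p' \<notin> ?D"
      by (elim imageE DiffE)
    show "p \<in> Inv r x" unfolding p'(1) using p'(2,3) by (rule sub)
  next
    fix p assume p: "p \<in> Inv r x"
    then have pD: "p \<notin> ?D" using D by blast
    have "p \<in> Inv r ((x * ?g) * ?g)" using p by simp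
    then have "?m p \<in> Inv r (x * ?g)" using pD by (rule sub)
    moreover have "?m p \<notin> ?D"
    proof
      assume "?m p \<in> ?D"
      then have "p \<in> {(hi k, lo k), (- lo k, - hi k)}" using mD by blast
      then show False using p lo_hi[of k] by (auto simp: Inv_def)
    qed
    moreover have "p = ?m (?m p)" by (cases p) (simp add: gg)
    ultimately show "p \<in> ?m ` (Inv r (x * ?g) - ?D)" by blast
  qed
  then have "card (Inv r x) = card (Inv r (x * ?g) - ?D)"
    by (metis card_image inj inj_on_subset subset_UNIV)
  also have "\<dots> = card (Inv r (x * ?g)) - card ?D"
    by (rule card_Diff_subset) (use D in auto)
  also have "card ?D = 2" using lo_hi[of k] by auto
  finally show ?thesis
    using card_mono[OF finite_Inv D(1)] \<open>card ?D = 2\<close> by linarith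
qed

lemma up_gen_iff: "up (x * gen k) k \<longleftrightarrow> \<not> up x k"
proof -
  have "gen k \<langle>$\<rangle> (lo k) = hi k" "gen k \<langle>$\<rangle> (hi k) = lo k" by (auto simp: apply_gen lo_def hi_def)
  moreover have "x \<langle>$\<rangle> (lo k) \<noteq> x \<langle>$\<rangle> (hi k)" using lo_hi[of k] by (simp add: apply_inj)
  ultimately show ?thesis by (auto simp: up_def apply_times)
qed

lemma card_Inv_down:
  assumes "x \<in> signed r" "k < r" "2 \<le> r" "\<not> up x k"
  shows "card (Inv r x) = card (Inv r (x * gen k)) + 2"
  using card_Inv_up[of "x * gen k" r k] assms
  by (simp add: times_signed gen_signed up_gen_iff)

lemma Inv_one [simp]: "Inv r 1 = {}"
  by (auto simp: Inv_def)

text \<open>This character cuts type D out of type B. Without it the absence of descents would not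
  force the identity: \<open>sgen 0\<close> goes up at every generator.\<close>

definition sign_product :: "nat \<Rightarrow> int perm \<Rightarrow> int" where
  "sign_product r x = (\<Prod>i\<in>{1..int r}. sgn (x \<langle>$\<rangle> i))"

lemma sign_product_gen:
  assumes x: "x \<in> signed r" and k: "k < r" and r: "2 \<le> r"
  shows "sign_product r (x * gen k) = sign_product r x"
proof (cases "k = 0")
  case True
  have split: "{1..int r} = insert 1 (insert 2 {3..int r})" using r by auto
  have "(\<Prod>i\<in>{3..int r}. sgn (x \<langle>$\<rangle> (gen 0 \<langle>$\<rangle> i))) = (\<Prod>i\<in>{3..int r}. sgn (x \<langle>$\<rangle> i))"
    by (rule prod.cong) (auto simp: apply_gen lo_def hi_def)
  moreover have "gen 0 \<langle>$\<rangle> 1 = - 2" "gen 0 \<langle>$\<rangle> 2 = - 1" by (auto simp: apply_gen lo_def hi_def)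
  ultimately show ?thesis
    unfolding sign_product_def split True
    by (simp add: apply_times signed_minus[OF x] sgn_minus)
next
  case False
  have "bij_betw (apply (gen k)) {1..int r} {1..int r}"
    by (rule bij_betw_byWitness[of _ "apply (gen k)"])
      (use False k r in \<open>auto simp: apply_gen lo_def hi_def split: if_splits\<close>)
  then show ?thesis
    unfolding sign_product_def
    by (simp add: apply_times prod.reindex_bij_betw[of _ _ _ "\<lambda>i. sgn (x \<langle>$\<rangle> i)"])
qed

text \<open>The ascents give |x 1| < x 2 < ... < x r. Induction from below and the bound
  \<open>r\<close> from above squeeze the values at the places from \<open>2\<close> on, only the
  sign of the value at \<open>1\<close> remains open, and \<open>sp\<close> settles it.\<close>

lemma no_descent_eq_one:
  assumes x: "x \<in> signed r" and r: "2 \<le> r" and sp: "sign_product r x = 1"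
    and up: "\<And>k. k < r \<Longrightarrow> up x k"
  shows "x = 1"
proof -
  have step: "x \<langle>$\<rangle> (int k) < x \<langle>$\<rangle> (int k + 1)" if "1 \<le> k" "k < r" for k
    using up[of k] that by (simp add: up_def lo_def hi_def)
  have abs2: "\<bar>x \<langle>$\<rangle> 1\<bar> < x \<langle>$\<rangle> 2"
    using up[of 0] step[of 1] r by (simp add: up_def lo_def hi_def signed_minus[OF x])
  have pos: "x \<langle>$\<rangle> (int k) \<ge> int k" if "2 \<le> k" "k \<le> r" for k
    using that
  proof (induction k rule: dec_induct)
    case base
    have "x \<langle>$\<rangle> 1 \<noteq> 0" using x by simp
    with abs2 show ?case by simp
  next
    case (step n)
    then show ?case using \<open>\<And>k. \<lbrakk>1 \<le> k; k < r\<rbrakk> \<Longrightarrow> x \<langle>$\<rangle> (int k) < x \<langle>$\<rangle> (int k + 1)\<close>[of n]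
      by (simp add: add.commute)
  qed
  have fix_ge: "x \<langle>$\<rangle> (int k) = int k" if "2 \<le> k" "k \<le> r" for k
  proof -
    have "x \<langle>$\<rangle> (int (r - j)) \<le> int (r - j)" if "j \<le> r - 2" for j
      using that
    proof (induction j)
      case 0
      then show ?case using signed_inside[OF x, of "int r"] by simp
    next
      case (Suc j)
      have "x \<langle>$\<rangle> (int (r - Suc j)) < x \<langle>$\<rangle> (int (r - Suc j) + 1)" by (rule step) (use Suc r in auto)
      moreover have "int (r - Suc j) + 1 = int (r - j)" using Suc r by auto
      ultimately show ?case using Suc by simp
    qed
    from this[of "r - k"] pos[of k] that show ?thesis by simp
  qed
  have "\<bar>x \<langle>$\<rangle> 1\<bar> < 2" using abs2 fix_ge[of 2] r by simp
  moreover have "x \<langle>$\<rangle> 1 \<noteq> 0" using x by simp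
  ultimately have x1: "x \<langle>$\<rangle> 1 = 1 \<or> x \<langle>$\<rangle> 1 = - 1" by linarith
  have split: "{1..int r} = insert 1 {2..int r}" using r by auto
  have fi: "x \<langle>$\<rangle> i = i" if "2 \<le> i" "i \<le> int r" for i
    using fix_ge[of "nat i"] that by simp
  have "(\<Prod>i\<in>{2..int r}. sgn (x \<langle>$\<rangle> i)) = 1"
    by (rule prod.neutral) (auto simp: fi)
  then have "sgn (x \<langle>$\<rangle> 1) = 1"
    using sp unfolding sign_product_def split by simp
  with x1 have x1': "x \<langle>$\<rangle> 1 = 1" by auto
  have nonneg: "x \<langle>$\<rangle> i = i" if i0: "0 \<le> i" for i
  proof -
    consider "i = 0" | "i = 1" | "2 \<le> i" "i \<le> int r" | "int r < \<bar>i\<bar>" using i0 by linarith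
    then show ?thesis by cases (use x x1' fi signed_outside in auto)
  qed
  show ?thesis
  proof (rule perm_eqI)
    fix i show "x \<langle>$\<rangle> i = 1 \<langle>$\<rangle> i"
      using nonneg[of i] nonneg[of "- i"] signed_minus[OF x, of i] by (cases "0 \<le> i") auto
  qed
qed

section \<open>Words, lengths and descents in the group of type D\<close>

locale type_D =
  fixes r :: nat
  assumes r2: "2 \<le> r"
begin

lemma dgens: "dgens r = gen ` {..<r}"
  using r2 by (intro dgens_eq) simp

lemma one_dgroup [simp]: "1 \<in> dgroup r"
  unfolding dgroup_def generated_def by (rule image_eqI[of _ _ "[]"]) auto

lemma gen_dgroup: "k < r \<Longrightarrow> gen k \<in> dgroup r"
  unfolding dgroup_def generated_def by (rule image_eqI[of _ _ "[gen k]"]) (auto simp: dgens)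

lemma times_dgroup: "v \<in> dgroup r \<Longrightarrow> w \<in> dgroup r \<Longrightarrow> v * w \<in> dgroup r"
  unfolding dgroup_def generated_def
  by (clarsimp, rule_tac x = "x @ xa" in image_eqI) auto

lemma dgroup_induct [consumes 1, case_names one step]:
  assumes "w \<in> dgroup r" "P 1" "\<And>v k. v \<in> dgroup r \<Longrightarrow> P v \<Longrightarrow> k < r \<Longrightarrow> P (v * gen k)"
  shows "P w"
proof -
  obtain xs where xs: "xs \<in> lists (dgens r)" "w = prod_list xs"
    using assms(1) by (auto simp: dgroup_def generated_def)
  have "prod_list xs \<in> dgroup r \<and> P (prod_list xs)" using xs(1)
  proof (induction xs rule: rev_induct)
    case (snoc y ys)
    then show ?case using assms(3) by (auto simp: dgens gen_dgroup times_dgroup)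
  qed (use assms(2) in auto)
  then show ?thesis using xs(2) by simp
qed

lemma dgroup_signed: "w \<in> dgroup r \<Longrightarrow> w \<in> signed r"
  by (induction rule: dgroup_induct) (use r2 in \<open>auto intro: times_signed gen_signed\<close>)

lemma dgroup_sign_product: "w \<in> dgroup r \<Longrightarrow> sign_product r w = 1"
proof (induction rule: dgroup_induct)
  case one
  show ?case unfolding sign_product_def by (rule prod.neutral) auto
next
  case (step v k)
  then show ?case using r2 by (simp add: sign_product_gen dgroup_signed)
qed

lemma inverse_dgroup: "w \<in> dgroup r \<Longrightarrow> inverse w \<in> dgroup r"
proof (induction rule: dgroup_induct)
  case one
  have "inverse (1 :: int perm) = 1" by (metis mult_1 perm.right_inverse)
  then show ?case by simp
next
  case (step v k)
  then show ?case by (simp add: perm.inverse_distrib_swap times_dgroup gen_dgroup)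
qed

lemma inverse_dgroup_iff [simp]: "inverse w \<in> dgroup r \<longleftrightarrow> w \<in> dgroup r"
  by (metis inverse_dgroup perm.inverse_inverse)

lemma dgroup_times_gen_iff [simp]: "k < r \<Longrightarrow> w * gen k \<in> dgroup r \<longleftrightarrow> w \<in> dgroup r"
  by (metis gen_dgroup times_dgroup gen_gen_right)

lemma dgroup_gen_times_iff [simp]: "k < r \<Longrightarrow> gen k * w \<in> dgroup r \<longleftrightarrow> w \<in> dgroup r"
  by (metis gen_dgroup times_dgroup gen_gen_left)

lemma finite_dgroup' [simp]: "finite (dgroup r)"
  using r2 by (intro finite_dgroup) simp

lemma descent_exists:
  assumes "w \<in> dgroup r" "w \<noteq> 1"
  obtains k where "k < r" "\<not> up w k"
  using no_descent_eq_one[of w r] assms r2 dgroup_signed dgroup_sign_product by blast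

lemma Inv_word_le:
  assumes "xs \<in> lists (dgens r)"
  shows "card (Inv r (prod_list xs)) \<le> 2 * length xs \<and> prod_list xs \<in> dgroup r"
  using assms
proof (induction xs rule: rev_induct)
  case (snoc y ys)
  then obtain k where k: "y = gen k" "k < r" by (auto simp: dgens)
  have IH: "card (Inv r (prod_list ys)) \<le> 2 * length ys" "prod_list ys \<in> dgroup r" using snoc by auto
  have "card (Inv r (prod_list ys * gen k)) \<le> card (Inv r (prod_list ys)) + 2"
    using card_Inv_up[OF dgroup_signed[OF IH(2)] k(2) r2] card_Inv_down[OF dgroup_signed[OF IH(2)] k(2)
      r2]
    by (cases "up (prod_list ys) k") simp_all
  then show ?case using IH k by simp
qed simp

lemma word_exists:
  assumes "w \<in> dgroup r"
  shows "\<exists>xs \<in> lists (dgens r). 2 * length xs = card (Inv r w) \<and> prod_list xs = w"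
  using assms
proof (induction "card (Inv r w)" arbitrary: w rule: less_induct)
  case less
  show ?case
  proof (cases "w = 1")
    case True
    then show ?thesis by (intro bexI[of _ "[]"]) auto
  next
    case False
    then obtain k where k: "k < r" "\<not> up w k" using less.prems descent_exists by metis
    have c: "card (Inv r w) = card (Inv r (w * gen k)) + 2"
      using k less.prems r2 by (intro card_Inv_down) (auto simp: dgroup_signed)
    then obtain xs where xs: "xs \<in> lists (dgens r)" "2 * length xs = card (Inv r (w * gen k))"
      "prod_list xs = w * gen k"
      using less.hyps[of "w * gen k"] less.prems k by auto
    show ?thesis
      by (rule bexI[of _ "xs @ [gen k]"]) (use xs c k in \<open>auto simp: dgens\<close>)
  qed
qed

lemma dlength_Inv:
  assumes "w \<in> dgroup r"
  shows "2 * dlength r w = card (Inv r w)"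
proof -
  obtain xs where xs: "xs \<in> lists (dgens r)" "2 * length xs = card (Inv r w)" "prod_list xs = w"
    using word_exists[OF assms] by blast
  have "dlength r w = length xs"
    unfolding dlength_def
  proof (rule Least_equality)
    fix k assume "\<exists>ys\<in>lists (dgens r). length ys = k \<and> prod_list ys = w"
    then show "length xs \<le> k" using Inv_word_le xs by fastforce
  qed (use xs in auto)
  then show ?thesis using xs by simp
qed

lemma dlength_gen:
  assumes "w \<in> dgroup r" "k < r"
  shows "dlength r (w * gen k) = (if up w k then dlength r w + 1 else dlength r w - 1)"
    and "\<not> up w k \<Longrightarrow> 0 < dlength r w"
  using card_Inv_up[of w r k] card_Inv_down[of w r k] dlength_Inv[of w] dlength_Inv[of "w * gen k"]
    assms r2 dgroup_signed by (auto split: if_splits)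

lemma dlength_less_iff: "w \<in> dgroup r \<Longrightarrow> k < r \<Longrightarrow> dlength r w < dlength r (w * gen k) \<longleftrightarrow> up w k"
  using dlength_gen[of w k] by auto

lemma dlength_one [simp]: "dlength r 1 = 0"
  using dlength_Inv[of 1] by simp

lemma reduced_word:
  assumes "w \<in> dgroup r"
  shows "reduced_word r w \<in> lists (dgens r)" "length (reduced_word r w) = dlength r w"
    "prod_list (reduced_word r w) = w"
proof -
  obtain xs where "xs \<in> lists (dgens r) \<and> length xs = dlength r w \<and> prod_list xs = w"
    using word_exists[OF assms] dlength_Inv[OF assms] by fastforce
  then have "reduced_word r w \<in> lists (dgens r) \<and> length (reduced_word r w) = dlength r w \<and>
      prod_list (reduced_word r w) = w"
    unfolding reduced_word_def by (rule someI)
  then show "reduced_word r w \<in> lists (dgens r)" "length (reduced_word r w) = dlength r w"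
    "prod_list (reduced_word r w) = w" by auto
qed

lemma dlength_word_le:
  assumes "xs \<in> lists (dgens r)"
  shows "dlength r (prod_list xs) \<le> length xs"
  unfolding dlength_def by (rule Least_le) (use assms in auto)

lemma dlength_inverse:
  assumes "w \<in> dgroup r"
  shows "dlength r (inverse w) = dlength r w"
proof -
  have inv_word: "inverse (prod_list xs) = prod_list (rev xs)" if "xs \<in> lists (dgens r)" for xs
    using that
  proof (induction xs)
    case Nil
    have "inverse (1 :: int perm) = 1" by (metis mult_1 perm.right_inverse)
    then show ?case by simp
  qed (auto simp: dgens perm.inverse_distrib_swap)
  have *: "dlength r (inverse w) \<le> dlength r w" if w: "w \<in> dgroup r" for w
  proof -
    have "inverse w = prod_list (rev (reduced_word r w))"
      using inv_word[of "reduced_word r w"] reduced_word[OF w] by simp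
    moreover have "rev (reduced_word r w) \<in> lists (dgens r)"
      using reduced_word(1)[OF w] by auto
    ultimately show ?thesis
      using dlength_word_le[of "rev (reduced_word r w)"] reduced_word(2)[OF w] by simp
  qed
  show ?thesis using *[of w] *[of "inverse w"] assms by (auto simp: inverse_dgroup)
qed

text \<open>The image under \<open>x\<close> of the simple root \<open>k\<close> is assumed
  different from plus and minus the simple root \<open>j\<close>; the reflection \<open>j\<close>
  then does not change its sign.\<close>

lemma up_left_gen:
  assumes x: "x \<in> signed r" and j: "j < r"
    and "(x \<langle>$\<rangle> (lo k), x \<langle>$\<rangle> (hi k)) \<notin> {(lo j, hi j), (hi j, lo j), (- hi j, - lo j), (- lo j,
      - hi j)}"
  shows "up (gen j * x) k \<longleftrightarrow> up x k"
proof -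
  let ?a = "x \<langle>$\<rangle> (lo k)" and ?b = "x \<langle>$\<rangle> (hi k)"
  have nz: "?a \<noteq> 0" "?b \<noteq> 0" "?a \<noteq> ?b" using x lo_hi[of k] by (auto simp: apply_inj)
  have "?a + ?b \<noteq> 0"
  proof
    assume "?a + ?b = 0"
    then have "?a = x \<langle>$\<rangle> (- hi k)" using x by (simp add: signed_minus)
    then show False using lo_hi[of k] by (simp add: apply_inj)
  qed
  then have "gen j \<langle>$\<rangle> ?a < gen j \<langle>$\<rangle> ?b" if "?a < ?b"
    using assms(3) nz that by (intro gen_mono) auto
  moreover have "gen j \<langle>$\<rangle> ?b < gen j \<langle>$\<rangle> ?a" if "?b < ?a"
    using \<open>?a + ?b \<noteq> 0\<close> assms(3) nz that by (intro gen_mono) auto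
  ultimately show ?thesis
    using nz(3) by (cases "?a < ?b") (simp_all add: up_def apply_times)
qed

text \<open>The complementary case: \<open>x\<close> carries the simple root \<open>k\<close> to
  plus or minus the simple root \<open>j\<close>, so conjugation by \<open>x\<close> carries one
  reflection to the other. The four pairs are these two roots with two names each.\<close>

lemma gen_conj:
  assumes x: "x \<in> signed r"
    and "(x \<langle>$\<rangle> (lo k), x \<langle>$\<rangle> (hi k)) \<in> {(lo j, hi j), (hi j, lo j), (- hi j, - lo j), (- lo j,
      - hi j)}"
  shows "gen j * x = x * gen k"
proof (rule perm_eqI)
  fix i
  have m: "x \<langle>$\<rangle> (- lo k) = - (x \<langle>$\<rangle> (lo k))" "x \<langle>$\<rangle> (- hi k) = - (x \<langle>$\<rangle> (hi k))"
    using x by (auto simp: signed_minus)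
  have gk: "gen k \<langle>$\<rangle> (lo k) = hi k" "gen k \<langle>$\<rangle> (hi k) = lo k" "gen k \<langle>$\<rangle> (- lo k) = - hi k"
    "gen k \<langle>$\<rangle> (- hi k) = - lo k" for k
    by (auto simp: apply_gen lo_def hi_def)
  show "(gen j * x) \<langle>$\<rangle> i = (x * gen k) \<langle>$\<rangle> i"
  proof (cases "i \<in> {lo k, hi k, - lo k, - hi k}")
    case True
    then show ?thesis using assms(2) m gk[of k] gk[of j] by (elim insertE) (simp_all add: apply_times)
  next
    case False
    then have "x \<langle>$\<rangle> i \<notin> {x \<langle>$\<rangle> (lo k), x \<langle>$\<rangle> (hi k), x \<langle>$\<rangle> (- lo k), x \<langle>$\<rangle> (- hi k)}"
      by (auto simp: apply_inj)
    then have "x \<langle>$\<rangle> i \<notin> {lo j, hi j, - lo j, - hi j}" using assms(2) unfolding m by auto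
    then show ?thesis using False by (auto simp: apply_times apply_gen)
  qed
qed

end

section \<open>The Hecke algebra and its commuting left and right operators\<close>

text \<open>The coefficient of \<open>hT x\<close> in the product of \<open>f\<close> with
  \<open>hT (gen k)\<close>. It depends on \<open>f\<close> only at \<open>x\<close> and
  \<open>x * gen k\<close>, and \<open>up\<close> replaces the comparison of lengths, so the formula
  makes sense for arbitrary functions and involves no sum over the group.\<close>

definition Rop :: "'a::comm_ring_1 \<Rightarrow> nat \<Rightarrow> (int perm \<Rightarrow> 'a) \<Rightarrow> int perm \<Rightarrow> 'a" where
  "Rop q k f = (\<lambda>x. if up x k then q * f (x * gen k) else f (x * gen k) + (q - 1) * f x)"

text \<open>The anti-automorphism exchanging \<open>hT w\<close> and \<open>hT (inverse w)\<close>;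
  it transports statements about right multiplication to the left.\<close>

definition star :: "(int perm \<Rightarrow> 'a) \<Rightarrow> int perm \<Rightarrow> 'a" where
  "star f = (\<lambda>x. f (inverse x))"

definition Lop :: "'a::comm_ring_1 \<Rightarrow> nat \<Rightarrow> (int perm \<Rightarrow> 'a) \<Rightarrow> int perm \<Rightarrow> 'a" where
  "Lop q k f = star (Rop q k (star f))"

definition linop :: "((int perm \<Rightarrow> 'a::comm_ring_1) \<Rightarrow> int perm \<Rightarrow> 'a) \<Rightarrow> bool" where
  "linop \<Phi> \<longleftrightarrow> (\<forall>g h. \<Phi> (g + h) = \<Phi> g + \<Phi> h) \<and> (\<forall>c g. \<Phi> (hscale c g) = hscale c (\<Phi> g))"

lemma sum_fun_apply: "(\<Sum>i\<in>A. f i) x = (\<Sum>i\<in>A. f i x)"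
  for f :: "'i \<Rightarrow> 'b \<Rightarrow> 'c::comm_monoid_add"
  by (induction A rule: infinite_finite_induct) auto

lemma hscale_simps [simp]:
  "hscale 0 h = 0" "hscale 1 h = h" "hscale c 0 = 0" "hscale c (hscale d h) = hscale (c * d) h"
  by (auto simp: hscale_def fun_eq_iff)

lemma hscale_add: "hscale c (g + h) = hscale c g + hscale c h"
  and hscale_diff: "hscale c (g - h) = hscale c g - hscale c h"
  and hscale_add_left: "hscale (c + d) h = hscale c h + hscale d h"
  by (auto simp: hscale_def fun_eq_iff algebra_simps)

lemma hscale_apply: "hscale c h x = c * h x"
  by (simp add: hscale_def)

lemma hscale_sum: "hscale c (\<Sum>i\<in>A. f i) = (\<Sum>i\<in>A. hscale c (f i))"
  by (rule ext) (simp add: hscale_apply sum_fun_apply sum_distrib_left)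

lemma linopI:
  "(\<And>g h. \<Phi> (g + h) = \<Phi> g + \<Phi> h) \<Longrightarrow> (\<And>c g. \<Phi> (hscale c g) = hscale c (\<Phi> g)) \<Longrightarrow> linop \<Phi>"
  by (simp add: linop_def)

lemma linop_add: "linop \<Phi> \<Longrightarrow> \<Phi> (g + h) = \<Phi> g + \<Phi> h"
  and linop_scale: "linop \<Phi> \<Longrightarrow> \<Phi> (hscale c g) = hscale c (\<Phi> g)"
  by (auto simp: linop_def)

lemma linop_zero: "linop \<Phi> \<Longrightarrow> \<Phi> 0 = 0"
  using linop_scale[of \<Phi> 0 0] by simp

lemma linop_sum: "linop \<Phi> \<Longrightarrow> \<Phi> (\<Sum>i\<in>A. f i) = (\<Sum>i\<in>A. \<Phi> (f i))"
  by (induction A rule: infinite_finite_induct) (auto simp: linop_add linop_zero)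

lemma linop_diff: "linop \<Phi> \<Longrightarrow> \<Phi> (g - h) = \<Phi> g - \<Phi> h"
  by (metis add_diff_cancel_right' diff_add_cancel linop_add)

lemma linop_comp: "linop \<Phi> \<Longrightarrow> linop \<Psi> \<Longrightarrow> linop (\<lambda>g. \<Phi> (\<Psi> g))"
  by (simp add: linop_def)

lemma linop_star: "linop star"
  by (auto simp: linop_def star_def hscale_def fun_eq_iff)

lemma linop_Rop: "linop (Rop q k)"
  by (auto simp: linop_def Rop_def hscale_def fun_eq_iff algebra_simps)

lemma linop_Lop: "linop (Lop q k)"
  unfolding Lop_def by (rule linop_comp[OF linop_star linop_comp[OF linop_Rop linop_star]])

lemma star_star [simp]: "star (star f) = f"
  by (simp add: star_def)

lemma star_Lop: "star (Lop q k f) = Rop q k (star f)"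
  and star_Rop: "star (Rop q k f) = Lop q k (star f)"
  by (simp_all add: Lop_def)

lemma Lop_apply:
  "Lop q k f x = (if up (inverse x) k then q * f (gen k * x) else f (gen k * x) + (q - 1) * f x)"
  by (simp add: Lop_def star_def Rop_def)

lemma Rop_apply:
  "Rop q k f x = (if up x k then q * f (x * gen k) else f (x * gen k) + (q - 1) * f x)"
  by (simp add: Rop_def)

lemma star_hT [simp]: "star (hT w) = hT (inverse w)"
  by (auto simp: star_def hT_def fun_eq_iff)

lemma hT_apply: "hT w v = (if v = w then 1 else 0)"
  by (simp add: hT_def)

lemma times_gen_ne [simp]: "w * gen k \<noteq> w" "w \<noteq> w * gen k"
  by (metis gen_ne_one perm_cancel_left(1) perm.left_inverse)+

lemma Rop_hT: "Rop q k (hT w) = (if up w k then hT (w * gen k)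
    else hscale q (hT (w * gen k)) + hscale (q - 1) (hT w))"
proof
  fix x
  have "x * gen k = w \<longleftrightarrow> x = w * gen k" by auto
  then show "Rop q k (hT w) x = (if up w k then hT (w * gen k)
    else hscale q (hT (w * gen k)) + hscale (q - 1) (hT w)) x"
    by (auto simp: Rop_apply hT_apply hscale_apply up_gen_iff)
qed

lemma Lop_hT: "Lop q k (hT w) = (if up (inverse w) k then hT (gen k * w)
    else hscale q (hT (gen k * w)) + hscale (q - 1) (hT w))"
  by (simp add: Lop_def Rop_hT linop_add[OF linop_star] linop_scale[OF linop_star])

lemma hecke_0 [simp]: "0 \<in> hecke r"
  and hecke_add: "g \<in> hecke r \<Longrightarrow> h \<in> hecke r \<Longrightarrow> g + h \<in> hecke r"
  and hecke_diff: "g \<in> hecke r \<Longrightarrow> h \<in> hecke r \<Longrightarrow> g - h \<in> hecke r"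
  and hecke_scale: "h \<in> hecke r \<Longrightarrow> hscale c h \<in> hecke r"
  and hecke_hT: "w \<in> dgroup r \<Longrightarrow> hT w \<in> hecke r"
  and hecke_outside: "h \<in> hecke r \<Longrightarrow> w \<notin> dgroup r \<Longrightarrow> h w = 0"
  by (auto simp: hecke_def hscale_def hT_def)

lemma hecke_sum: "(\<And>i. i \<in> A \<Longrightarrow> f i \<in> hecke r) \<Longrightarrow> (\<Sum>i\<in>A. f i) \<in> hecke r"
  by (induction A rule: infinite_finite_induct) (auto simp: hecke_add)

lemma hecke_eqI:
  assumes "g \<in> hecke r" "h \<in> hecke r" "\<And>w. w \<in> dgroup r \<Longrightarrow> g w = h w"
  shows "g = h"
  using assms by (auto simp: fun_eq_iff hecke_def) metis

section \<open>Left and right multiplication by generators, and associativity\<close>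

locale hecke_D = type_D r for r +
  fixes q :: "'a::comm_ring_1"
begin

abbreviation R :: "nat \<Rightarrow> (int perm \<Rightarrow> 'a) \<Rightarrow> int perm \<Rightarrow> 'a" where
  "R \<equiv> Rop q"

abbreviation L :: "nat \<Rightarrow> (int perm \<Rightarrow> 'a) \<Rightarrow> int perm \<Rightarrow> 'a" where
  "L \<equiv> Lop q"

abbreviation H :: "(int perm \<Rightarrow> 'a) set" where
  "H \<equiv> hecke r"

abbreviation mul :: "(int perm \<Rightarrow> 'a) \<Rightarrow> (int perm \<Rightarrow> 'a) \<Rightarrow> int perm \<Rightarrow> 'a" (infixl \<open>\<bullet>\<close> 70) where
  "g \<bullet> h \<equiv> hmult r q g h"

lemma hecke_R: "k < r \<Longrightarrow> h \<in> H \<Longrightarrow> R k h \<in> H"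
  by (auto simp: hecke_def Rop_apply)

lemma hecke_star: "h \<in> H \<Longrightarrow> star h \<in> H"
  by (auto simp: hecke_def star_def)

lemma hecke_L: "k < r \<Longrightarrow> h \<in> H \<Longrightarrow> L k h \<in> H"
  by (simp add: Lop_def hecke_R hecke_star)

lemma hmult_gen_R:
  assumes h: "h \<in> H" and k: "k < r"
  shows "hmult_gen r q h (gen k) = R k h"
proof
  fix x
  let ?F = "\<lambda>w. (if w = x * gen k then (if up w k then h w else q * h w) else 0) +
    (if w = x then (if up w k then 0 else (q - 1) * h w) else 0)"
  have "hmult_gen r q h (gen k) x = (\<Sum>w\<in>dgroup r. ?F w)"
    unfolding hmult_gen_def sum_fun_apply
  proof (rule sum.cong)
    fix w assume "w \<in> dgroup r"
    moreover have "x = w * gen k \<longleftrightarrow> w = x * gen k" by auto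
    ultimately show "hscale (h w) (if dlength r w < dlength r (w * gen k) then hT (w * gen k)
        else hscale q (hT (w * gen k)) + hscale (q - 1) (hT w)) x = ?F w"
      using k by (auto simp: dlength_less_iff hscale_apply hT_apply algebra_simps)
  qed simp
  also have "\<dots> = R k h x"
    using k h unfolding sum.distrib
    by (auto simp: Rop_apply up_gen_iff sum.delta hecke_outside)
  finally show "hmult_gen r q h (gen k) x = R k h x" .
qed

lemma linop_hmult_gen: "linop (\<lambda>g. hmult_gen r q g s)"
  by (rule linopI; rule ext)
    (simp_all only: hmult_gen_def sum_fun_apply hscale_apply plus_fun_apply distrib_right sum.distrib
      mult.assoc sum_distrib_left)

lemma linop_foldl: "linop (\<lambda>g. foldl (hmult_gen r q) g ws)"
proof (induction ws)
  case Nil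
  show ?case by (simp add: linop_def)
next
  case (Cons s ws)
  then show ?case using linop_comp[OF Cons linop_hmult_gen[of s]] by simp
qed

lemma linop_hmult_left: "linop (\<lambda>g. g \<bullet> h)"
  by (rule linopI)
    (simp_all add: hmult_def linop_add[OF linop_foldl] linop_scale[OF linop_foldl] hscale_add
      sum.distrib hscale_sum mult.commute)

lemma linop_hmult_right: "linop (\<lambda>h. g \<bullet> h)"
  by (rule linopI)
    (simp_all add: hmult_def hscale_apply hscale_add_left sum.distrib hscale_sum)

lemmas mul_add_left = linop_add[OF linop_hmult_left]
  and mul_add_right = linop_add[OF linop_hmult_right]
  and mul_diff_left = linop_diff[OF linop_hmult_left]
  and mul_scale_left = linop_scale[OF linop_hmult_left]
  and mul_scale_right = linop_scale[OF linop_hmult_right]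
  and mul_sum_left = linop_sum[OF linop_hmult_left]
  and mul_sum_right = linop_sum[OF linop_hmult_right]
  and mul_zero_left [simp] = linop_zero[OF linop_hmult_left]
  and mul_zero_right [simp] = linop_zero[OF linop_hmult_right]

lemma foldl_hecke: "g \<in> H \<Longrightarrow> ws \<in> lists (dgens r) \<Longrightarrow> foldl (hmult_gen r q) g ws \<in> H"
  by (induction ws arbitrary: g) (auto simp: dgens hmult_gen_R hecke_R)

lemma hecke_mul: "g \<in> H \<Longrightarrow> g \<bullet> h \<in> H"
  unfolding hmult_def by (intro hecke_sum hecke_scale foldl_hecke reduced_word) auto

lemma hecke_expand:
  assumes "h \<in> H"
  shows "h = (\<Sum>w\<in>dgroup r. hscale (h w) (hT w))"
proof
  fix x
  have "(\<Sum>w\<in>dgroup r. hscale (h w) (hT w)) x = (\<Sum>w\<in>dgroup r. if w = x then h w else 0)"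
    unfolding sum_fun_apply by (rule sum.cong) (auto simp: hscale_apply hT_apply)
  then show "h x = (\<Sum>w\<in>dgroup r. hscale (h w) (hT w)) x"
    using assms by (simp add: sum.delta hecke_outside)
qed

lemma linop_eq_on_hecke:
  assumes "linop \<Phi>" "linop \<Psi>" "\<And>w. w \<in> dgroup r \<Longrightarrow> \<Phi> (hT w) = \<Psi> (hT w)" "g \<in> H"
  shows "\<Phi> g = \<Psi> g"
  by (subst (1 2) hecke_expand[OF assms(4)])
    (simp add: linop_sum assms(1-3) linop_scale)

text \<open>If \<open>x\<close> does not carry the simple root \<open>k\<close> to plus or minus the
  root \<open>j\<close>, the two directions are independent and both sides expand to the same four
  terms. Otherwise \<open>gen j * x = x * gen k\<close>, the two directions coincide, and
  \<open>up x k\<close> agrees with \<open>up (inverse x) j\<close>.\<close>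

lemma R_L_commute:
  assumes f: "f \<in> H" and j: "j < r" and k: "k < r"
  shows "R k (L j f) = L j (R k f)"
proof (rule hecke_eqI[of _ r])
  fix x assume "x \<in> dgroup r"
  then have x: "x \<in> signed r" by (rule dgroup_signed)
  let ?S = "(x \<langle>$\<rangle> (lo k), x \<langle>$\<rangle> (hi k)) \<in> {(lo j, hi j), (hi j, lo j), (- hi j, - lo j), (- lo j,
    - hi j)}"
  let ?S' = "(inverse x \<langle>$\<rangle> (lo j), inverse x \<langle>$\<rangle> (hi j)) \<in> {(lo k, hi k), (hi k, lo k), (- hi k,
    - lo k), (- lo k, - hi k)}"
  have ix: "inverse x \<in> signed r" using x by (rule inverse_signed)
  have inv_iff: "inverse x \<langle>$\<rangle> a = b \<longleftrightarrow> x \<langle>$\<rangle> b = a" for a b by (metis inverse_apply)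
  have SS': "?S \<longleftrightarrow> ?S'"
    by (auto simp: inv_iff signed_minus[OF x])
  show "R k (L j f) x = L j (R k f) x"
  proof (cases ?S)
    case False
    have "up (gen j * x) k \<longleftrightarrow> up x k" using x j False by (rule up_left_gen)
    moreover have "up (gen k * inverse x) j \<longleftrightarrow> up (inverse x) j"
      using ix k False[unfolded SS'] by (rule up_left_gen)
    ultimately show ?thesis by (simp add: Rop_apply Lop_apply mult.assoc algebra_simps)
  next
    case True
    then have c: "gen j * x = x * gen k" using x by (intro gen_conj)
    have "up x k \<longleftrightarrow> up (inverse x) j"
    proof -
      from True consider
        (a) "x \<langle>$\<rangle> (lo k) = lo j" "x \<langle>$\<rangle> (hi k) = hi j"
          | (b) "x \<langle>$\<rangle> (lo k) = hi j" "x \<langle>$\<rangle> (hi k) = lo j"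
        | (c) "x \<langle>$\<rangle> (lo k) = - hi j" "x \<langle>$\<rangle> (hi k) = - lo j"
          | (d) "x \<langle>$\<rangle> (lo k) = - lo j" "x \<langle>$\<rangle> (hi k) = - hi j"
        by auto
      then show ?thesis
      proof cases
        case a
        then have "inverse x \<langle>$\<rangle> (lo j) = lo k" "inverse x \<langle>$\<rangle> (hi j) = hi k"
          by (simp_all only: inv_iff)
        with a show ?thesis using lo_hi(3)[of j] lo_hi(3)[of k] by (simp add: up_def)
      next
        case b
        then have "inverse x \<langle>$\<rangle> (lo j) = hi k" "inverse x \<langle>$\<rangle> (hi j) = lo k"
          by (simp_all only: inv_iff)
        with b show ?thesis using lo_hi(3)[of j] lo_hi(3)[of k] by (simp add: up_def)
      next
        case c
        then have "inverse x \<langle>$\<rangle> (lo j) = - hi k" "inverse x \<langle>$\<rangle> (hi j) = - lo k"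
          by (simp_all add: inv_iff signed_minus[OF x])
        with c show ?thesis using lo_hi(3)[of j] lo_hi(3)[of k] by (simp add: up_def)
      next
        case d
        then have "inverse x \<langle>$\<rangle> (lo j) = - lo k" "inverse x \<langle>$\<rangle> (hi j) = - hi k"
          by (simp_all add: inv_iff signed_minus[OF x])
        with d show ?thesis using lo_hi(3)[of j] lo_hi(3)[of k] by (simp add: up_def)
      qed
    qed
    moreover have "up (x * gen k) k \<longleftrightarrow> \<not> up x k" "up (inverse x * gen j) j \<longleftrightarrow> \<not> up (inverse x) j"
      by (simp_all add: up_gen_iff)
    moreover have "gen k * inverse x = inverse x * gen j"
      using arg_cong[OF c, of inverse] by simp
    moreover have "gen j * (x * gen k) = x" unfolding c[symmetric] by simp
    ultimately show ?thesis by (simp add: Rop_apply Lop_apply c algebra_simps)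
  qed
qed (use f j k in \<open>auto intro: hecke_L hecke_R\<close>)

text \<open>
  As \<open>hT 1\<close> generates the algebra under the \<open>L k\<close>, an operator commuting with all of them is determined by
  its value at \<open>hT 1\<close>.  Associativity of \<open>\<bullet>\<close> is an instance, as \<open>L\<close> and \<open>R\<close> commute.
\<close>

lemma eq_of_L_commute:
  assumes \<Phi>: "linop \<Phi>" "\<And>k g. k < r \<Longrightarrow> g \<in> H \<Longrightarrow> \<Phi> (L k g) = L k (\<Phi> g)"
    and \<Psi>: "linop \<Psi>" "\<And>k g. k < r \<Longrightarrow> g \<in> H \<Longrightarrow> \<Psi> (L k g) = L k (\<Psi> g)"
    and one: "\<Phi> (hT 1) = \<Psi> (hT 1)" and g: "g \<in> H"
  shows "\<Phi> g = \<Psi> g"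
  using \<Phi>(1) \<Psi>(1) _ g
proof (rule linop_eq_on_hecke)
  fix w assume "w \<in> dgroup r"
  then show "\<Phi> (hT w) = \<Psi> (hT w)"
  proof (induction "dlength r w" arbitrary: w rule: less_induct)
    case less
    show ?case
    proof (cases "w = 1")
      case False
      then have "inverse w \<noteq> 1" by (metis mult_1_right perm.right_inverse)
      then obtain k where k: "k < r" "\<not> up (inverse w) k"
        using less.prems descent_exists[of "inverse w"] by auto
      have "dlength r (gen k * w) = dlength r (inverse w * gen k)"
        using dlength_inverse[of "gen k * w"] less.prems k by simp
      then have "dlength r (gen k * w) < dlength r w"
        using dlength_gen[of "inverse w" k] k less.prems dlength_inverse[of w] by simp
      then have "\<Phi> (hT (gen k * w)) = \<Psi> (hT (gen k * w))"
        using less k by simp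
      moreover have "hT w = L k (hT (gen k * w))"
        using k by (simp add: Lop_hT up_gen_iff)
      moreover have "hT (gen k * w) \<in> H" using k less.prems by (simp add: hecke_hT)
      ultimately show ?thesis using \<Phi>(2) \<Psi>(2) k by metis
    qed (simp add: one)
  qed
qed

lemma mul_one_right [simp]: "g \<bullet> hT 1 = g"
proof -
  have "reduced_word r 1 = []" using reduced_word(2)[of 1] by simp
  then have "g \<bullet> hT 1 = (\<Sum>y\<in>dgroup r. if y = 1 then g else 0)"
    unfolding hmult_def by (intro sum.cong) (auto simp: hT_apply)
  then show ?thesis by (simp add: sum.delta)
qed

text \<open>A chosen reduced word is evaluated only at the start \<open>hT 1\<close>. General left
  factors are then reached through \<open>eq_of_L_commute\<close>, so different reduced words are
  never compared.\<close>

lemma foldl_reduced: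
  assumes "ws \<in> lists (dgens r)" "dlength r (prod_list ws) = length ws"
  shows "foldl (hmult_gen r q) (hT 1) ws = hT (prod_list ws)"
  using assms
proof (induction ws rule: rev_induct)
  case (snoc s vs)
  then obtain k where k: "s = gen k" "k < r" by (auto simp: dgens)
  have vs: "vs \<in> lists (dgens r)" using snoc.prems by auto
  have v: "prod_list vs \<in> dgroup r" using Inv_word_le[OF vs] by blast
  have "dlength r (prod_list vs * gen k) = length vs + 1" using snoc.prems k by simp
  then have "up (prod_list vs) k" "dlength r (prod_list vs) = length vs"
    using dlength_gen(1)[OF v k(2)] dlength_word_le[OF vs] by (auto split: if_splits)
  then show ?case using snoc.IH[OF vs] k v by (simp add: hmult_gen_R hecke_hT Rop_hT)
qed simp

lemma mul_one_left [simp]: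
  assumes "h \<in> H"
  shows "hT 1 \<bullet> h = h"
proof -
  have "hT 1 \<bullet> h = (\<Sum>y\<in>dgroup r. hscale (h y) (hT y))"
    unfolding hmult_def
    by (rule sum.cong) (auto simp: foldl_reduced reduced_word)
  then show ?thesis using hecke_expand[OF assms] by simp
qed

lemma foldl_L:
  "g \<in> H \<Longrightarrow> k < r \<Longrightarrow> ws \<in> lists (dgens r) \<Longrightarrow>
    foldl (hmult_gen r q) (L k g) ws = L k (foldl (hmult_gen r q) g ws)"
  by (induction ws arbitrary: g)
    (auto simp: dgens hmult_gen_R hecke_L hecke_R R_L_commute)

lemma mul_L:
  assumes "g \<in> H" "k < r"
  shows "L k g \<bullet> h = L k (g \<bullet> h)"
  unfolding hmult_def linop_sum[OF linop_Lop] linop_scale[OF linop_Lop]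
  by (rule sum.cong) (use assms in \<open>auto simp: foldl_L reduced_word\<close>)

lemma mul_assoc:
  assumes "f \<in> H" "g \<in> H" "h \<in> H"
  shows "f \<bullet> g \<bullet> h = f \<bullet> (g \<bullet> h)"
proof (rule eq_of_L_commute[of "\<lambda>f. f \<bullet> g \<bullet> h" "\<lambda>f. f \<bullet> (g \<bullet> h)"])
  show "linop (\<lambda>f. f \<bullet> g \<bullet> h)"
    using linop_comp[OF linop_hmult_left linop_hmult_left] .
qed (use assms in \<open>auto simp: linop_hmult_left mul_L hecke_mul\<close>)

lemma R_eq_mul:
  assumes "g \<in> H" "k < r"
  shows "R k g = g \<bullet> hT (gen k)"
proof (rule eq_of_L_commute[of "R k" "\<lambda>g. g \<bullet> hT (gen k)"])
  have "up 1 k" using lo_hi(3) by (simp add: up_def)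
  then have "R k (hT 1) = hT (gen k)" by (simp add: Rop_hT)
  then show "R k (hT 1) = hT 1 \<bullet> hT (gen k)" using assms by (simp add: hecke_hT gen_dgroup)
qed (use assms in \<open>auto simp: linop_Rop linop_hmult_left mul_L R_L_commute\<close>)

lemma L_eq_mul:
  assumes "g \<in> H" "k < r"
  shows "L k g = hT (gen k) \<bullet> g"
proof -
  have "inverse (1 :: int perm) = 1" by (metis mult_1 perm.right_inverse)
  then have "up (inverse 1) k" using lo_hi(3) by (simp add: up_def)
  then have "L k (hT 1) = hT (gen k)" by (simp add: Lop_hT)
  then show ?thesis using mul_L[of "hT 1" k g] assms by (simp add: hecke_hT)
qed

lemma mul_R:
  assumes "g \<in> H" "h \<in> H" "k < r"
  shows "g \<bullet> R k h = R k (g \<bullet> h)"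
  using assms by (simp add: R_eq_mul mul_assoc hecke_mul hecke_hT gen_dgroup)

text \<open>As functions of \<open>g\<close> both sides commute with every \<open>L k\<close>:
  \<open>star\<close> turns \<open>L k\<close> into \<open>R k\<close>, which passes through the
  right factor of a product. They agree at \<open>hT 1\<close>.\<close>

lemma star_mul:
  assumes "g \<in> H" "h \<in> H"
  shows "star (g \<bullet> h) = star h \<bullet> star g"
proof -
  have "g \<bullet> h = star (star h \<bullet> star g)"
  proof (rule eq_of_L_commute[of "\<lambda>g. g \<bullet> h" "\<lambda>g. star (star h \<bullet> star g)"])
    show "linop (\<lambda>g. star (star h \<bullet> star g))"
      by (intro linop_comp[OF linop_star] linop_comp[OF linop_hmult_right linop_star])
    have "inverse (1 :: int perm) = 1" by (metis mult_1 perm.right_inverse)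
    then show "hT 1 \<bullet> h = star (star h \<bullet> star (hT 1))" using assms by simp
  qed (use assms in \<open>auto simp: linop_hmult_left mul_L star_Lop mul_R hecke_star star_Rop\<close>)
  then show ?thesis by simp
qed

end

section \<open>The factors of the elements hpi\<close>

lemma up_one [simp]: "up 1 k"
  using lo_hi(3) by (simp add: up_def)

lemma apply_tref:
  assumes "1 \<le> i"
  shows "tref i \<langle>$\<rangle> x = (if \<bar>x\<bar> = int i then - x else x)"
  using assms
proof (induction i arbitrary: x rule: dec_induct)
  case base
  then show ?case by (simp add: tref.simps[of "Suc 0"] apply_sgen0)
next
  case (step n)
  have "tref (Suc n) = gen n * tref n * gen n"
    using step by (simp add: tref.simps[of "Suc n"] gen_def)
  moreover have "gen n \<langle>$\<rangle> y = (if y = int n then int n + 1 else if y = int n + 1 then int n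
     else if y = - int n then - int n - 1 else if y = - int n - 1 then - int n else y)" for y
    using step by (simp add: apply_gen lo_def hi_def)
  ultimately show ?case using step by (simp add: apply_times abs_eq_iff')
qed

lemma apply_uelt:
  assumes "2 \<le> i"
  shows "uelt i \<langle>$\<rangle> x = (if \<bar>x\<bar> = 1 \<or> \<bar>x\<bar> = int i then - x else x)"
  using assms by (simp add: uelt_def apply_times apply_tref)

lemma uelt_uelt [simp]: "2 \<le> i \<Longrightarrow> uelt i * uelt i = 1"
  by (rule perm_eqI) (simp add: apply_times apply_uelt)

lemma uelt_uelt_right [simp]: "2 \<le> i \<Longrightarrow> x * uelt i * uelt i = x"
  by (simp add: mult.assoc)

lemma inverse_uelt [simp]: "2 \<le> i \<Longrightarrow> inverse (uelt i) = uelt i"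
  by (rule perm.inverse_unique) simp

lemma uelt_2: "uelt 2 = gen 0 * gen 1"
  by (rule perm_eqI) (simp add: apply_times apply_uelt apply_gen lo_def hi_def abs_eq_iff')

lemma uelt_Suc:
  assumes "2 \<le> i"
  shows "uelt (Suc i) = gen i * uelt i * gen i"
proof -
  have "tref (Suc i) = gen i * tref i * gen i"
    using assms by (simp add: tref.simps[of "Suc i"] gen_def)
  moreover have "tref 1 * gen i = gen i * tref 1"
    by (rule perm_eqI) (use assms in \<open>auto simp: apply_times apply_tref apply_gen lo_def hi_def\<close>)
  ultimately show ?thesis by (simp add: uelt_def flip: mult.assoc)
qed

text \<open>For signed \<open>x\<close> this says that \<open>x\<close> keeps the roots
  \<open>e_i - e_j\<close> and \<open>e_i + e_j\<close> with \<open>1 \<le> j < i\<close> positive.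
  These are the positive roots made negative by \<open>uelt i\<close>, so the condition means that
  the lengths of \<open>x\<close> and \<open>uelt i\<close> add up.\<close>

definition ucond :: "int perm \<Rightarrow> nat \<Rightarrow> bool" where
  "ucond x i \<longleftrightarrow> (\<forall>j. 1 \<le> j \<and> j < int i \<longrightarrow> \<bar>x \<langle>$\<rangle> j\<bar> < x \<langle>$\<rangle> (int i))"

text \<open>For \<open>2 \<le> m\<close> and \<open>n \<le> Suc r\<close> these are the products of
  distinct elements among \<open>uelt m, ..., uelt (n - 1)\<close>. Place \<open>1\<close> is left
  free: every factor changes the sign there, and evenness determines the outcome.\<close>

definition flips :: "nat \<Rightarrow> nat \<Rightarrow> nat \<Rightarrow> int perm set" where
  "flips r m n = {e \<in> dgroup r. (\<forall>i. \<bar>e \<langle>$\<rangle> i\<bar> = \<bar>i\<bar>) \<and>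
     (\<forall>i\<ge>2. i < int m \<or> int n \<le> i \<longrightarrow> e \<langle>$\<rangle> i = i)}"

context type_D
begin

lemma uelt_dgroup: "2 \<le> i \<Longrightarrow> i \<le> r \<Longrightarrow> uelt i \<in> dgroup r"
proof (induction i rule: dec_induct)
  case base
  then show ?case using r2 by (simp add: uelt_2 times_dgroup gen_dgroup)
next
  case (step n)
  then show ?case by (simp add: uelt_Suc)
qed

lemma flips_mono: "n \<le> n' \<Longrightarrow> flips r m n \<subseteq> flips r m n'"
  by (auto simp: flips_def)

lemma flips_uelt:
  assumes e: "e \<in> flips r m n" and n: "2 \<le> n" "n \<le> r" "m \<le> n"
  shows "e * uelt n \<in> flips r m (Suc n)" "e * uelt n \<noteq> 1"
proof -
  have s: "e \<in> signed r" using e by (auto simp: flips_def intro: dgroup_signed)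
  have "\<bar>e \<langle>$\<rangle> (- i)\<bar> = \<bar>i\<bar>" for i using e unfolding flips_def by auto
  then show "e * uelt n \<in> flips r m (Suc n)"
    using e n by (auto simp: flips_def apply_times apply_uelt times_dgroup uelt_dgroup)
  have "e \<langle>$\<rangle> (int n) = int n" using e n by (auto simp: flips_def)
  then have "(e * uelt n) \<langle>$\<rangle> (int n) = - int n"
    using n by (simp add: apply_times apply_uelt signed_minus[OF s])
  then show "e * uelt n \<noteq> 1" using n by auto
qed

lemma one_flips [simp]: "1 \<in> flips r m n"
  by (simp add: flips_def)

text \<open>Membership in type D determines the sign at place \<open>1\<close> from the other
  signs.\<close>

lemma flips_trivial:
  assumes e: "e \<in> flips r m n" and fx: "\<And>i. 2 \<le> i \<Longrightarrow> e \<langle>$\<rangle> i = i"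
  shows "e = 1"
proof (rule no_descent_eq_one[of _ r])
  show "e \<in> signed r" "sign_product r e = 1" "2 \<le> r"
    using e r2 by (auto simp: flips_def dgroup_signed dgroup_sign_product)
  fix k assume "k < r"
  have e1: "\<bar>e \<langle>$\<rangle> 1\<bar> = 1" "\<bar>e \<langle>$\<rangle> (- 1)\<bar> = 1" using e unfolding flips_def by auto
  show "up e k"
  proof (cases "k \<le> 1")
    case True
    then have "\<bar>lo k\<bar> = 1" "hi k = 2" by (auto simp: lo_def hi_def)
    then show ?thesis using e1 fx[of 2] by (auto simp: up_def abs_if split: if_splits)
  next
    case False
    then show ?thesis using fx by (simp add: up_def lo_def hi_def)
  qed
qed

end

definition pfac :: "'a::comm_ring_1 \<Rightarrow> nat \<Rightarrow> int perm \<Rightarrow> 'a" where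
  "pfac q i = hscale (q ^ (i - 1)) (hT 1) + hT (uelt i)"

text \<open>An arbitrary start \<open>g\<close> and lower end \<open>m\<close> allow
  \<open>hpi\<close> to be split at an index and its factors to be appended to elements other than
  \<open>hT 1\<close>.\<close>

definition pprod :: "nat \<Rightarrow> 'a::comm_ring_1 \<Rightarrow> nat \<Rightarrow> nat \<Rightarrow> (int perm \<Rightarrow> 'a) \<Rightarrow> int perm \<Rightarrow> 'a" where
  "pprod r q m n g = foldl (\<lambda>h i. hmult r q h (pfac q i)) g [m..<n]"

section \<open>Products with sign changes; commutation and absorption properties of
  \<open>hpi\<close>\<close>

context hecke_D
begin

abbreviation P :: "nat \<Rightarrow> int perm \<Rightarrow> 'a" where
  "P \<equiv> hpi r q"

lemma T_gen: "g \<in> H \<Longrightarrow> k < r \<Longrightarrow> g \<bullet> hT (gen k) = R k g"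
  by (simp add: R_eq_mul)

lemma gen_T: "g \<in> H \<Longrightarrow> k < r \<Longrightarrow> hT (gen k) \<bullet> g = L k g"
  by (simp add: L_eq_mul)

text \<open>The product is reduced. The induction follows
  \<open>uelt (Suc i) = gen i * uelt i * gen i\<close>: \<open>ucond x (Suc i)\<close> makes
  \<open>x\<close> go up at \<open>gen i\<close>, gives \<open>ucond (x * gen i) i\<close>, and
  makes the result go up at \<open>gen i\<close> once more.\<close>

lemma T_uelt:
  assumes "2 \<le> i" "i \<le> r" "x \<in> dgroup r" "ucond x i"
  shows "hT x \<bullet> hT (uelt i) = hT (x * uelt i)"
  using assms
proof (induction i arbitrary: x rule: dec_induct)
  case base
  have r: "0 < r" "1 < r" using r2 by auto
  have x: "x \<in> signed r" using base by (simp add: dgroup_signed)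
  have c: "\<bar>x \<langle>$\<rangle> 1\<bar> < x \<langle>$\<rangle> 2" using base by (auto simp: ucond_def)
  have "up (gen 0) 1" by (simp add: up_def apply_gen lo_def hi_def)
  then have "hT (uelt 2) = hT (gen 0) \<bullet> hT (gen 1)"
    using r by (simp add: T_gen hecke_hT gen_dgroup Rop_hT uelt_2)
  then have "hT x \<bullet> hT (uelt 2) = R 1 (R 0 (hT x))"
    using r base by (simp add: T_gen hecke_hT gen_dgroup mul_R)
  moreover have "up x 0" using c by (simp add: up_def lo_def hi_def signed_minus[OF x])
  moreover have "up (x * gen 0) 1"
    using c signed_minus[OF x, of 2] signed_minus[OF x, of 1]
    by (simp add: up_def apply_times apply_gen) (simp add: lo_def hi_def)
  ultimately show ?case by (simp add: Rop_hT uelt_2 mult.assoc)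
next
  case (step i)
  have i: "i < r" "2 \<le> i" "i \<le> r" using step by auto
  have x: "x \<in> signed r" using step by (simp add: dgroup_signed)
  have gi: "gen i \<langle>$\<rangle> (int i) = int i + 1" "gen i \<langle>$\<rangle> (int i + 1) = int i"
     "gen i \<langle>$\<rangle> (- int i) = - int i - 1"
    using i by (auto simp: apply_gen lo_def hi_def)
  have gj: "gen i \<langle>$\<rangle> j = j" if "1 \<le> j" "j < int i" for j
    using i that by (auto simp: apply_gen lo_def hi_def)
  have lohi: "lo i = int i" "hi i = int i + 1" using i by (auto simp: lo_def hi_def)
  have c: "\<bar>x \<langle>$\<rangle> j\<bar> < x \<langle>$\<rangle> (int i + 1)" if "1 \<le> j" "j < int i + 1" for j
    using step.prems that by (auto simp: ucond_def add.commute)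
  have "ucond (gen i) i" by (simp add: ucond_def gi gj)
  then have "hT (gen i) \<bullet> hT (uelt i) = hT (gen i * uelt i)"
    using step.IH[of "gen i"] i by (simp add: gen_dgroup)
  moreover have "up (gen i * uelt i) i"
    using i by (simp add: up_def lohi apply_times apply_uelt gi)
  ultimately have "hT (uelt (Suc i)) = hT (gen i) \<bullet> hT (uelt i) \<bullet> hT (gen i)"
    using i by (simp add: T_gen hecke_hT gen_dgroup times_dgroup uelt_dgroup Rop_hT uelt_Suc)
  then have "hT x \<bullet> hT (uelt (Suc i)) = R i (R i (hT x) \<bullet> hT (uelt i))"
    using i step.prems
    by (simp add: hecke_hT gen_dgroup uelt_dgroup hecke_mul hecke_R R_eq_mul mul_assoc)
  also have "R i (hT x) = hT (x * gen i)"
    using c[of "int i"] i by (simp add: Rop_hT up_def lohi abs_less_iff)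
  also have "hT (x * gen i) \<bullet> hT (uelt i) = hT (x * gen i * uelt i)"
  proof (rule step.IH)
    show "ucond (x * gen i) i"
      unfolding ucond_def using c gj gi by (simp add: apply_times)
  qed (use i step.prems in auto)
  also have "R i \<dots> = hT (x * gen i * uelt i * gen i)"
  proof -
    have "(x * gen i * uelt i) \<langle>$\<rangle> (int i) = - (x \<langle>$\<rangle> (int i + 1))"
      using i gi signed_minus[OF x, of "int i + 1"] by (simp add: apply_times apply_uelt)
    moreover have "(x * gen i * uelt i) \<langle>$\<rangle> (int i + 1) = x \<langle>$\<rangle> (int i)"
      using i gi by (simp add: apply_times apply_uelt)
    ultimately show ?thesis using c[of "int i"] i by (simp add: Rop_hT up_def lohi abs_less_iff)
  qed
  finally show ?case using i by (simp add: uelt_Suc mult.assoc)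
qed

text \<open>Multiplication is a mere translation here, because every term of \<open>g\<close>
  multiplies without a quadratic relation.\<close>

lemma mul_T_uelt:
  assumes i: "2 \<le> i" "i \<le> r" and g: "g \<in> H" and c: "\<And>x. g x \<noteq> 0 \<Longrightarrow> ucond x i"
  shows "g \<bullet> hT (uelt i) = (\<lambda>x. g (x * uelt i))"
proof
  fix x
  have eq: "g \<bullet> hT (uelt i) = (\<Sum>w\<in>dgroup r. hscale (g w) (hT w \<bullet> hT (uelt i)))"
    by (subst hecke_expand[OF g]) (simp add: mul_sum_left mul_scale_left)
  have "(g \<bullet> hT (uelt i)) x = (\<Sum>w\<in>dgroup r. if w = x * uelt i then g w else 0)"
    unfolding eq sum_fun_apply
  proof (rule sum.cong)
    fix w assume w: "w \<in> dgroup r"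
    show "hscale (g w) (hT w \<bullet> hT (uelt i)) x = (if w = x * uelt i then g w else 0)"
    proof (cases "g w = 0")
      case False
      have "x = w * uelt i \<longleftrightarrow> w = x * uelt i" using i by auto
      then show ?thesis using T_uelt[OF i w c[OF False]] by (simp add: hscale_apply hT_apply)
    qed (auto simp: hscale_apply)
  qed simp
  also have "\<dots> = g (x * uelt i)" using g by (auto simp: sum.delta hecke_outside)
  finally show "(g \<bullet> hT (uelt i)) x = g (x * uelt i)" .
qed

lemma hecke_pfac: "2 \<le> i \<Longrightarrow> i \<le> r \<Longrightarrow> pfac q i \<in> H"
  by (simp add: pfac_def hecke_add hecke_scale hecke_hT uelt_dgroup)

lemma mul_pfac: "g \<bullet> pfac q i = hscale (q ^ (i - 1)) g + g \<bullet> hT (uelt i)"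
  by (simp add: pfac_def mul_add_right mul_scale_right)

lemma hpi_pprod: "P a = pprod r q 2 (Suc a) (hT 1)"
  by (simp add: hpi_def pprod_def pfac_def)

lemma pprod_Suc: "m \<le> n \<Longrightarrow> pprod r q m (Suc n) g = pprod r q m n g \<bullet> pfac q n"
  by (simp add: pprod_def)

lemma pprod_refl [simp]: "n \<le> m \<Longrightarrow> pprod r q m n g = g"
  by (simp add: pprod_def)

lemma pprod_append: "m \<le> k \<Longrightarrow> k \<le> n \<Longrightarrow> pprod r q k n (pprod r q m k g) = pprod r q m n g"
  using upt_add_eq_append[of m k "n - k"] by (simp add: pprod_def flip: foldl_append)

lemma hecke_pprod: "g \<in> H \<Longrightarrow> 2 \<le> m \<Longrightarrow> n \<le> Suc r \<Longrightarrow> pprod r q m n g \<in> H"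
  by (induction n) (auto simp: pprod_Suc hecke_mul not_less_eq_eq[symmetric] dest: Suc_leD,
      metis hecke_mul not_less_eq_eq pprod_Suc pprod_refl)

lemma mul_pprod:
  assumes "g \<in> H" "h \<in> H" "2 \<le> m" "n \<le> Suc r"
  shows "pprod r q m n (g \<bullet> h) = g \<bullet> pprod r q m n h"
  using assms(4)
proof (induction n)
  case (Suc n)
  show ?case
  proof (cases "m \<le> n")
    case True
    then show ?thesis
      using Suc assms by (simp add: pprod_Suc mul_assoc hecke_pprod hecke_pfac)
  qed simp
qed simp

lemma hecke_P: "a \<le> r \<Longrightarrow> P a \<in> H"
  by (simp add: hpi_pprod hecke_pprod hecke_hT)

lemma P_Suc: "1 \<le> a \<Longrightarrow> P (Suc a) = P a \<bullet> pfac q (Suc a)"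
  by (simp add: hpi_pprod pprod_Suc)

lemma P_0 [simp]: "P 0 = hT 1" and P_1 [simp]: "P (Suc 0) = hT 1"
  by (simp_all add: hpi_pprod)

lemma P_2: "P 2 = hscale q (hT 1) + hT (uelt 2)"
  using P_Suc[of 1] r2 by (simp add: mul_pfac numeral_2_eq_2 hecke_hT uelt_dgroup)

lemma mul_L_eq_R_mul:
  assumes "g \<in> H" "h \<in> H" "k < r"
  shows "g \<bullet> L k h = R k g \<bullet> h"
  using assms by (simp add: L_eq_mul R_eq_mul mul_assoc hecke_hT gen_dgroup)

lemma gen_T_uelt:
  assumes "1 \<le> i" "i < r" "2 \<le> j" "j \<le> r" "j \<noteq> i" "j \<noteq> Suc i"
  shows "L i (hT (uelt j)) = hT (gen i * uelt j)"
    and "up (uelt j) i"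
proof -
  have "\<bar>gen i \<langle>$\<rangle> k\<bar> < int j" if "1 \<le> k" "k < int j" for k
    using assms that by (auto simp: apply_gen lo_def hi_def)
  moreover have "gen i \<langle>$\<rangle> (int j) = int j"
    using assms by (auto simp: apply_gen lo_def hi_def)
  ultimately have "ucond (gen i) j" by (simp add: ucond_def)
  then show "L i (hT (uelt j)) = hT (gen i * uelt j)"
    using assms T_uelt[of j "gen i"] by (simp add: gen_T[symmetric] hecke_hT uelt_dgroup gen_dgroup)
  show "up (uelt j) i" using assms by (auto simp: up_def apply_uelt lo_def hi_def)
qed

text \<open>\<open>gen i\<close> commutes with \<open>uelt j\<close>, and both products of their
  basis elements are reduced. The factor may be appended to any \<open>g\<close> that already
  commutes with \<open>gen i\<close>.\<close>

lemma pfac_comm_far: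
  assumes "2 \<le> i" "i < r" "2 \<le> j" "j \<le> r" "j \<noteq> i" "j \<noteq> Suc i" "g \<in> H" "R i g = L i g"
  shows "R i (g \<bullet> pfac q j) = L i (g \<bullet> pfac q j)"
proof -
  have "uelt j \<in> signed r" using assms by (simp add: uelt_dgroup dgroup_signed)
  then have "gen i * uelt j = uelt j * gen i"
    by (rule gen_conj) (use assms in \<open>auto simp: apply_uelt lo_def hi_def\<close>)
  then have "L i (hT (uelt j)) = R i (hT (uelt j))"
    using gen_T_uelt[of i j] assms by (simp add: Rop_hT)
  moreover have "L i (hT 1) = R i (hT 1)"
    by (simp add: Rop_hT Lop_hT)
  ultimately have "R i (pfac q j) = L i (pfac q j)"
    by (simp add: pfac_def linop_add[OF linop_Rop] linop_scale[OF linop_Rop]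
        linop_add[OF linop_Lop] linop_scale[OF linop_Lop])
  then have "R i (g \<bullet> pfac q j) = g \<bullet> L i (pfac q j)"
    using assms by (simp add: hecke_pfac flip: mul_R)
  also have "\<dots> = R i g \<bullet> pfac q j"
    using assms by (intro mul_L_eq_R_mul hecke_pfac)
  finally show ?thesis using assms by (simp add: mul_L)
qed

text \<open>The two factors have to be treated together. Multiplying their product by
  \<open>gen i\<close> from the right gives \<open>hT (A * gen i)\<close> the coefficient
  \<open>q ^ i\<close> and \<open>hT (gen i * A)\<close> the coefficient
  \<open>q * q ^ (i - 1)\<close>, from the left the other way round; the exponents in
  \<open>pfac\<close> are such that these agree.\<close>

lemma pfac_comm_near:
  assumes i: "2 \<le> i" "Suc i \<le> r" and g: "g \<in> H" "R i g = L i g"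
  shows "R i (g \<bullet> pfac q i \<bullet> pfac q (Suc i)) = L i (g \<bullet> pfac q i \<bullet> pfac q (Suc i))"
proof -
  define A where "A = uelt i"
  define B where "B = uelt (Suc i)"
  have ii: "i < r" "i \<le> r" "2 \<le> Suc i" using i by auto
  have AB: "A \<in> dgroup r" "B \<in> dgroup r" "A * A = 1" "inverse A = A" "inverse B = B"
    using i by (auto simp: A_def B_def uelt_dgroup)
  have B: "B = gen i * A * gen i" using i by (simp add: A_def B_def uelt_Suc)
  have comm: "B * A = A * B"
    by (rule perm_eqI) (use i in \<open>simp add: A_def B_def apply_times apply_uelt\<close>)
  have gAB: "gen i * (A * B) = B * A * gen i"
    by (simp add: B mult.assoc)
  have lohi: "lo i = int i" "hi i = int i + 1" using i by (auto simp: lo_def hi_def)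
  have ups: "up 1 i" "up A i" "\<not> up B i" "\<not> up (A * B) i"
    using i by (auto simp: up_def lohi A_def B_def apply_times apply_uelt)
  have iAB: "inverse (A * B) = A * B" by (simp add: AB comm)
  define f where "f = pfac q i \<bullet> pfac q (Suc i)"
  have "ucond A (Suc i)" using i by (auto simp: A_def ucond_def apply_uelt)
  then have TAB: "hT A \<bullet> hT B = hT (A * B)"
    using T_uelt[of "Suc i" A] i AB by (simp add: B_def)
  have f: "f = hscale (q ^ i) (hscale (q ^ (i - 1)) (hT 1)) + hscale (q ^ i) (hT A)
      + hscale (q ^ (i - 1)) (hT B) + hT (A * B)"
    unfolding f_def mul_pfac[of "pfac q i"]
    using AB TAB by (simp add: pfac_def hscale_add mul_add_left mul_scale_left hecke_hT
        flip: A_def B_def)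
  have q: "q ^ (i - Suc 0) * q = q ^ i" using i by (simp add: power_eq_if mult.commute)
  have "R i f = L i f"
    using ups AB
    unfolding f linop_add[OF linop_Rop] linop_scale[OF linop_Rop] linop_add[OF linop_Lop] linop_scale[OF
      linop_Lop]
      Rop_hT Lop_hT perm.inverse_neutral iAB AB(4,5)
    by (simp add: gAB comm hscale_add q) (simp add: B mult.assoc)
  moreover have fH: "f \<in> H" using i by (simp add: f_def hecke_mul hecke_pfac)
  ultimately have "R i (g \<bullet> f) = g \<bullet> L i f"
    using g ii by (simp flip: mul_R)
  also have "\<dots> = R i g \<bullet> f"
    using g fH ii by (intro mul_L_eq_R_mul)
  finally have "R i (g \<bullet> f) = L i (g \<bullet> f)" using g ii by (simp add: mul_L)
  then show ?thesis using g i by (simp add: f_def mul_assoc hecke_pfac)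
qed

text \<open>Below \<open>i\<close> every factor commutes with \<open>gen i\<close>; from
  \<open>Suc i\<close> on the factors \<open>i\<close> and \<open>Suc i\<close> occur as a pair. At
  \<open>a = i\<close> the pair is incomplete, which is why this value is excluded.\<close>

lemma P_comm_ge2:
  assumes i: "2 \<le> i" "i < r" and a: "a \<le> r" "a \<noteq> i"
  shows "R i (P a) = L i (P a)"
proof -
  have one: "R i (hT 1) = L i (hT 1)" by (simp add: Rop_hT Lop_hT)
  have less: "R i (P a) = L i (P a)" if "a < i" for a
    using that
  proof (induction a)
    case (Suc a)
    show ?case
    proof (cases "1 \<le> a")
      case True
      then show ?thesis
        unfolding P_Suc[OF True] using Suc i by (intro pfac_comm_far) (auto simp: hecke_P)
    next
      case False
      then have "a = 0" by simp
      then show ?thesis using one by simp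
    qed
  qed (use one in simp)
  have base: "R i (P (Suc i)) = L i (P (Suc i))"
  proof -
    have "P (Suc i) = P (i - 1) \<bullet> pfac q i \<bullet> pfac q (Suc i)"
      using P_Suc[of i] P_Suc[of "i - 1"] i by simp
    then show ?thesis using pfac_comm_near[of i "P (i - 1)"] less[of "i - 1"] i by (simp add: hecke_P)
  qed
  have "R i (P a) = L i (P a)" if "Suc i \<le> a" "a \<le> r" for a
    using that
  proof (induction a rule: dec_induct)
    case (step a)
    then show ?case
      using P_Suc[of a] i pfac_comm_far[of i "Suc a" "P a"] by (simp add: hecke_P)
  qed (use base in simp)
  with less show ?thesis using a by (metis Suc_leI nat_neq_iff)
qed

text \<open>For \<open>a = 2\<close> the product with either generator is \<open>q\<close> times
  \<open>hT (gen 0) + hT (gen 1)\<close> plus \<open>q - 1\<close> times \<open>hT (uelt 2)\<close>,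
  which is symmetric in the two. Each later \<open>uelt\<close> negates place \<open>1\<close>, so
  it exchanges \<open>gen 0\<close> and \<open>gen 1\<close>, between which the product so far does
  not distinguish.\<close>

lemma P_absorb:
  assumes a: "2 \<le> a" "a \<le> r"
  shows "R 0 (P a) = R 1 (P a)" "L 1 (P a) = R 1 (P a)" "L 0 (P a) = R 1 (P a)"
proof -
  have r: "0 < r" "1 < r" using r2 by auto
  have "R 0 (P a) = R 1 (P a) \<and> L 1 (P a) = R 1 (P a) \<and> L 0 (P a) = R 1 (P a)"
    using a
  proof (induction a rule: dec_induct)
    case base
    have c: "gen 1 * gen 0 = gen 0 * gen 1"
      by (rule perm_eqI) (simp add: apply_times apply_gen lo_def hi_def)
    have ups: "up 1 0" "up 1 1" "\<not> up (uelt 2) 0" "\<not> up (uelt 2) 1"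
      by (auto simp: up_def apply_uelt lo_def hi_def)
    have u2: "uelt 2 = gen 1 * gen 0" by (simp only: uelt_2 c)
    have prods: "uelt 2 * gen 0 = gen 1" "gen 1 * uelt 2 = gen 0"
      unfolding u2 by simp_all
    have prods': "uelt 2 * gen 1 = gen 0" "gen 0 * uelt 2 = gen 1"
      unfolding uelt_2 by simp_all
    show ?case
      unfolding P_2 linop_add[OF linop_Rop] linop_scale[OF linop_Rop]
        linop_add[OF linop_Lop] linop_scale[OF linop_Lop] Rop_hT Lop_hT perm.inverse_neutral
      using ups prods prods' by (simp add: add_ac)
  next
    case (step a)
    let ?u = "hT (uelt (Suc a)) :: int perm \<Rightarrow> 'a"
    have uH: "?u \<in> H" using step by (simp add: hecke_hT uelt_dgroup)
    have PH: "P a \<in> H" using step by (simp add: hecke_P)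
    have ucs: "ucond (gen k) (Suc a)" if "k \<le> 1" for k
    proof -
      have "\<bar>gen k \<langle>$\<rangle> j\<bar> < int (Suc a)" if "1 \<le> j" "j < int (Suc a)" for j
        using \<open>k \<le> 1\<close> step that by (auto simp: apply_gen lo_def hi_def)
      moreover have "gen k \<langle>$\<rangle> (int (Suc a)) = int (Suc a)"
        using \<open>k \<le> 1\<close> step by (auto simp: apply_gen lo_def hi_def)
      ultimately show ?thesis by (simp add: ucond_def)
    qed
    have Lu: "L k ?u = hT (gen k * uelt (Suc a))" if "k \<le> 1" for k
      using T_uelt[of "Suc a" "gen k"] ucs[OF that] step that r2 uH
      by (simp add: gen_T[symmetric] gen_dgroup)
    have ups: "up (uelt (Suc a)) k" if "k \<le> 1" for k
      using that step by (auto simp: up_def apply_uelt lo_def hi_def)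
    have us: "uelt (Suc a) \<in> signed r" using step by (simp add: uelt_dgroup dgroup_signed)
    have "gen 0 * uelt (Suc a) = uelt (Suc a) * gen 1" "gen 1 * uelt (Suc a) = uelt (Suc a) * gen 0"
      by (rule gen_conj[OF us], use step in \<open>auto simp: apply_uelt lo_def hi_def\<close>)+
    then have sw: "R 1 ?u = L 0 ?u" "R 0 ?u = L 1 ?u"
      using Lu[of 0] Lu[of 1] ups[of 0] ups[of 1] by (simp_all add: Rop_hT)
    have PL: "P a \<bullet> L k ?u = R k (P a) \<bullet> ?u" if "k < r" for k
      using that PH uH by (intro mul_L_eq_R_mul)
    have PS: "P (Suc a) = hscale (q ^ a) (P a) + P a \<bullet> ?u"
      using P_Suc[of a] step by (simp add: mul_pfac)
    have "R k (P a \<bullet> ?u) = P a \<bullet> R k ?u" if "k < r" for k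
      using that PH uH by (simp add: mul_R)
    moreover have "L k (P a \<bullet> ?u) = L k (P a) \<bullet> ?u" if "k < r" for k
      using that PH by (simp add: mul_L)
    ultimately have "R k (P (Suc a)) = hscale (q ^ a) (R k (P a)) + P a \<bullet> R k ?u"
      "L k (P (Suc a)) = hscale (q ^ a) (L k (P a)) + L k (P a) \<bullet> ?u" if "k < r" for k
      using that by (simp_all only: PS linop_add[OF linop_Rop] linop_scale[OF linop_Rop]
        linop_add[OF linop_Lop] linop_scale[OF linop_Lop])
    then show ?case
      using step.IH step.prems r sw PL[OF r(1)] PL[OF r(2)] by simp
  qed
  then show "R 0 (P a) = R 1 (P a)" "L 1 (P a) = R 1 (P a)" "L 0 (P a) = R 1 (P a)" by auto
qed

lemma P_comm:
  assumes i: "1 \<le> i" "i < r" and a: "a \<le> r" "a \<noteq> i"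
  shows "R i (P a) = L i (P a)"
proof (cases "2 \<le> i")
  case False
  then have i1: "i = 1" using i by simp
  show ?thesis
  proof (cases "2 \<le> a")
    case True
    then show ?thesis using P_absorb[of a] a i1 by simp
  next
    case False
    then have "P a = hT 1" using a i1 by (cases a) auto
    then show ?thesis by (simp add: Rop_hT Lop_hT)
  qed
qed (use P_comm_ge2 assms in auto)

text \<open>Each factor is fixed by \<open>star\<close> and the factors commute, so reversing their
  order changes nothing. The commutation of two factors is obtained by applying \<open>star\<close>
  to one reduced product.\<close>

lemma star_P: "a \<le> r \<Longrightarrow> star (P a) = P a"
proof (induction a)
  case 0
  show ?case by simp
next
  case (Suc a)
  show ?case
  proof (cases "1 \<le> a")
    case True
    let ?F = "pfac q (Suc a)"
    have F: "?F \<in> H" using Suc True by (simp add: hecke_pfac)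
    have "star ?F = ?F"
      using True by (simp add: pfac_def linop_add[OF linop_star] linop_scale[OF linop_star])
    then have "star (P (Suc a)) = ?F \<bullet> P a"
      using Suc F True by (simp add: P_Suc star_mul hecke_P)
    also have "\<dots> = P a \<bullet> ?F"
    proof -
      have "?F \<bullet> P b = P b \<bullet> ?F" if "b \<le> a" for b
        using that
      proof (induction b)
        case (Suc b)
        show ?case
        proof (cases "1 \<le> b")
          case True
          let ?G = "pfac q (Suc b)"
          have G: "?G \<in> H" using Suc.prems \<open>Suc a \<le> r\<close> True by (intro hecke_pfac) auto
          have Pb: "P b \<in> H" using Suc.prems \<open>Suc a \<le> r\<close> by (intro hecke_P) auto
          have "ucond (uelt (Suc b)) (Suc a)"
            using Suc.prems True by (auto simp: ucond_def apply_uelt)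
          then have uu: "hT (uelt (Suc b)) \<bullet> hT (uelt (Suc a)) = hT (uelt (Suc b) * uelt (Suc a))"
            using Suc.prems True \<open>Suc a \<le> r\<close> by (intro T_uelt uelt_dgroup) auto
          have us: "uelt (Suc b) \<in> dgroup r" "uelt (Suc a) \<in> dgroup r"
            using Suc.prems True \<open>Suc a \<le> r\<close> by (auto intro: uelt_dgroup)
          have "uelt (Suc b) * uelt (Suc a) = uelt (Suc a) * uelt (Suc b)"
            by (rule perm_eqI) (use Suc.prems True in \<open>simp add: apply_times apply_uelt\<close>)
          moreover have "hT (uelt (Suc a)) \<bullet> hT (uelt (Suc b)) = star (hT (uelt (Suc b)) \<bullet> hT (uelt (Suc
            a)))"
            using us True Suc.prems by (simp add: star_mul hecke_hT)
          ultimately have "hT (uelt (Suc a)) \<bullet> hT (uelt (Suc b)) = hT (uelt (Suc b)) \<bullet> hT (uelt (Suc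
            a))"
            using True Suc.prems by (simp add: uu)
          then have "?F \<bullet> ?G = ?G \<bullet> ?F"
            using us by (simp add: pfac_def mul_add_left mul_add_right mul_scale_left mul_scale_right
                hecke_hT hscale_add mult.commute add_ac)
          then show ?thesis
            using Suc True F G Pb by (simp add: P_Suc mul_assoc[symmetric])
              (simp add: mul_assoc F G Pb)
        next
          case False
          then have "b = 0" by simp
          then show ?thesis using F by simp
        qed
      qed (use F in simp)
      then show ?thesis by simp
    qed
    finally show ?thesis using True by (simp add: P_Suc)
  next
    case False
    then have "a = 0" by simp
    then show ?thesis by simp
  qed
qed

text \<open>In the expansion each factor contributes either its constant or its
  \<open>uelt i\<close>, and all products are reduced, so the support consists of points
  \<open>x * e\<close>. A point that is reached only with \<open>e = 1\<close> receives the
  constants of all factors, whence the power of \<open>q\<close>.\<close>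

lemma pprod_support:
  assumes m: "2 \<le> m" "n \<le> Suc r" and g: "g \<in> H"
    and c: "\<And>x i. g x \<noteq> 0 \<Longrightarrow> m \<le> i \<Longrightarrow> i < n \<Longrightarrow> ucond x i"
  shows "pprod r q m n g y \<noteq> 0 \<Longrightarrow> \<exists>x e. g x \<noteq> 0 \<and> e \<in> flips r m n \<and> y = x * e"
    and "(\<And>x e. g x \<noteq> 0 \<Longrightarrow> e \<in> flips r m n \<Longrightarrow> y = x * e \<Longrightarrow> e = 1) \<Longrightarrow>
      pprod r q m n g y = q ^ (\<Sum>i = m..<n. i - 1) * g y"
proof -
  have triv: "\<exists>x e. g x \<noteq> 0 \<and> e \<in> flips r m n \<and> y = x * e" if "g y \<noteq> 0" for n y
    using that by (intro exI[of _ y] exI[of _ 1]) auto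
  have "(pprod r q m n g y \<noteq> 0 \<longrightarrow> (\<exists>x e. g x \<noteq> 0 \<and> e \<in> flips r m n \<and> y = x * e)) \<and>
    ((\<forall>x e. g x \<noteq> 0 \<longrightarrow> e \<in> flips r m n \<longrightarrow> y = x * e \<longrightarrow> e = 1) \<longrightarrow>
      pprod r q m n g y = q ^ (\<Sum>i = m..<n. i - 1) * g y)" for y
    using m(2) c
  proof (induction n arbitrary: y)
    case 0
    then show ?case using triv by auto
  next
    case (Suc n)
    show ?case
    proof (cases "m \<le> n")
      case False
      then show ?thesis using triv by auto
    next
      case True
      let ?p = "pprod r q m n g"
      have n: "2 \<le> n" "n \<le> r" using True m Suc.prems by auto
      have IH: "?p y \<noteq> 0 \<Longrightarrow> \<exists>x e. g x \<noteq> 0 \<and> e \<in> flips r m n \<and> y = x * e"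
        "(\<forall>x e. g x \<noteq> 0 \<longrightarrow> e \<in> flips r m n \<longrightarrow> y = x * e \<longrightarrow> e = 1) \<Longrightarrow>
          ?p y = q ^ (\<Sum>i = m..<n. i - 1) * g y" for y
        using Suc.IH[of y] Suc.prems by auto
      \<comment> \<open>The flips used so far fix place \<open>n\<close> and preserve all absolute
        values, so the next factor again multiplies without quadratic relations.\<close>
      have ucp: "ucond y n" if nz: "?p y \<noteq> 0" for y
      proof -
        obtain x e where xe: "g x \<noteq> 0" "e \<in> flips r m n" "y = x * e" using IH(1)[OF nz] by blast
        have x: "x \<in> signed r" using xe(1) g by (metis dgroup_signed hecke_outside)
        have "ucond x n" using Suc.prems(2)[OF xe(1)] True by simp
        moreover have "\<bar>y \<langle>$\<rangle> j\<bar> = \<bar>x \<langle>$\<rangle> j\<bar>" for j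
          using xe(2,3) x by (auto simp: apply_times flips_def intro!: signed_abs_eq[OF x])
        moreover have "e \<langle>$\<rangle> (int n) = int n" using xe(2) n by (simp add: flips_def)
        ultimately show ?thesis by (simp add: ucond_def xe(3) apply_times)
      qed
      have pH: "?p \<in> H" using g m Suc.prems by (intro hecke_pprod) auto
      have step: "pprod r q m (Suc n) g y = q ^ (n - 1) * ?p y + ?p (y * uelt n)"
        using mul_T_uelt[OF n pH ucp] True by (simp add: pprod_Suc mul_pfac hscale_apply)
      have flip: "\<exists>x e. g x \<noteq> 0 \<and> e \<in> flips r m (Suc n) \<and> y = x * e \<and> e \<noteq> 1"
        if nz: "?p (y * uelt n) \<noteq> 0"
      proof -
        obtain x e where xe: "g x \<noteq> 0" "e \<in> flips r m n" "y * uelt n = x * e" using IH(1)[OF nz]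
          by blast
        have "y = y * uelt n * uelt n" using n by simp
        also have "\<dots> = x * (e * uelt n)" unfolding xe(3) by (simp add: mult.assoc)
        finally show ?thesis using flips_uelt[OF xe(2) n True] xe(1) by blast
      qed
      have mono: "flips r m n \<subseteq> flips r m (Suc n)" by (rule flips_mono) simp
      show ?thesis
      proof (intro conjI impI)
        assume "pprod r q m (Suc n) g y \<noteq> 0"
        then have "?p y \<noteq> 0 \<or> ?p (y * uelt n) \<noteq> 0" using step by auto
        then show "\<exists>x e. g x \<noteq> 0 \<and> e \<in> flips r m (Suc n) \<and> y = x * e"
          using IH(1)[of y] flip mono by blast
      next
        assume *: "\<forall>x e. g x \<noteq> 0 \<longrightarrow> e \<in> flips r m (Suc n) \<longrightarrow> y = x * e \<longrightarrow> e = 1"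
        then have "?p (y * uelt n) = 0" using flip by blast
        moreover have "?p y = q ^ (\<Sum>i = m..<n. i - 1) * g y"
          using * mono by (intro IH(2)) blast
        ultimately show "pprod r q m (Suc n) g y = q ^ (\<Sum>i = m..<Suc n. i - 1) * g y"
          using step True by (simp add: power_add mult_ac)
      qed
    qed
  qed
  then show "pprod r q m n g y \<noteq> 0 \<Longrightarrow> \<exists>x e. g x \<noteq> 0 \<and> e \<in> flips r m n \<and> y = x * e"
    and "(\<And>x e. g x \<noteq> 0 \<Longrightarrow> e \<in> flips r m n \<Longrightarrow> y = x * e \<Longrightarrow> e = 1) \<Longrightarrow>
      pprod r q m n g y = q ^ (\<Sum>i = m..<n. i - 1) * g y" by blast+
qed

end

section \<open>Linear equations for the ideals generated by hpi\<close>

text \<open>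
  Conjugation with \<open>sgen 0\<close> is the diagram automorphism: it exchanges \<open>gen 0\<close> with \<open>gen 1\<close> and fixes the
  other generators, so \<open>tw c * gen k * tw c = gen (tk c k)\<close> for \<open>1 \<le> k\<close>.
\<close>

definition tw :: "bool \<Rightarrow> int perm" where
  "tw c = (if c then sgen 0 else 1)"

definition tk :: "bool \<Rightarrow> nat \<Rightarrow> nat" where
  "tk c k = (if c \<and> k = 1 then 0 else k)"

lemma apply_tw: "tw c \<langle>$\<rangle> x = (if c \<and> \<bar>x\<bar> = 1 then - x else x)"
  by (auto simp: tw_def apply_sgen0)

lemma abs_tw [simp]: "\<bar>tw c \<langle>$\<rangle> x\<bar> = \<bar>x\<bar>"
  by (simp add: apply_tw)

lemma inverse_tw [simp]: "inverse (tw c) = tw c"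
  by (simp add: tw_def)

lemma tw_tw [simp]: "tw c * tw c = 1" "tw c * (tw c * x) = x" "x * tw c * tw c = x"
  by (simp_all add: tw_def mult.assoc) (simp flip: mult.assoc)

lemma gen_tw:
  assumes "1 \<le> k"
  shows "gen (tk c k) * tw c = tw c * gen k" "tw c * gen (tk c k) = gen k * tw c"
proof -
  show 1: "gen (tk c k) * tw c = tw c * gen k"
  proof (cases "c \<and> k = 1")
    case True
    have "gen 0 * sgen 0 = sgen 0 * gen 1" by (simp add: gen_def mult.assoc)
    then show ?thesis using True by (simp add: tk_def tw_def)
  next
    case False
    have "gen k * sgen 0 = sgen 0 * gen k" if "2 \<le> k"
      by (rule perm_eqI) (use that in \<open>auto simp: apply_times apply_sgen0 apply_gen lo_def hi_def\<close>)
    then show ?thesis using False assms by (auto simp: tk_def tw_def)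
  qed
  show "tw c * gen (tk c k) = gen k * tw c"
    using arg_cong[OF 1, of inverse] by simp
qed

lemma tw_lo_hi: "1 \<le> k \<Longrightarrow> tw c \<langle>$\<rangle> (lo (tk c k)) = lo k" "1 \<le> k \<Longrightarrow> tw c \<langle>$\<rangle> (hi (tk c k)) = hi k"
  by (auto simp: apply_tw tk_def lo_def hi_def)

lemma gen_positive:
  assumes "1 \<le> k" "k \<noteq> a" "1 \<le> i" "i \<le> int a"
  shows "1 \<le> gen k \<langle>$\<rangle> i" "gen k \<langle>$\<rangle> i \<le> int a"
  using assms by (auto simp: apply_gen lo_def hi_def)

text \<open>
  Let \<open>E\<^sub>a\<close> be the group of even sign changes of \<open>1, ..., a\<close>.  The set \<open>Yset r b a\<close> is a transversal of the
  double cosets of \<open>E\<^sub>b\<close> and \<open>E\<^sub>a\<close>.  Normally the representative is positive at the positions up to \<open>a\<close> and at the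
  values up to \<open>b\<close>.  As only even sign changes are available, there may remain a sign at the value 1 (\<open>\<epsilon>\<close>) or at
  the position 1 (\<open>\<delta>\<close>); if some position up to \<open>a\<close> carries a value up to \<open>b\<close>, then one of them suffices and
  only \<open>\<epsilon>\<close> is used.
\<close>

definition pos :: "nat \<Rightarrow> nat \<Rightarrow> int perm \<Rightarrow> bool" where
  "pos b a y \<longleftrightarrow> (\<forall>i. 1 \<le> i \<and> i \<le> int a \<longrightarrow> 0 < y \<langle>$\<rangle> i) \<and>
     (\<forall>j. 1 \<le> j \<and> j \<le> int b \<longrightarrow> 0 < inverse y \<langle>$\<rangle> j)"

definition neut :: "nat \<Rightarrow> nat \<Rightarrow> int perm \<Rightarrow> bool" where
  "neut b a y \<longleftrightarrow> (\<exists>i. 1 \<le> i \<and> i \<le> int a \<and> \<bar>y \<langle>$\<rangle> i\<bar> \<le> int b)"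

definition admissible :: "nat \<Rightarrow> nat \<Rightarrow> bool \<Rightarrow> bool \<Rightarrow> int perm \<Rightarrow> bool" where
  "admissible b a \<epsilon> \<delta> y \<longleftrightarrow> pos b a y \<and> (\<epsilon> \<longrightarrow> 2 \<le> b) \<and> (\<delta> \<longrightarrow> 2 \<le> a \<and> \<not> neut b a y)"

definition tri :: "nat \<Rightarrow> nat \<Rightarrow> bool \<Rightarrow> bool \<Rightarrow> int perm \<Rightarrow> bool" where
  "tri b a \<epsilon> \<delta> x \<longleftrightarrow> admissible b a \<epsilon> \<delta> (tw \<epsilon> * x * tw \<delta>)"

definition Yset :: "nat \<Rightarrow> nat \<Rightarrow> nat \<Rightarrow> int perm set" where
  "Yset r b a = {x \<in> dgroup r. \<exists>\<epsilon> \<delta>. tri b a \<epsilon> \<delta> x}"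

lemma admissible_right:
  assumes "admissible b a \<epsilon> \<delta> y" "1 \<le> k" "k \<noteq> a"
  shows "admissible b a \<epsilon> \<delta> (y * gen k)"
proof -
  have gg: "gen k \<langle>$\<rangle> (gen k \<langle>$\<rangle> i) = i" for i
    using apply_times[of "gen k" "gen k", THEN fun_cong, of i] by simp
  have gp: "0 < gen k \<langle>$\<rangle> i" if "0 < i" for i
    using that assms(2) by (auto simp: apply_gen lo_def hi_def)
  show ?thesis
    using assms gen_positive[of k a] unfolding admissible_def pos_def neut_def
    by (auto simp: apply_times intro: gp)
qed

lemma admissible_left:
  assumes "admissible b a \<epsilon> \<delta> y" "1 \<le> k" "k \<noteq> b"
  shows "admissible b a \<epsilon> \<delta> (gen k * y)"
proof -
  have gp: "0 < gen k \<langle>$\<rangle> i" if "0 < i" for i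
    using that assms(2) by (auto simp: apply_gen lo_def hi_def)
  have gb: "\<bar>gen k \<langle>$\<rangle> i\<bar> \<le> int b \<longrightarrow> \<bar>i\<bar> \<le> int b" if "0 < i" for i
    using that assms(2,3) by (auto simp: apply_gen lo_def hi_def)
  have "\<not> neut b a (gen k * y)" if "\<not> neut b a y" "pos b a y"
  proof
    assume "neut b a (gen k * y)"
    then obtain i where i: "1 \<le> i" "i \<le> int a" "\<bar>gen k \<langle>$\<rangle> (y \<langle>$\<rangle> i)\<bar> \<le> int b"
      by (auto simp: neut_def apply_times)
    have "0 < y \<langle>$\<rangle> i" using that(2) i by (simp add: pos_def)
    then have "\<bar>y \<langle>$\<rangle> i\<bar> \<le> int b" using gb i(3) by blast
    then show False using that(1) i by (auto simp: neut_def)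
  qed
  then show ?thesis
    using assms gen_positive[of k b] unfolding admissible_def pos_def
    by (auto simp: apply_times intro: gp)
qed

text \<open>On the normalised element \<open>tw \<epsilon> * x * tw \<delta>\<close> the twisted
  generator becomes the plain \<open>gen k\<close>, which permutes the places up to \<open>a\<close>
  among themselves.\<close>

lemma tri_right:
  assumes "tri b a \<epsilon> \<delta> x" "1 \<le> k" "k \<noteq> a"
  shows "tri b a \<epsilon> \<delta> (x * gen (tk \<delta> k))"
proof -
  have "tw \<epsilon> * (x * gen (tk \<delta> k)) * tw \<delta> = (tw \<epsilon> * x * tw \<delta>) * gen k"
    using gen_tw[OF assms(2)] by (simp add: mult.assoc)
  then show ?thesis using admissible_right assms unfolding tri_def by simp
qed

lemma tri_left:
  assumes "tri b a \<epsilon> \<delta> x" "1 \<le> k" "k \<noteq> b"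
  shows "tri b a \<epsilon> \<delta> (gen (tk \<epsilon> k) * x)"
proof -
  have "tw \<epsilon> * (gen (tk \<epsilon> k) * x) * tw \<delta> = gen k * (tw \<epsilon> * x * tw \<delta>)"
    using gen_tw(2)[OF assms(2), of \<epsilon>] by (simp flip: mult.assoc)
  then show ?thesis using admissible_left assms unfolding tri_def by simp
qed

lemma sorted_less:
  assumes "\<And>k. 1 \<le> k \<Longrightarrow> k < a \<Longrightarrow> up x k" "1 \<le> i" "i < j" "j \<le> int a"
  shows "x \<langle>$\<rangle> i < x \<langle>$\<rangle> j"
proof -
  have "x \<langle>$\<rangle> i < x \<langle>$\<rangle> (i + 1 + int n)" if "i + 1 + int n \<le> int a" for n
    using that
  proof (induction n)
    case 0
    then show ?case using assms(1)[of "nat i"] assms(2) by (simp add: up_def lo_def hi_def)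
  next
    case (Suc n)
    have "x \<langle>$\<rangle> (i + 1 + int n) < x \<langle>$\<rangle> (i + 1 + int n + 1)"
      using assms(1)[of "nat (i + 1 + int n)"] assms(2) Suc.prems
      by (simp add: up_def lo_def hi_def)
    then show ?case using Suc by (simp add: algebra_simps)
  qed
  from this[of "nat (j - i - 1)"] show ?thesis using assms by simp
qed

lemma sorted_abs_less:
  assumes "\<And>k. k < a \<Longrightarrow> up x k" "x \<in> signed r" "1 \<le> i" "i < j" "j \<le> int a"
  shows "\<bar>x \<langle>$\<rangle> i\<bar> < x \<langle>$\<rangle> j"
proof -
  have 1: "x \<langle>$\<rangle> i < x \<langle>$\<rangle> j" if "1 \<le> i" "i < j" "j \<le> int a" for i j
    using sorted_less[of a x i j] assms(1) that by blast
  have "- (x \<langle>$\<rangle> 1) < x \<langle>$\<rangle> 2"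
    using assms(1)[of 0] assms(3-5) signed_minus[OF assms(2), of 1] by (simp add: up_def lo_def hi_def)
  then have 2: "- (x \<langle>$\<rangle> 1) < x \<langle>$\<rangle> j" if "2 \<le> j" "j \<le> int a" for j
    using 1[of 2 j] that by (cases "j = 2") auto
  have "- (x \<langle>$\<rangle> i) < x \<langle>$\<rangle> j"
  proof (cases "i = 1")
    case True
    then show ?thesis using 2 assms by simp
  next
    case False
    have "x \<langle>$\<rangle> 1 < x \<langle>$\<rangle> i" "- (x \<langle>$\<rangle> 1) < x \<langle>$\<rangle> i" using 1[of 1 i] 2[of i] False assms by auto
    then show ?thesis using 1[of i j] assms by linarith
  qed
  then show ?thesis using 1[of i j] assms by linarith
qed

lemma sorted_ge:
  assumes "\<And>k. 1 \<le> k \<Longrightarrow> k < a \<Longrightarrow> up x k" "0 < x \<langle>$\<rangle> 1" "1 \<le> i" "i \<le> int a"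
  shows "i \<le> x \<langle>$\<rangle> i"
proof -
  have "1 + int n \<le> x \<langle>$\<rangle> (1 + int n)" if "1 + int n \<le> int a" for n
    using that
  proof (induction n)
    case (Suc n)
    then show ?case using sorted_less[of a x "1 + int n" "1 + int (Suc n)"] assms(1) by simp
  qed (use assms in simp)
  from this[of "nat (i - 1)"] show ?thesis using assms by simp
qed

section \<open>Signs and descents of the representatives\<close>

context type_D
begin

lemma tw_signed: "tw c \<in> signed r"
  using r2 sgen0_signed[of r] by (simp add: tw_def)

lemma untwist: "x = tw \<epsilon> * (tw \<epsilon> * x * tw \<delta>) * tw \<delta>"
  by (simp add: mult.assoc)

text \<open>The first two parts recover the twists from the signs of \<open>x\<close> at place
  \<open>1\<close> and at value \<open>1\<close>, the other two exclude negative signs elsewhere.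
  They yield uniqueness of the twists and, for sorted elements, that no nontrivial flip stays in
  \<open>Yset\<close>.\<close>

lemma tri_apply:
  assumes x: "x \<in> signed r" and t: "tri b a \<epsilon> \<delta> x"
  shows "2 \<le> a \<Longrightarrow> \<not> neut b a (tw \<epsilon> * x * tw \<delta>) \<Longrightarrow> x \<langle>$\<rangle> 1 < 0 \<longleftrightarrow> \<delta>"
    and "2 \<le> b \<Longrightarrow> inverse x \<langle>$\<rangle> 1 < 0 \<longleftrightarrow> \<epsilon>"
    and "2 \<le> i \<Longrightarrow> i \<le> int a \<Longrightarrow> int b < \<bar>x \<langle>$\<rangle> i\<bar> \<Longrightarrow> 0 < x \<langle>$\<rangle> i"
    and "2 \<le> j \<Longrightarrow> j \<le> int b \<Longrightarrow> 0 < inverse x \<langle>$\<rangle> j"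
proof -
  let ?y = "tw \<epsilon> * x * tw \<delta>"
  have ys: "?y \<in> signed r" by (intro times_signed tw_signed x)
  have iys: "inverse ?y \<in> signed r" using ys by (rule inverse_signed)
  have ad: "pos b a ?y" "\<epsilon> \<Longrightarrow> 2 \<le> b" "\<delta> \<Longrightarrow> 2 \<le> a" "\<delta> \<Longrightarrow> \<not> neut b a ?y"
    using t by (auto simp: tri_def admissible_def)
  have xy: "x \<langle>$\<rangle> i = tw \<epsilon> \<langle>$\<rangle> (?y \<langle>$\<rangle> (tw \<delta> \<langle>$\<rangle> i))" for i
    by (subst untwist[of x \<epsilon> \<delta>]) (simp add: apply_times)
  have ixy: "inverse x \<langle>$\<rangle> i = tw \<delta> \<langle>$\<rangle> (inverse ?y \<langle>$\<rangle> (tw \<epsilon> \<langle>$\<rangle> i))" for i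
    by (subst untwist[of x \<epsilon> \<delta>]) (simp add: apply_times)
  have ypos: "0 < ?y \<langle>$\<rangle> i" if "1 \<le> i" "i \<le> int a" for i using ad(1) that by (simp add: pos_def)
  have iypos: "0 < inverse ?y \<langle>$\<rangle> i" if "1 \<le> i" "i \<le> int b" for i using ad(1) that
    by (simp add: pos_def)
  \<comment> \<open>When \<delta> is set, no place up to \<open>a\<close> carries a value up to
    \<open>b\<close>; the twist at place \<open>1\<close> therefore leaves these values
    alone.\<close>
  have ibig: "inverse ?y \<langle>$\<rangle> j \<noteq> 1" if "\<delta>" "1 \<le> j" "j \<le> int b" for j
  proof
    assume "inverse ?y \<langle>$\<rangle> j = 1"
    then have "?y \<langle>$\<rangle> 1 = j" by (metis inverse_apply(2))
    then have "neut b a ?y" using that ad(3)[OF that(1)] unfolding neut_def by (intro exI[of _ 1]) auto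
    then show False using ad(4) that by blast
  qed
  show "x \<langle>$\<rangle> 1 < 0 \<longleftrightarrow> \<delta>" if "2 \<le> a" "\<not> neut b a ?y"
  proof -
    have p: "0 < ?y \<langle>$\<rangle> 1" using ypos[of 1] that by simp
    moreover have "int b < ?y \<langle>$\<rangle> 1" using that p unfolding neut_def by (auto dest!: spec[of _ 1])
    ultimately show ?thesis
      using ad(2) xy[of 1] signed_minus[OF ys, of 1] by (cases \<delta>; cases \<epsilon>) (simp_all add: apply_tw)
  qed
  show "inverse x \<langle>$\<rangle> 1 < 0 \<longleftrightarrow> \<epsilon>" if "2 \<le> b"
    using ixy[of 1] iypos[of 1] ibig[of 1] that signed_minus[OF iys, of 1]
    by (cases \<delta>; cases \<epsilon>) (simp_all add: apply_tw)
  show "0 < x \<langle>$\<rangle> i" if "2 \<le> i" "i \<le> int a" "int b < \<bar>x \<langle>$\<rangle> i\<bar>"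
  proof -
    have "tw \<delta> \<langle>$\<rangle> i = i" using that by (simp add: apply_tw)
    then have xi: "x \<langle>$\<rangle> i = tw \<epsilon> \<langle>$\<rangle> (?y \<langle>$\<rangle> i)" using xy[of i] by simp
    then have "int b < \<bar>?y \<langle>$\<rangle> i\<bar>" using that(3) by simp
    then show ?thesis using ad(2) ypos[of i] that xi by (auto simp: apply_tw)
  qed
  show "0 < inverse x \<langle>$\<rangle> j" if "2 \<le> j" "j \<le> int b"
  proof -
    have "tw \<epsilon> \<langle>$\<rangle> j = j" using that by (simp add: apply_tw)
    then show ?thesis using ixy[of j] iypos[of j] ibig[of j] that by (auto simp: apply_tw)
  qed
qed

lemma neut_tw:
  assumes "x \<in> signed r"
  shows "neut b a (tw \<epsilon> * x * tw \<delta>) \<longleftrightarrow> neut b a x"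
proof -
  have "\<bar>(tw \<epsilon> * x * tw \<delta>) \<langle>$\<rangle> i\<bar> = \<bar>x \<langle>$\<rangle> i\<bar>" for i
    using signed_abs_eq[OF assms, of "tw \<delta> \<langle>$\<rangle> i" i] by (simp add: apply_times)
  then show ?thesis by (simp add: neut_def)
qed

lemma tri_unique:
  assumes x: "x \<in> signed r" and t: "tri b a \<epsilon> \<delta> x" "tri b a \<epsilon>' \<delta>' x"
  shows "\<epsilon> = \<epsilon>'" "\<delta> = \<delta>'"
proof -
  have imp: "\<epsilon> \<longrightarrow> 2 \<le> b" "\<epsilon>' \<longrightarrow> 2 \<le> b" "\<delta> \<longrightarrow> 2 \<le> a \<and> \<not> neut b a x" "\<delta>' \<longrightarrow> 2 \<le> a \<and> \<not> neut b a x"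
    using t x by (auto simp: tri_def admissible_def neut_tw)
  show "\<epsilon> = \<epsilon>'" using tri_apply(2)[OF x t(1)] tri_apply(2)[OF x t(2)] imp by blast
  show "\<delta> = \<delta>'" using tri_apply(1)[OF x t(1)] tri_apply(1)[OF x t(2)] imp x by (auto simp: neut_tw)
qed

text \<open>Base case of the elimination. The ascents give |x 1| < x 2 < ... < x a, and likewise for
  the inverse up to \<open>b\<close>, so only the signs at place \<open>1\<close> and value
  \<open>1\<close> are open. If some place up to \<open>a\<close> carries a value up to
  \<open>b\<close>, sortedness forces \<open>x\<close> to send \<open>1\<close> to \<open>1\<close>
  or \<open>-1\<close>, and the two signs coincide; otherwise they are adjusted
  independently.\<close>

lemma no_descent_Yset:
  assumes x: "x \<in> dgroup r" and a: "a = 0 \<or> 2 \<le> a \<and> a \<le> r" and b: "b = 0 \<or> 2 \<le> b \<and> b \<le> r"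
    and ua: "\<And>k. k < r \<Longrightarrow> k \<noteq> a \<Longrightarrow> up x k" and ub: "\<And>k. k < r \<Longrightarrow> k \<noteq> b \<Longrightarrow> up (inverse x) k"
  shows "x \<in> Yset r b a"
proof -
  have xs: "x \<in> signed r" using x by (rule dgroup_signed)
  have ixs: "inverse x \<in> signed r" using xs by (rule inverse_signed)
  have sa: "\<bar>x \<langle>$\<rangle> i\<bar> < x \<langle>$\<rangle> j" if "1 \<le> i" "i < j" "j \<le> int a" for i j
    using sorted_abs_less[of a x r i j] ua xs a that by auto
  have sb: "\<bar>inverse x \<langle>$\<rangle> i\<bar> < inverse x \<langle>$\<rangle> j" if "1 \<le> i" "i < j" "j \<le> int b" for i j
    using sorted_abs_less[of b "inverse x" r i j] ub ixs b that by auto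
  have posa: "0 < x \<langle>$\<rangle> j" if "2 \<le> j" "j \<le> int a" for j using sa[of 1 j] that by simp
  have posb: "0 < inverse x \<langle>$\<rangle> j" if "2 \<le> j" "j \<le> int b" for j using sb[of 1 j] that by simp
  have nz: "x \<langle>$\<rangle> 1 \<noteq> 0" "inverse x \<langle>$\<rangle> 1 \<noteq> 0" using xs ixs by auto
  have abs_inv: "\<bar>inverse x \<langle>$\<rangle> j\<bar> = \<bar>i\<bar> \<longleftrightarrow> \<bar>x \<langle>$\<rangle> i\<bar> = \<bar>j\<bar>" for i j
    using signed_abs_eq_iff[OF xs, of i "inverse x \<langle>$\<rangle> j"] by auto
  show ?thesis
  proof (cases "neut b a x")
    case True
    then obtain i where i: "1 \<le> i" "i \<le> int a" "\<bar>x \<langle>$\<rangle> i\<bar> \<le> int b" by (auto simp: neut_def)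
    have "x \<langle>$\<rangle> i \<noteq> 0" using i xs by simp
    then have ab: "2 \<le> a" "2 \<le> b" using i a b by linarith+
    have xb: "\<bar>x \<langle>$\<rangle> 1\<bar> \<le> int b" using sa[of 1 i] i by (cases "i = 1") auto
    \<comment> \<open>This value is at most \<open>b\<close> and sits, up to sign, at place
      \<open>1\<close>. As the inverse is sorted, the value \<open>1\<close> cannot sit further
      out.\<close>
    let ?j = "\<bar>x \<langle>$\<rangle> 1\<bar>"
    have "\<bar>inverse x \<langle>$\<rangle> ?j\<bar> = \<bar>1\<bar>" unfolding abs_inv by simp
    then have ij: "\<bar>inverse x \<langle>$\<rangle> ?j\<bar> = 1" by simp
    have "\<bar>inverse x \<langle>$\<rangle> 1\<bar> \<le> 1"
    proof (cases "?j = 1")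
      case False
      then have "1 < ?j" using nz by linarith
      then show ?thesis using sb[of 1 ?j] xb ij by linarith
    qed (use ij in simp)
    then have i1: "\<bar>inverse x \<langle>$\<rangle> 1\<bar> = \<bar>1\<bar>" using nz by auto
    then have x1: "\<bar>x \<langle>$\<rangle> 1\<bar> = 1" unfolding abs_inv by simp
    define \<epsilon> where "\<epsilon> = (x \<langle>$\<rangle> 1 < 0)"
    let ?y = "tw \<epsilon> * x * tw False"
    have twF: "tw False = 1" by (simp add: tw_def)
    have y: "0 < ?y \<langle>$\<rangle> i" if "1 \<le> i" "i \<le> int a" for i
    proof (cases "i = 1")
      case True
      then show ?thesis using x1 by (auto simp: apply_times twF apply_tw \<epsilon>_def)
    next
      case False
      then show ?thesis using sa[of 1 i] that x1 by (simp add: apply_times twF apply_tw)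
    qed
    have sgn1: "inverse x \<langle>$\<rangle> 1 < 0 \<longleftrightarrow> x \<langle>$\<rangle> 1 < 0"
    proof -
      have "x \<langle>$\<rangle> 1 = 1 \<or> x \<langle>$\<rangle> 1 = - 1" using x1 by auto
      then have "inverse x \<langle>$\<rangle> 1 = x \<langle>$\<rangle> 1"
        by (metis inverse_apply(1) signed_minus[OF ixs] minus_minus)
      then show ?thesis by simp
    qed
    have iy: "0 < inverse ?y \<langle>$\<rangle> j" if "1 \<le> j" "j \<le> int b" for j
    proof (cases "j = 1")
      case True
      then show ?thesis
        using sgn1 nz signed_minus[OF ixs, of 1] by (auto simp: apply_times twF apply_tw \<epsilon>_def)
    next
      case False
      then show ?thesis using posb[of j] that by (simp add: apply_times twF apply_tw)
    qed
    have "tri b a \<epsilon> False x"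
      using y iy ab by (simp add: tri_def admissible_def pos_def)
    then show ?thesis using x by (auto simp: Yset_def)
  next
    case False
    define \<epsilon> where "\<epsilon> = (2 \<le> b \<and> inverse x \<langle>$\<rangle> 1 < 0)"
    define \<delta> where "\<delta> = (2 \<le> a \<and> x \<langle>$\<rangle> 1 < 0)"
    let ?y = "tw \<epsilon> * x * tw \<delta>"
    have big: "int b < \<bar>x \<langle>$\<rangle> i\<bar>" if "1 \<le> i" "i \<le> int a" for i
      using False that unfolding neut_def by force
    have ibig: "\<bar>inverse x \<langle>$\<rangle> j\<bar> \<noteq> 1" if "1 \<le> j" "j \<le> int b" "2 \<le> a" for j
      using abs_inv[of j 1] big[of 1] that by auto
    have y: "0 < ?y \<langle>$\<rangle> i" if i: "1 \<le> i" "i \<le> int a" for i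
    proof -
      have a2: "2 \<le> a" using i a by auto
      have p: "0 < x \<langle>$\<rangle> (tw \<delta> \<langle>$\<rangle> i)"
      proof (cases "i = 1")
        case True
        then show ?thesis using nz a2 signed_minus[OF xs, of 1] by (auto simp: apply_tw \<delta>_def)
      next
        case False
        then show ?thesis using posa[of i] i by (simp add: apply_tw)
      qed
      have "\<bar>x \<langle>$\<rangle> (tw \<delta> \<langle>$\<rangle> i)\<bar> = \<bar>x \<langle>$\<rangle> i\<bar>" using xs by (rule signed_abs_eq) simp
      then have "\<epsilon> \<Longrightarrow> \<bar>x \<langle>$\<rangle> (tw \<delta> \<langle>$\<rangle> i)\<bar> \<noteq> 1" using big[OF i] by (auto simp: \<epsilon>_def)
      then show ?thesis using p by (auto simp: apply_times apply_tw[of \<epsilon>])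
    qed
    have iy: "0 < inverse ?y \<langle>$\<rangle> j" if j: "1 \<le> j" "j \<le> int b" for j
    proof -
      have b2: "2 \<le> b" using j b by auto
      have p: "0 < inverse x \<langle>$\<rangle> (tw \<epsilon> \<langle>$\<rangle> j)"
      proof (cases "j = 1")
        case True
        then show ?thesis using nz b2 signed_minus[OF ixs, of 1] by (auto simp: apply_tw \<epsilon>_def)
      next
        case False
        then show ?thesis using posb[of j] j by (simp add: apply_tw)
      qed
      have "\<bar>inverse x \<langle>$\<rangle> (tw \<epsilon> \<langle>$\<rangle> j)\<bar> = \<bar>inverse x \<langle>$\<rangle> j\<bar>" using ixs by (rule signed_abs_eq) simp
      then have "\<delta> \<Longrightarrow> \<bar>inverse x \<langle>$\<rangle> (tw \<epsilon> \<langle>$\<rangle> j)\<bar> \<noteq> 1" using ibig[OF j] by (auto simp: \<delta>_def)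
      then show ?thesis using p by (auto simp: apply_times apply_tw[of \<delta>])
    qed
    have "tri b a \<epsilon> \<delta> x"
      using y iy False xs by (auto simp: tri_def admissible_def pos_def neut_tw \<epsilon>_def \<delta>_def)
    then show ?thesis using x by (auto simp: Yset_def)
  qed
qed

end

section \<open>The solution spaces and their determination on the transversal\<close>

locale hecke_D_unit = hecke_D r q for r and q :: "'a::comm_ring_1" +
  fixes qi :: 'a
  assumes q_qi: "q * qi = 1"
begin

text \<open>
  The condition \<open>KR a z\<close> says that \<open>z \<bullet> h \<bullet> hT (gen 0) = z \<bullet> h \<bullet> hT (gen 1)\<close> for all \<open>h\<close> in the subalgebra of the
  parabolic subgroup generated by the \<open>gen k\<close> with \<open>k \<noteq> a\<close>.  It characterises the left ideal generated by
  \<open>P a\<close>, and \<open>V b a\<close> is the intersection of this left ideal with the right ideal generated by \<open>P b\<close>.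
\<close>

definition KR :: "nat \<Rightarrow> (int perm \<Rightarrow> 'a) \<Rightarrow> bool" where
  "KR a z \<longleftrightarrow> a = 0 \<or> (\<forall>ws\<in>lists ({..<r} - {a}). R 0 (fold R ws z) = R 1 (fold R ws z))"

definition V :: "nat \<Rightarrow> nat \<Rightarrow> (int perm \<Rightarrow> 'a) set" where
  "V b a = {z \<in> H. KR a z \<and> KR b (star z)}"

lemma q_cancel: "q * x = 0 \<Longrightarrow> x = 0"
  using q_qi by (metis mult.assoc mult.commute mult_1 mult_zero_right)

lemma linop_fold_R: "linop (fold R ws)"
proof (induction ws)
  case Nil
  show ?case by (simp add: linop_def)
next
  case (Cons k ws)
  have "fold R (k # ws) = (\<lambda>z. fold R ws (R k z))" by (simp add: fun_eq_iff)
  then show ?case using linop_comp[OF Cons linop_Rop] by simp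
qed

lemma fold_R_hecke: "z \<in> H \<Longrightarrow> ws \<in> lists {..<r} \<Longrightarrow> fold R ws z \<in> H"
  by (induction ws arbitrary: z) (auto simp: hecke_R)

lemma fold_R_L: "z \<in> H \<Longrightarrow> ws \<in> lists {..<r} \<Longrightarrow> k < r \<Longrightarrow> fold R ws (L k z) = L k (fold R ws z)"
  by (induction ws arbitrary: z) (auto simp: hecke_R R_L_commute)

lemma lists_sub: "ws \<in> lists ({..<r} - {a}) \<Longrightarrow> ws \<in> lists {..<r}"
  by auto

lemma KR_I:
  "(\<And>ws. a \<noteq> 0 \<Longrightarrow> ws \<in> lists ({..<r} - {a}) \<Longrightarrow> R 0 (fold R ws z) = R 1 (fold R ws z)) \<Longrightarrow> KR a z"
  by (auto simp: KR_def)

lemma KR_D: "KR a z \<Longrightarrow> a \<noteq> 0 \<Longrightarrow> ws \<in> lists ({..<r} - {a}) \<Longrightarrow> R 0 (fold R ws z) = R 1 (fold R ws z)"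
  by (simp add: KR_def)

lemma KR_add:
  assumes "KR a y" "KR a z"
  shows "KR a (y + z)"
proof (rule KR_I)
  fix ws assume *: "a \<noteq> 0" "ws \<in> lists ({..<r} - {a})"
  show "R 0 (fold R ws (y + z)) = R 1 (fold R ws (y + z))"
    by (simp only: KR_D[OF assms(1) *] KR_D[OF assms(2) *] linop_add[OF linop_fold_R] linop_add[OF
      linop_Rop])
qed

lemma KR_scale:
  assumes "KR a z"
  shows "KR a (hscale c z)"
proof (rule KR_I)
  fix ws assume *: "a \<noteq> 0" "ws \<in> lists ({..<r} - {a})"
  show "R 0 (fold R ws (hscale c z)) = R 1 (fold R ws (hscale c z))"
    by (simp only: KR_D[OF assms *] linop_scale[OF linop_fold_R] linop_scale[OF linop_Rop])
qed

lemma KR_zero: "KR a 0"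
  by (rule KR_I) (simp only: linop_zero[OF linop_fold_R] linop_zero[OF linop_Rop])

lemma KR_R:
  assumes "KR a z" "k < r" "k \<noteq> a"
  shows "KR a (R k z)"
proof (rule KR_I)
  fix ws assume "a \<noteq> 0" "ws \<in> lists ({..<r} - {a})"
  then show "R 0 (fold R ws (R k z)) = R 1 (fold R ws (R k z))"
    using assms KR_D[of a z "k # ws"] by simp
qed

lemma KR_L:
  assumes "KR a z" "z \<in> H" "k < r"
  shows "KR a (L k z)"
proof (rule KR_I)
  fix ws assume *: "a \<noteq> 0" "ws \<in> lists ({..<r} - {a})"
  have ws: "ws \<in> lists {..<r}" using *(2) by (rule lists_sub)
  have r: "0 < r" "1 < r" using r2 by auto
  have "R 0 (fold R ws z) = R 1 (fold R ws z)" using assms * by (intro KR_D)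
  then show "R 0 (fold R ws (L k z)) = R 1 (fold R ws (L k z))"
    using R_L_commute[OF fold_R_hecke[OF assms(2) ws] assms(3) r(1)]
      R_L_commute[OF fold_R_hecke[OF assms(2) ws] assms(3) r(2)]
    by (simp only: fold_R_L[OF assms(2) ws assms(3)])
qed

lemma KR_absorb: "KR a z \<Longrightarrow> a \<noteq> 0 \<Longrightarrow> R 0 z = R 1 z"
  unfolding KR_def by (auto dest: bspec[of _ _ "[]"])

lemma R_mul_P:
  assumes a: "a = 0 \<or> 2 \<le> a" "a \<le> r" and g: "g \<in> H" and k: "k < r" "k \<noteq> a"
  shows "\<exists>h\<in>H. R k (g \<bullet> P a) = h \<bullet> P a"
proof -
  have PH: "P a \<in> H" using a by (simp add: hecke_P)
  have "\<exists>j<r. R k (P a) = L j (P a)"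
  proof (cases "k = 0")
    case True
    then have "2 \<le> a" using a k by auto
    then show ?thesis using P_absorb[of a] a True r2 by (intro exI[of _ 1]) auto
  next
    case False
    then show ?thesis using P_comm[of k a] a k by auto
  qed
  then obtain j where j: "j < r" "R k (P a) = L j (P a)" by blast
  have "R k (g \<bullet> P a) = g \<bullet> L j (P a)" using j g PH k by (simp flip: mul_R)
  also have "\<dots> = R j g \<bullet> P a" using g PH j(1) by (rule mul_L_eq_R_mul)
  finally show ?thesis using g j(1) hecke_R by blast
qed

text \<open>A generator other than \<open>gen a\<close> crosses \<open>P a\<close> to the left,
  possibly turning into another one. Folding thus keeps a left multiple of \<open>P a\<close>, and
  on such a multiple \<open>gen 0\<close> and \<open>gen 1\<close> act alike.\<close>

lemma KR_mul_P:
  assumes a: "a = 0 \<or> 2 \<le> a" "a \<le> r" and g: "g \<in> H"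
  shows "KR a (g \<bullet> P a)"
proof (rule KR_I)
  fix ws assume a0: "a \<noteq> 0" and "ws \<in> lists ({..<r} - {a})"
  then have "\<exists>h\<in>H. fold R ws (g \<bullet> P a) = h \<bullet> P a" using g
  proof (induction ws arbitrary: g)
    case (Cons k ws)
    then obtain h where h: "h \<in> H" "R k (g \<bullet> P a) = h \<bullet> P a"
      using R_mul_P[OF a, of g k] by auto
    then show ?case using Cons.IH[of h] Cons.prems by auto
  qed auto
  then obtain h where h: "h \<in> H" "fold R ws (g \<bullet> P a) = h \<bullet> P a" by blast
  have r: "0 < r" "1 < r" using r2 by auto
  have PH: "P a \<in> H" using a by (simp add: hecke_P)
  have "R 0 (P a) = R 1 (P a)" using P_absorb(1)[of a] a a0 by simp
  then have "R 0 (h \<bullet> P a) = R 1 (h \<bullet> P a)"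
    using mul_R[OF h(1) PH r(1)] mul_R[OF h(1) PH r(2)] by simp
  then show "R 0 (fold R ws (g \<bullet> P a)) = R 1 (fold R ws (g \<bullet> P a))" by (simp only: h(2))
qed

lemma V_hecke: "z \<in> V b a \<Longrightarrow> z \<in> H"
  by (simp add: V_def)

lemma V_star: "z \<in> V b a \<Longrightarrow> star z \<in> V a b"
  by (simp add: V_def hecke_star)

lemma V_add: "y \<in> V b a \<Longrightarrow> z \<in> V b a \<Longrightarrow> y + z \<in> V b a"
  unfolding V_def using linop_add[OF linop_star, of y z] by (auto intro: KR_add hecke_add)

lemma V_scale: "z \<in> V b a \<Longrightarrow> hscale c z \<in> V b a"
  unfolding V_def using linop_scale[OF linop_star, of c z] by (auto intro: KR_scale hecke_scale)

lemma V_zero: "0 \<in> V b a"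
  by (simp only: V_def linop_zero[OF linop_star] mem_Collect_eq hecke_0 KR_zero)

lemma V_sum: "(\<And>i. i \<in> A \<Longrightarrow> f i \<in> V b a) \<Longrightarrow> (\<Sum>i\<in>A. f i) \<in> V b a"
  by (induction A rule: infinite_finite_induct) (auto intro: V_zero V_add simp del: plus_fun_apply
    zero_fun_apply)

lemma V_diff: "y \<in> V b a \<Longrightarrow> z \<in> V b a \<Longrightarrow> y - z \<in> V b a"
proof -
  assume "y \<in> V b a" "z \<in> V b a"
  then have "y + hscale (- 1) z \<in> V b a" by (intro V_add V_scale)
  moreover have "y + hscale (- 1) z = y - z" by (auto simp: fun_eq_iff hscale_apply)
  ultimately show ?thesis by simp
qed

text \<open>The two systems of equations do not interfere: the move preserves \<open>KR a\<close> by
  the form of that condition, and the condition for \<open>b\<close> because left and right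
  operators commute.\<close>

lemma V_R: "z \<in> V b a \<Longrightarrow> k < r \<Longrightarrow> k \<noteq> a \<Longrightarrow> R k z \<in> V b a"
  by (simp add: V_def KR_R hecke_R star_Rop KR_L hecke_star)

lemma V_L: "z \<in> V b a \<Longrightarrow> k < r \<Longrightarrow> k \<noteq> b \<Longrightarrow> L k z \<in> V b a"
  by (simp add: V_def KR_L hecke_L star_Lop KR_R)

lemma V_R_tk: "z \<in> V b a \<Longrightarrow> (\<delta> \<Longrightarrow> a \<noteq> 0) \<Longrightarrow> R (tk \<delta> k) z = R k z"
  by (auto simp: tk_def V_def dest: KR_absorb)

lemma V_L_tk: "z \<in> V b a \<Longrightarrow> (\<epsilon> \<Longrightarrow> b \<noteq> 0) \<Longrightarrow> L (tk \<epsilon> k) z = L k z"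
  using V_R_tk[OF V_star, of z b a \<epsilon> k] unfolding Lop_def by simp

text \<open>On a solution \<open>gen 0\<close> and \<open>gen 1\<close> act alike, so at each point
  the generator may be exchanged for the twisted one that stays in \<open>Yset\<close>. For
  \<open>1 \<le> k\<close>, \<open>k \<noteq> a\<close>, the values of \<open>R k z\<close> on
  \<open>Yset\<close> are thereby computed from those of \<open>z\<close> on
  \<open>Yset\<close>.\<close>

lemma tri_V_R:
  assumes z: "z \<in> V b a" and t: "tri b a \<epsilon> \<delta> y"
  shows "R k z y = R (tk \<delta> k) z y"
  using V_R_tk[OF z, of \<delta> k] t by (fastforce simp: tri_def admissible_def)

lemma tri_V_L:
  assumes z: "z \<in> V b a" and t: "tri b a \<epsilon> \<delta> y"
  shows "L k z y = L (tk \<epsilon> k) z y"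
  using V_L_tk[OF z, of \<epsilon> k] t by (fastforce simp: tri_def admissible_def)

lemma tk_less: "k < r \<Longrightarrow> tk c k < r"
  by (simp add: tk_def)

lemma Yset_right: "y \<in> Yset r b a \<Longrightarrow> tri b a \<epsilon> \<delta> y \<Longrightarrow> 1 \<le> k \<Longrightarrow> k < r \<Longrightarrow> k \<noteq> a \<Longrightarrow>
  y * gen (tk \<delta> k) \<in> Yset r b a"
  unfolding Yset_def using tri_right[of b a \<epsilon> \<delta> y k] tk_less[of k \<delta>] by auto

lemma Yset_left: "y \<in> Yset r b a \<Longrightarrow> tri b a \<epsilon> \<delta> y \<Longrightarrow> 1 \<le> k \<Longrightarrow> k < r \<Longrightarrow> k \<noteq> b \<Longrightarrow>
  gen (tk \<epsilon> k) * y \<in> Yset r b a"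
  unfolding Yset_def using tri_left[of b a \<epsilon> \<delta> y k] tk_less[of k \<epsilon>] by auto

definition V0 :: "nat \<Rightarrow> nat \<Rightarrow> (int perm \<Rightarrow> 'a) set" where
  "V0 b a = {z \<in> V b a. \<forall>y\<in>Yset r b a. z y = 0}"

lemma V0_R:
  assumes z: "z \<in> V0 b a" and k: "k < r" "k \<noteq> a" and a: "a \<noteq> 1"
  shows "R k z \<in> V0 b a"
proof -
  have zV: "z \<in> V b a" using z by (simp add: V0_def)
  have ge1: "R k z \<in> V0 b a" if k: "1 \<le> k" "k < r" "k \<noteq> a" for k
  proof -
    have "R k z y = 0" if y: "y \<in> Yset r b a" for y
    proof -
      obtain \<epsilon> \<delta> where t: "tri b a \<epsilon> \<delta> y" using y by (auto simp: Yset_def)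
      have "z (y * gen (tk \<delta> k)) = 0" "z y = 0"
        using z y Yset_right[OF y t k] by (auto simp: V0_def)
      then have "R (tk \<delta> k) z y = 0" by (simp add: Rop_apply)
      then show ?thesis using tri_V_R[OF zV t, of k] by (rule trans[rotated])
    qed
    then show ?thesis using zV k V_R by (simp add: V0_def)
  qed
  show ?thesis
  proof (cases "k = 0")
    case True
    \<comment> \<open>For \<open>k = 0\<close> the equations replace \<open>gen 0\<close> by
      \<open>gen 1\<close>, an allowed generator because \<open>a\<close> is not
      \<open>1\<close>.\<close>
    then have "R k z = R 1 z" using k zV KR_absorb[of a z] by (auto simp: V_def)
    then show ?thesis using ge1[of 1] r2 a by auto
  qed (use ge1 k in auto)
qed

lemma V0_L:
  assumes z: "z \<in> V0 b a" and k: "k < r" "k \<noteq> b" and b: "b \<noteq> 1"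
  shows "L k z \<in> V0 b a"
proof -
  have zV: "z \<in> V b a" using z by (simp add: V0_def)
  have ge1: "L k z \<in> V0 b a" if k: "1 \<le> k" "k < r" "k \<noteq> b" for k
  proof -
    have "L k z y = 0" if y: "y \<in> Yset r b a" for y
    proof -
      obtain \<epsilon> \<delta> where t: "tri b a \<epsilon> \<delta> y" using y by (auto simp: Yset_def)
      have "z (gen (tk \<epsilon> k) * y) = 0" "z y = 0"
        using z y Yset_left[OF y t k] by (auto simp: V0_def)
      then have "L (tk \<epsilon> k) z y = 0" by (simp add: Lop_apply)
      then show ?thesis using tri_V_L[OF zV t, of k] by (rule trans[rotated])
    qed
    then show ?thesis using zV k V_L by (simp add: V0_def)
  qed
  show ?thesis
  proof (cases "k = 0")
    case True
    then have "L k z = L 1 z" using k zV KR_absorb[of b "star z"] by (auto simp: V_def Lop_def)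
    then show ?thesis using ge1[of 1] r2 b by auto
  qed (use ge1 k in auto)
qed

text \<open>
  The elements of \<open>V b a\<close> vanishing on \<open>Yset r b a\<close> form a space stable under all generators other than
  \<open>gen a\<close> on the right and \<open>gen b\<close> on the left.  As \<open>q\<close> is invertible, the set of common zeros of this space
  is closed under multiplication by these generators.
\<close>

theorem V_determined:
  assumes a: "a = 0 \<or> 2 \<le> a \<and> a \<le> r" and b: "b = 0 \<or> 2 \<le> b \<and> b \<le> r"
    and z: "z \<in> V b a" "\<And>y. y \<in> Yset r b a \<Longrightarrow> z y = 0"
  shows "z = 0"
proof -
  have "z x = 0" if "x \<in> dgroup r" "z \<in> V0 b a" for x z
    using that
  proof (induction "dlength r x" arbitrary: x z rule: less_induct)
    case less
    consider k where "k < r" "k \<noteq> a" "\<not> up x k" | k where "k < r" "k \<noteq> b" "\<not> up (inverse x) k"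
      | "\<And>k. k < r \<Longrightarrow> k \<noteq> a \<Longrightarrow> up x k" "\<And>k. k < r \<Longrightarrow> k \<noteq> b \<Longrightarrow> up (inverse x) k"
      by blast
    then show ?case
    proof cases
      case (1 k)
      have l: "dlength r (x * gen k) < dlength r x" using dlength_gen[OF less.prems(1) 1(1)] 1(3)
        by simp
      \<comment> \<open>The induction hypothesis is applied to \<open>R k z\<close> instead of
        \<open>z\<close>; at the shorter point its coefficient is \<open>q * z x\<close>.\<close>
      have "R k z \<in> V0 b a" using V0_R[OF less.prems(2) 1(1,2)] a by auto
      then have "R k z (x * gen k) = 0" using less.hyps[OF l] less.prems 1 by auto
      then have "q * z x = 0" using 1 by (simp add: Rop_apply up_gen_iff)
      then show ?thesis by (rule q_cancel)
    next
      case (2 k)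
      have "dlength r (inverse x * gen k) < dlength r (inverse x)"
        using dlength_gen[of "inverse x" k] less.prems(1) 2 by simp
      then have l: "dlength r (gen k * x) < dlength r x"
        using dlength_inverse[of "gen k * x"] dlength_inverse[of x] less.prems(1) 2 by simp
      have "L k z \<in> V0 b a" using V0_L[OF less.prems(2) 2(1,2)] b by auto
      then have "L k z (gen k * x) = 0" using less.hyps[OF l] less.prems 2 by auto
      then have "q * z x = 0" using 2 by (simp add: Lop_apply up_gen_iff)
      then show ?thesis by (rule q_cancel)
    next
      case 3
      then have "x \<in> Yset r b a" using no_descent_Yset[OF less.prems(1) a b] by blast
      then show ?thesis using less.prems by (simp add: V0_def)
    qed
  qed
  then show ?thesis using z by (intro hecke_eqI[of _ r]) (auto simp: V0_def V_def)
qed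

end

section \<open>Solutions dual to the representatives\<close>

lemma card_Inv_inverse:
  assumes x: "x \<in> signed r"
  shows "card (Inv r (inverse x)) = card (Inv r x)"
proof -
  have le: "card (Inv r x) \<le> card (Inv r (inverse x))" if x: "x \<in> signed r" for x
  proof (rule card_inj_on_le)
    show "inj_on (\<lambda>(a, b). (x \<langle>$\<rangle> b, x \<langle>$\<rangle> a)) (Inv r x)"
      by (auto intro!: inj_onI simp: apply_inj)
    show "(\<lambda>(a, b). (x \<langle>$\<rangle> b, x \<langle>$\<rangle> a)) ` Inv r x \<subseteq> Inv r (inverse x)"
    proof (clarify)
      fix a b assume ab: "(a, b) \<in> Inv r x"
      have "x \<langle>$\<rangle> b + x \<langle>$\<rangle> a \<noteq> 0"
      proof
        assume "x \<langle>$\<rangle> b + x \<langle>$\<rangle> a = 0"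
        then have "x \<langle>$\<rangle> b = x \<langle>$\<rangle> (- a)" by (simp add: signed_minus[OF x])
        then show False using ab by (simp add: apply_inj Inv_def)
      qed
      then show "(x \<langle>$\<rangle> b, x \<langle>$\<rangle> a) \<in> Inv r (inverse x)"
        using ab x by (simp add: Inv_def signed_inside)
    qed
  qed simp
  show ?thesis using le[OF x] le[OF inverse_signed[OF x]] by simp
qed

section \<open>Construction of solutions dual to the points of the transversal\<close>

context hecke_D_unit
begin

lemma qi_power: "qi ^ n * q ^ n = 1"
  using q_qi by (metis mult.commute power_mult_distrib power_one)

text \<open>Solutions for which a factorisation through \<open>P a\<close> is known. It is carried
  along in the construction, since that every solution factors is deduced only afterwards, from the
  existence of dual elements in \<open>W\<close>.\<close>

definition W :: "nat \<Rightarrow> nat \<Rightarrow> (int perm \<Rightarrow> 'a) set" where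
  "W b a = {z \<in> V b a. \<exists>g\<in>H. z = g \<bullet> P a}"

definition dual_at :: "nat \<Rightarrow> nat \<Rightarrow> int perm \<Rightarrow> (int perm \<Rightarrow> 'a) \<Rightarrow> bool" where
  "dual_at b a y z \<longleftrightarrow> (\<forall>t\<in>Yset r b a. z t = (if t = y then 1 else 0))"

lemma W_diff_scale:
  assumes "y \<in> W b a" "z \<in> W b a"
  shows "hscale c (y - hscale e z) \<in> W b a"
proof -
  obtain g h where gh: "g \<in> H" "h \<in> H" "y = g \<bullet> P a" "z = h \<bullet> P a"
    using assms unfolding W_def by blast
  have "hscale c (y - hscale e z) = hscale c (g - hscale e h) \<bullet> P a"
    by (simp only: gh mul_scale_left mul_diff_left)
  moreover have "hscale c (g - hscale e h) \<in> H" using gh by (intro hecke_scale hecke_diff)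
  moreover have "hscale c (y - hscale e z) \<in> V b a"
    using assms unfolding W_def by (intro V_scale V_diff) auto
  ultimately show ?thesis unfolding W_def by blast
qed

lemma W_R:
  assumes a: "a = 0 \<or> 2 \<le> a" "a \<le> r" and z: "z \<in> W b a" and k: "k < r" "k \<noteq> a"
  shows "R k z \<in> W b a"
proof -
  obtain g where g: "g \<in> H" "z = g \<bullet> P a" "z \<in> V b a" using z unfolding W_def by blast
  have "\<exists>h\<in>H. R k z = h \<bullet> P a" unfolding g(2) using R_mul_P[OF a g(1) k] .
  moreover have "R k z \<in> V b a" using g(3) k by (rule V_R)
  ultimately show ?thesis unfolding W_def by blast
qed

lemma W_L:
  assumes z: "z \<in> W b a" and k: "k < r" "k \<noteq> b"
  shows "L k z \<in> W b a"
proof -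
  obtain g where g: "g \<in> H" "z = g \<bullet> P a" "z \<in> V b a" using z unfolding W_def by blast
  have "L k z = L k g \<bullet> P a" unfolding g(2) using g(1) k(1) by (simp only: mul_L)
  moreover have "L k g \<in> H" using k(1) g(1) by (rule hecke_L)
  moreover have "L k z \<in> V b a" using g(3) k by (rule V_L)
  ultimately show ?thesis unfolding W_def by blast
qed

text \<open>One elimination step: on \<open>Yset\<close> the solution \<open>w\<close> is supported
  at \<open>y\<close> and \<open>y'\<close>, with a unit value at \<open>y\<close>, so subtracting a
  multiple of \<open>z'\<close> and rescaling isolates \<open>y\<close>.\<close>

lemma dual_step:
  assumes z': "z' \<in> W b a" "dual_at b a y' z'" and w: "w \<in> W b a"
    and y: "y \<in> Yset r b a" "y' \<in> Yset r b a" and ne: "y \<noteq> y'"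
    and wt: "\<And>t. t \<in> Yset r b a \<Longrightarrow> t \<noteq> y \<Longrightarrow> t \<noteq> y' \<Longrightarrow> w t = 0" and c: "c * w y = 1"
  shows "\<exists>z\<in>W b a. dual_at b a y z"
proof (rule bexI)
  show "hscale c (w - hscale (w y') z') \<in> W b a" using w z'(1) by (rule W_diff_scale)
  show "dual_at b a y (hscale c (w - hscale (w y') z'))"
    using z'(2) wt c y ne by (auto simp: dual_at_def hscale_apply)
qed

text \<open>Applying \<open>R k\<close> to a solution dual to the neighbour of \<open>y\<close>
  spreads it to \<open>y\<close>, with value \<open>q\<close> or \<open>1\<close> according to the
  direction. The twists are constant along the move, so no third point is reached.\<close>

lemma dual_right:
  assumes a: "a = 0 \<or> 2 \<le> a" "a \<le> r" and y: "y \<in> Yset r b a" and t: "tri b a \<epsilon> \<delta> y"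
    and k: "1 \<le> k" "k < r" "k \<noteq> a"
    and ex: "\<exists>z\<in>W b a. dual_at b a (y * gen (tk \<delta> k)) z"
  shows "\<exists>z\<in>W b a. dual_at b a y z"
proof -
  let ?y = "y * gen (tk \<delta> k)"
  obtain z where z: "z \<in> W b a" "dual_at b a ?y z" using ex by blast
  have zV: "z \<in> V b a" using z by (simp add: W_def)
  have y': "?y \<in> Yset r b a" using y t k by (rule Yset_right)
  have val: "R k z s = R (tk \<delta>' k) z s" if "tri b a \<epsilon>' \<delta>' s" for s \<epsilon>' \<delta>'
    using zV that by (rule tri_V_R)
  have zy: "z y = 0" "z ?y = 1" using z(2) y y' by (auto simp: dual_at_def)
  show ?thesis
  proof (rule dual_step[OF z, of "R k z" y "if up y (tk \<delta> k) then qi else 1"])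
    show "R k z \<in> W b a" using a z(1) k by (intro W_R)
    show "(if up y (tk \<delta> k) then qi else 1) * R k z y = 1"
      unfolding val[OF t] using zy q_qi by (simp add: Rop_apply mult.commute)
    fix s assume s: "s \<in> Yset r b a" "s \<noteq> y" "s \<noteq> ?y"
    then obtain \<epsilon>' \<delta>' where t': "tri b a \<epsilon>' \<delta>' s" by (auto simp: Yset_def)
    let ?s = "s * gen (tk \<delta>' k)"
    have s': "?s \<in> Yset r b a" using s(1) t' k by (rule Yset_right)
    have "?s \<noteq> ?y"
    proof
      assume eq: "?s = ?y"
      have "tri b a \<epsilon>' \<delta>' ?y" using tri_right[OF t' k(1,3)] eq by simp
      moreover have "tri b a \<epsilon> \<delta> ?y" using t k(1,3) by (rule tri_right)
      moreover have "?y \<in> signed r" using y' by (simp only: Yset_def mem_Collect_eq dgroup_signed)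
      ultimately have "\<delta>' = \<delta>" using tri_unique(2) by blast
      then have "s * gen (tk \<delta> k) = y * gen (tk \<delta> k)" using eq by (simp only:)
      from arg_cong[OF this, of "\<lambda>v. v * gen (tk \<delta> k)"] show False
        using s(2) by (simp only: gen_gen_right)
    qed
    then have "z ?s = 0" "z s = 0" using z(2) s s' by (auto simp: dual_at_def)
    then show "R k z s = 0" unfolding val[OF t'] by (simp add: Rop_apply)
  qed (use y y' in auto)
qed

lemma dual_left:
  assumes y: "y \<in> Yset r b a" and t: "tri b a \<epsilon> \<delta> y"
    and k: "1 \<le> k" "k < r" "k \<noteq> b"
    and ex: "\<exists>z\<in>W b a. dual_at b a (gen (tk \<epsilon> k) * y) z"
  shows "\<exists>z\<in>W b a. dual_at b a y z"
proof -
  let ?y = "gen (tk \<epsilon> k) * y"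
  obtain z where z: "z \<in> W b a" "dual_at b a ?y z" using ex by blast
  have zV: "z \<in> V b a" using z by (simp add: W_def)
  have y': "?y \<in> Yset r b a" using y t k by (rule Yset_left)
  have val: "L k z s = L (tk \<epsilon>' k) z s" if "tri b a \<epsilon>' \<delta>' s" for s \<epsilon>' \<delta>'
    using zV that by (rule tri_V_L)
  have ne: "y \<noteq> ?y" by (metis gen_ne_one mult_1 perm_cancel_right(1) perm.right_inverse)
  then have zy: "z y = 0" "z ?y = 1" using z(2) y y' by (auto simp: dual_at_def)
  show ?thesis
  proof (rule dual_step[OF z, of "L k z" y "if up (inverse y) (tk \<epsilon> k) then qi else 1"])
    show "L k z \<in> W b a" using z(1) k by (intro W_L)
    show "(if up (inverse y) (tk \<epsilon> k) then qi else 1) * L k z y = 1"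
      unfolding val[OF t] using zy q_qi by (simp add: Lop_apply mult.commute)
    fix s assume s: "s \<in> Yset r b a" "s \<noteq> y" "s \<noteq> ?y"
    then obtain \<epsilon>' \<delta>' where t': "tri b a \<epsilon>' \<delta>' s" by (auto simp: Yset_def)
    let ?s = "gen (tk \<epsilon>' k) * s"
    have s': "?s \<in> Yset r b a" using s(1) t' k by (rule Yset_left)
    have "?s \<noteq> ?y"
    proof
      assume eq: "?s = ?y"
      have "tri b a \<epsilon>' \<delta>' ?y" using tri_left[OF t' k(1,3)] eq by simp
      moreover have "tri b a \<epsilon> \<delta> ?y" using t k(1,3) by (rule tri_left)
      moreover have "?y \<in> signed r" using y' by (simp only: Yset_def mem_Collect_eq dgroup_signed)
      ultimately have "\<epsilon>' = \<epsilon>" using tri_unique(1) by blast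
      then have "gen (tk \<epsilon> k) * s = gen (tk \<epsilon> k) * y" using eq by (simp only:)
      from arg_cong[OF this, of "\<lambda>v. gen (tk \<epsilon> k) * v"] show False
        using s(2) by (simp only: gen_gen_left)
    qed
    then have "z ?s = 0" "z s = 0" using z(2) s s' by (auto simp: dual_at_def)
    then show "L k z s = 0" unfolding val[OF t'] by (simp add: Lop_apply)
  qed (use y y' ne in auto)
qed

text \<open>Such a \<open>y\<close> commutes with every \<open>uelt i\<close> up to
  \<open>n\<close>, and both products of basis elements are reduced, because \<open>y\<close> and
  its inverse satisfy \<open>ucond\<close>.\<close>

lemma P_mul_commute_T:
  assumes y: "y \<in> dgroup r" and n: "n \<le> r"
    and fixed: "\<And>i. 2 \<le> i \<Longrightarrow> i \<le> int n \<Longrightarrow> y \<langle>$\<rangle> i = i" and one: "2 \<le> n \<Longrightarrow> \<bar>y \<langle>$\<rangle> 1\<bar> = 1"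
  shows "P n \<bullet> hT y = hT y \<bullet> P n"
  using n fixed one
proof (induction n)
  case 0
  then show ?case using y by (simp add: hecke_hT)
next
  case (Suc n)
  show ?case
  proof (cases "1 \<le> n")
    case False
    then have "n = 0" by simp
    then show ?thesis using y by (simp add: hecke_hT)
  next
    case True
    let ?i = "Suc n"
    have ys: "y \<in> signed r" "inverse y \<in> signed r" using y by (auto intro: dgroup_signed inverse_signed)
    have yi: "y \<langle>$\<rangle> (int ?i) = int ?i" and y1: "\<bar>y \<langle>$\<rangle> 1\<bar> = 1" using Suc.prems True by auto
    have fx: "\<bar>y \<langle>$\<rangle> j\<bar> = j" if "1 \<le> j" "j \<le> int ?i" for j
      using Suc.prems(2)[of j] y1 that by (cases "j = 1") auto
    have ifx: "\<bar>inverse y \<langle>$\<rangle> j\<bar> = j" if "1 \<le> j" "j \<le> int ?i" for j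
    proof -
      have "\<bar>y \<langle>$\<rangle> j\<bar> = \<bar>y \<langle>$\<rangle> (inverse y \<langle>$\<rangle> j)\<bar>" using fx[OF that] that by simp
      then show ?thesis using signed_abs_eq_iff[OF ys(1), of j "inverse y \<langle>$\<rangle> j"] that by simp
    qed
    have iyi: "inverse y \<langle>$\<rangle> (int ?i) = int ?i" by (metis inverse_apply(1) yi)
    have uc: "ucond y ?i" "ucond (inverse y) ?i"
      unfolding ucond_def using yi iyi fx ifx by auto
    have "y * uelt ?i = uelt ?i * y"
    proof (rule perm_eqI)
      fix v
      have "\<bar>y \<langle>$\<rangle> v\<bar> = 1 \<longleftrightarrow> \<bar>v\<bar> = 1" "\<bar>y \<langle>$\<rangle> v\<bar> = int ?i \<longleftrightarrow> \<bar>v\<bar> = int ?i"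
        using signed_abs_eq_iff[OF ys(1), of v 1] signed_abs_eq_iff[OF ys(1), of v "int ?i"] y1 yi
          by auto
      then show "(y * uelt ?i) \<langle>$\<rangle> v = (uelt ?i * y) \<langle>$\<rangle> v"
        using True signed_minus[OF ys(1), of v] by (auto simp: apply_times apply_uelt)
    qed
    moreover have "hT y \<bullet> hT (uelt ?i) = hT (y * uelt ?i)"
      using True Suc.prems y uc by (intro T_uelt) auto
    moreover have "hT (uelt ?i) \<bullet> hT y = hT (uelt ?i * y)"
    proof -
      have "hT (inverse y) \<bullet> hT (uelt ?i) = hT (inverse y * uelt ?i)"
        using True Suc.prems y uc by (intro T_uelt) auto
      then have "star (hT (inverse y) \<bullet> hT (uelt ?i)) = star (hT (inverse y * uelt ?i))"
        by (rule arg_cong)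
      then show ?thesis using True Suc.prems y by (simp add: star_mul hecke_hT uelt_dgroup)
    qed
    ultimately have "pfac q ?i \<bullet> hT y = hT y \<bullet> pfac q ?i"
      using y by (simp add: pfac_def mul_add_left mul_add_right mul_scale_left mul_scale_right hecke_hT)
    moreover have "pfac q ?i \<in> H" "P n \<in> H" "hT y \<in> H"
      using True Suc.prems y by (auto intro: hecke_pfac hecke_P hecke_hT)
    ultimately show ?thesis
      using Suc True by (simp add: P_Suc mul_assoc) (simp flip: mul_assoc)
  qed
qed

text \<open>
  For sorted \<open>y\<close>, positions \<open>1, ..., n0\<close> being those with values up to \<open>b\<close>, the element
  \<open>\<zeta> = P b \<bullet> hT y \<bullet> (\<Prod>i = max (n0 + 1) 2..a. pfac q i)\<close> has \<open>y\<close> as the only element of \<open>Yset r b a\<close> in its support, because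
  all products of basis elements occurring in it are reduced.  It is a left multiple of \<open>P a\<close>, as the first \<open>n0\<close>
  factors of \<open>P b\<close> can be moved across \<open>hT y\<close>.  The naive choice \<open>P b \<bullet> hT y \<bullet> P a\<close> would repeat these
  factors, giving a coefficient which is not a unit.
\<close>

lemma dual_sorted:
  assumes a: "a = 0 \<or> 2 \<le> a" "a \<le> r" and b: "b = 0 \<or> 2 \<le> b" "b \<le> r"
    and y: "y \<in> Yset r b a" and t: "tri b a \<epsilon> \<delta> y"
    and ua: "\<And>k. 1 \<le> k \<Longrightarrow> k < r \<Longrightarrow> k \<noteq> a \<Longrightarrow> up (tw \<epsilon> * y * tw \<delta>) k"
    and ub: "\<And>k. 1 \<le> k \<Longrightarrow> k < r \<Longrightarrow> k \<noteq> b \<Longrightarrow> up (inverse (tw \<epsilon> * y * tw \<delta>)) k"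
  shows "\<exists>z\<in>W b a. dual_at b a y z"
proof -
  define y0 where "y0 = tw \<epsilon> * y * tw \<delta>"
  have yD: "y \<in> dgroup r" using y by (simp add: Yset_def)
  have ys: "y \<in> signed r" using yD by (rule dgroup_signed)
  have iys: "inverse y \<in> signed r" using ys by (rule inverse_signed)
  have y0s: "y0 \<in> signed r" unfolding y0_def by (intro times_signed tw_signed ys)
  have iy0s: "inverse y0 \<in> signed r" using y0s by (rule inverse_signed)
  have ad: "pos b a y0" "\<epsilon> \<Longrightarrow> 2 \<le> b" "\<delta> \<Longrightarrow> 2 \<le> a" "\<delta> \<Longrightarrow> \<not> neut b a y0"
    using t by (auto simp: tri_def admissible_def y0_def)
  have yy: "y \<langle>$\<rangle> i = tw \<epsilon> \<langle>$\<rangle> (y0 \<langle>$\<rangle> (tw \<delta> \<langle>$\<rangle> i))" for i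
    unfolding y0_def by (subst untwist[of y \<epsilon> \<delta>]) (simp add: apply_times)
  have iyy: "inverse y \<langle>$\<rangle> i = tw \<delta> \<langle>$\<rangle> (inverse y0 \<langle>$\<rangle> (tw \<epsilon> \<langle>$\<rangle> i))" for i
    unfolding y0_def by (subst untwist[of y \<epsilon> \<delta>]) (simp add: apply_times)
  have absy: "\<bar>y \<langle>$\<rangle> i\<bar> = \<bar>y0 \<langle>$\<rangle> i\<bar>" for i
    unfolding yy using signed_abs_eq[OF y0s, of "tw \<delta> \<langle>$\<rangle> i" i] by simp
  have absiy: "\<bar>inverse y \<langle>$\<rangle> i\<bar> = \<bar>inverse y0 \<langle>$\<rangle> i\<bar>" for i
    unfolding iyy using signed_abs_eq[OF iy0s, of "tw \<epsilon> \<langle>$\<rangle> i" i] by simp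
  have p1: "0 < y0 \<langle>$\<rangle> i" if "1 \<le> i" "i \<le> int a" for i using ad(1) that by (simp add: pos_def)
  have p2: "0 < inverse y0 \<langle>$\<rangle> i" if "1 \<le> i" "i \<le> int b" for i using ad(1) that by (simp add: pos_def)
  have ua': "up y0 k" if "1 \<le> k" "k < a" for k using ua[of k] that a by (simp add: y0_def)
  have ub': "up (inverse y0) k" if "1 \<le> k" "k < b" for k using ub[of k] that b by (simp add: y0_def)
  have ge1: "i \<le> y0 \<langle>$\<rangle> i" if "1 \<le> i" "i \<le> int a" for i
    using sorted_ge[of a y0 i] ua' p1[of 1] that by simp
  have ge2: "i \<le> inverse y0 \<langle>$\<rangle> i" if "1 \<le> i" "i \<le> int b" for i
    using sorted_ge[of b "inverse y0" i] ub' p2[of 1] that by simp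
  have lt1: "y0 \<langle>$\<rangle> i < y0 \<langle>$\<rangle> j" if "1 \<le> i" "i < j" "j \<le> int a" for i j
    using sorted_less[of a y0 i j] ua' that by simp
  have lt2: "inverse y0 \<langle>$\<rangle> i < inverse y0 \<langle>$\<rangle> j" if "1 \<le> i" "i < j" "j \<le> int b" for i j
    using sorted_less[of b "inverse y0" i j] ub' that by simp
  \<comment> \<open>The bound for \<open>y0\<close> at place \<open>i\<close> gives one inequality,
    the bound for the inverse at the value found there gives the other.\<close>
  have fixed: "y0 \<langle>$\<rangle> i = i" if "1 \<le> i" "i \<le> int a" "y0 \<langle>$\<rangle> i \<le> int b" for i
    using ge1[of i] ge2[of "y0 \<langle>$\<rangle> i"] p1[of i] that by simp
  define B where "B = {i. 1 \<le> i \<and> i \<le> a \<and> y0 \<langle>$\<rangle> (int i) \<le> int b}"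
  have finB: "finite B" unfolding B_def by (rule finite_subset[of _ "{..a}"]) auto
  define n0 where "n0 = Max (insert 0 B)"
  have n0in: "n0 \<in> insert 0 B" unfolding n0_def using finB by (intro Max_in) auto
  have n0ge: "i \<le> n0" if "i \<in> B" for i unfolding n0_def using finB that by (intro Max_ge) auto
  have n0a: "n0 \<le> a" using n0in by (auto simp: B_def)
  have small: "y0 \<langle>$\<rangle> i = i" if "1 \<le> i" "i \<le> int n0" for i
  proof -
    have nB: "n0 \<in> B" using n0in that by auto
    have "y0 \<langle>$\<rangle> i \<le> y0 \<langle>$\<rangle> (int n0)" using lt1[of i "int n0"] that n0a by (cases "i = int n0") auto
    then show ?thesis using fixed[of i] that nB n0a by (auto simp: B_def)
  qed
  have n0b: "n0 \<le> b" using n0in small[of "int n0"] by (auto simp: B_def)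
  have large: "int b < y0 \<langle>$\<rangle> i" if "1 \<le> i" "i \<le> int a" "int n0 < i" for i
    using n0ge[of "nat i"] that unfolding B_def by force
  \<comment> \<open>The factors of \<open>hpi\<close> are numbered from \<open>2\<close>, so for
    \<open>n0 \<le> 1\<close> none is omitted.\<close>
  define m where "m = max (Suc n0) 2"
  have m2: "2 \<le> m" by (simp add: m_def)
  have y_large: "y \<langle>$\<rangle> i = y0 \<langle>$\<rangle> i" "int b < y0 \<langle>$\<rangle> i" if "int m \<le> i" "i \<le> int a" for i
  proof -
    show "int b < y0 \<langle>$\<rangle> i" using large[of i] that by (simp add: m_def)
    then show "y \<langle>$\<rangle> i = y0 \<langle>$\<rangle> i" using yy[of i] ad(2) that by (auto simp: m_def apply_tw)
  qed
  have iy_eq: "inverse y \<langle>$\<rangle> j = inverse y0 \<langle>$\<rangle> j" "j \<le> inverse y0 \<langle>$\<rangle> j" if "2 \<le> j" "j \<le> int b" for j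
  proof -
    show "j \<le> inverse y0 \<langle>$\<rangle> j" using ge2[of j] that by simp
    then show "inverse y \<langle>$\<rangle> j = inverse y0 \<langle>$\<rangle> j" using iyy[of j] that by (simp add: apply_tw)
  qed
  have ucy: "ucond y i" if "m \<le> i" "i < Suc a" for i
    unfolding ucond_def
  proof (intro allI impI)
    fix j assume j: "1 \<le> j \<and> j < int i"
    then show "\<bar>y \<langle>$\<rangle> j\<bar> < y \<langle>$\<rangle> (int i)"
      using y_large[of "int i"] that lt1[of j "int i"] p1[of j] absy[of j] by simp
  qed
  define g where "g = pprod r q m (Suc a) (hT y :: int perm \<Rightarrow> 'a)"
  have Ty: "hT y \<in> H" using yD by (rule hecke_hT)
  have gH: "g \<in> H" unfolding g_def using Ty m2 a(2) by (intro hecke_pprod) auto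
  have hTnz: "x = y" if "hT y x \<noteq> (0 :: 'a)" for x using that by (simp add: hT_apply split: if_splits)
  have gsup: "\<exists>e\<in>flips r m (Suc a). x = y * e" if "g x \<noteq> 0" for x
    using pprod_support(1)[OF m2 _ Ty, of "Suc a" x] ucy a(2) that hTnz unfolding g_def by blast
  have gy: "g y = q ^ (\<Sum>i = m..<Suc a. i - 1)"
  proof -
    have "g y = q ^ (\<Sum>i = m..<Suc a. i - 1) * hT y y"
      unfolding g_def
    proof (rule pprod_support(2)[OF m2 _ Ty])
      fix x e assume xe: "hT y x \<noteq> (0 :: 'a)" "y = x * e"
      have "y = y * e" using xe(2) unfolding hTnz[OF xe(1)] .
      then show "e = 1" by (metis perm.left_inverse perm_cancel_left(1))
    qed (use ucy a(2) hTnz in auto)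
    then show ?thesis by (simp add: hT_apply)
  qed
  define \<zeta> where "\<zeta> = P b \<bullet> g"
  have PbH: "P b \<in> H" and PaH: "P a \<in> H" using a b by (auto intro: hecke_P)
  have \<zeta>H: "\<zeta> \<in> H" unfolding \<zeta>_def using PbH by (rule hecke_mul)
  have sg: "star g \<in> H" using gH by (rule hecke_star)
  have s\<zeta>': "star \<zeta> = star g \<bullet> P b"
    unfolding \<zeta>_def using PbH gH b by (simp add: star_mul star_P)
  have s\<zeta>: "star \<zeta> = pprod r q 2 (Suc b) (star g)"
    unfolding s\<zeta>' hpi_pprod using mul_pprod[OF sg, of "hT 1" 2 "Suc b"] b(2) by (simp add: hecke_hT)
  have sgsup: "\<exists>e\<in>flips r m (Suc a). inverse x = y * e" if "star g x \<noteq> 0" for x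
    using gsup[of "inverse x"] that by (simp add: star_def)
  have inv_flip: "inverse e \<langle>$\<rangle> p = p" if "e \<langle>$\<rangle> p = p" for e p by (metis inverse_apply(1) that)
  have fl_fix: "e \<langle>$\<rangle> p = p" if "e \<in> flips r m (Suc a)" "2 \<le> p" "p < int m \<or> int a < p" for e p
    using that unfolding flips_def by auto
  have fl_fix2: "e \<langle>$\<rangle> p = p" if "e \<in> flips r 2 (Suc b)" "2 \<le> p" "int b < p" for e p
    using that unfolding flips_def by auto
  have fl_abs: "e \<in> signed r" "\<bar>e \<langle>$\<rangle> p\<bar> = \<bar>p\<bar>" "\<bar>inverse e \<langle>$\<rangle> p\<bar> = \<bar>p\<bar>" if "e \<in> flips r i j"
    for e p i j
  proof -
    show "e \<in> signed r" using that by (auto simp: flips_def dgroup_signed)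
    show "\<bar>e \<langle>$\<rangle> p\<bar> = \<bar>p\<bar>" for p using that unfolding flips_def by blast
    from this[of "inverse e \<langle>$\<rangle> p"] show "\<bar>inverse e \<langle>$\<rangle> p\<bar> = \<bar>p\<bar>" by simp
  qed
  \<comment> \<open>A value from \<open>2\<close> to \<open>b\<close> sits below place
    \<open>m\<close> or beyond place \<open>a\<close>, hence where the flips of the factors appended
    to \<open>hT y\<close> have no effect.\<close>
  have iy0_fix: "p < int m \<or> int a < p" if "2 \<le> j" "j \<le> int b" "p = inverse y0 \<langle>$\<rangle> j" for j p
  proof (rule ccontr)
    assume c: "\<not> (p < int m \<or> int a < p)"
    have "y0 \<langle>$\<rangle> p = j" using that by simp
    moreover have "int m \<le> p" "p \<le> int a" "int n0 < int m" using c by (auto simp: m_def)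
    ultimately show False using large[of p] that m2 by simp
  qed
  have ucg: "ucond x i" if sgx: "star g x \<noteq> 0" and "2 \<le> i" "i < Suc b" for x i
    unfolding ucond_def
  proof (intro allI impI)
    fix k assume k: "1 \<le> k \<and> k < int i"
    obtain e where e: "e \<in> flips r m (Suc a)" "inverse x = y * e" using sgsup[OF sgx] by blast
    have x: "x = inverse e * inverse y" using arg_cong[OF e(2), of inverse] by simp
    let ?p = "inverse y0 \<langle>$\<rangle> (int i)"
    have ip: "inverse y \<langle>$\<rangle> (int i) = ?p" "int i \<le> ?p" using iy_eq[of "int i"] that by auto
    have "?p < int m \<or> int a < ?p" using iy0_fix[of "int i"] that by simp
    then have "inverse e \<langle>$\<rangle> ?p = ?p" using fl_fix[OF e(1)] ip that by (intro inv_flip) auto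
    then have "x \<langle>$\<rangle> (int i) = ?p" by (simp add: x apply_times ip)
    moreover have "\<bar>x \<langle>$\<rangle> k\<bar> = \<bar>inverse y0 \<langle>$\<rangle> k\<bar>" by (simp add: x apply_times fl_abs[OF e(1)] absiy)
    ultimately show "\<bar>x \<langle>$\<rangle> k\<bar> < x \<langle>$\<rangle> (int i)"
      using lt2[of k "int i"] p2[of k] k that by simp
  qed
  \<comment> \<open>Nontrivial flips destroy the normalisation of signs. The places from
    \<open>m\<close> to \<open>a\<close>, which \<open>e2\<close> may flip, carry values above
    \<open>b\<close>, which have to stay positive and which \<open>e1\<close> does not touch; once
    \<open>e2 = 1\<close>, the values from \<open>2\<close> to \<open>b\<close> have to stay at
    positive places. The sign at \<open>1\<close> follows by parity.\<close>
  have Q: "e1 = 1 \<and> e2 = 1"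
    if e1: "e1 \<in> flips r 2 (Suc b)" and e2: "e2 \<in> flips r m (Suc a)"
      and s: "inverse e1 * y * e2 \<in> Yset r b a" for e1 e2
  proof -
    let ?s = "inverse e1 * y * e2"
    have ss: "?s \<in> signed r" using s by (auto simp: Yset_def dgroup_signed)
    obtain \<epsilon>' \<delta>' where t': "tri b a \<epsilon>' \<delta>' ?s" using s by (auto simp: Yset_def)
    have "e2 = 1"
    proof (rule flips_trivial[OF e2])
      fix i :: int assume i: "2 \<le> i"
      show "e2 \<langle>$\<rangle> i = i"
      proof (cases "i < int m \<or> int a < i")
        case False
        then have im: "int m \<le> i" "i \<le> int a" by auto
        have ei: "e2 \<langle>$\<rangle> i = i \<or> e2 \<langle>$\<rangle> i = - i" using fl_abs(2)[OF e2, of i] i by auto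
        have big: "int b < y \<langle>$\<rangle> i" "2 \<le> y \<langle>$\<rangle> i" using y_large[OF im] ge1[of i] i im by auto
        have "inverse e1 \<langle>$\<rangle> (y \<langle>$\<rangle> i) = y \<langle>$\<rangle> i" using fl_fix2[OF e1] big by (intro inv_flip) auto
        moreover have "inverse e1 \<langle>$\<rangle> (- (y \<langle>$\<rangle> i)) = - (inverse e1 \<langle>$\<rangle> (y \<langle>$\<rangle> i))"
          using fl_abs(1)[OF e1] by (simp add: signed_minus[OF inverse_signed])
        ultimately have si: "e2 \<langle>$\<rangle> i = i \<longrightarrow> ?s \<langle>$\<rangle> i = y \<langle>$\<rangle> i"
          "e2 \<langle>$\<rangle> i = - i \<longrightarrow> ?s \<langle>$\<rangle> i = - (y \<langle>$\<rangle> i)"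
          by (auto simp: apply_times signed_minus[OF ys])
        then have "int b < \<bar>?s \<langle>$\<rangle> i\<bar>" using ei big by auto
        then have "0 < ?s \<langle>$\<rangle> i" using tri_apply(3)[OF ss t'] i im by auto
        then show ?thesis using si ei big by auto
      qed (use fl_fix[OF e2 i] in auto)
    qed
    moreover have "e1 = 1"
    proof (rule flips_trivial[OF e1])
      fix j :: int assume j: "2 \<le> j"
      show "e1 \<langle>$\<rangle> j = j"
      proof (cases "int b < j")
        case False
        then have jb: "j \<le> int b" by simp
        have ej: "e1 \<langle>$\<rangle> j = j \<or> e1 \<langle>$\<rangle> j = - j" using fl_abs(2)[OF e1, of j] j by auto
        have "inverse ?s = inverse y * e1" using \<open>e2 = 1\<close> by simp
        then have si: "inverse ?s \<langle>$\<rangle> j = inverse y \<langle>$\<rangle> (e1 \<langle>$\<rangle> j)" by (simp only: apply_times o_apply)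
        have "0 < inverse ?s \<langle>$\<rangle> j" using tri_apply(4)[OF ss t' j jb] .
        then show ?thesis using si ej iy_eq[OF j jb] j signed_minus[OF iys, of j] by auto
      qed (use fl_fix2[OF e1 j] in auto)
    qed
    ultimately show ?thesis by simp
  qed
  have \<zeta>t: "\<zeta> s = 0" if s: "s \<in> Yset r b a" "s \<noteq> y" for s
  proof (rule ccontr)
    assume "\<zeta> s \<noteq> 0"
    then have "star \<zeta> (inverse s) \<noteq> 0" by (simp add: star_def)
    then obtain x e where xe: "star g x \<noteq> 0" "e \<in> flips r 2 (Suc b)" "inverse s = x * e"
      using pprod_support(1)[OF order_refl _ sg, of "Suc b" "inverse s"] ucg b(2) unfolding s\<zeta> by blast
    obtain e2 where e2: "e2 \<in> flips r m (Suc a)" "inverse x = y * e2" using sgsup[OF xe(1)] by blast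
    have "s = inverse e * y * e2" using arg_cong[OF xe(3), of inverse] e2(2) by (simp add: mult.assoc)
    then show False using Q[OF xe(2) e2(1)] s by auto
  qed
  have \<zeta>y: "\<zeta> y = q ^ (\<Sum>i = 2..<Suc b. i - 1) * g y"
  proof -
    have "star \<zeta> (inverse y) = q ^ (\<Sum>i = 2..<Suc b. i - 1) * star g (inverse y)"
      unfolding s\<zeta>
    proof (rule pprod_support(2)[OF order_refl _ sg])
      fix x e assume xe: "star g x \<noteq> 0" "e \<in> flips r 2 (Suc b)" "inverse y = x * e"
      obtain e2 where e2: "e2 \<in> flips r m (Suc a)" "inverse x = y * e2" using sgsup[OF xe(1)] by blast
      have "y = inverse e * y * e2" using arg_cong[OF xe(3), of inverse] e2(2) by (simp add: mult.assoc)
      then show "e = 1" using Q[OF xe(2) e2(1)] y by auto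
    qed (use ucg b(2) in auto)
    then show ?thesis by (simp add: star_def)
  qed
  have "\<exists>h\<in>H. \<zeta> = h \<bullet> P a"
  proof (cases "2 \<le> n0")
    case False
    then have "m = 2" by (simp add: m_def)
    then have "g = hT y \<bullet> P a"
      using mul_pprod[OF Ty, of "hT 1" 2 "Suc a"] a(2) by (simp add: g_def hpi_pprod hecke_hT)
    then have "\<zeta> = (P b \<bullet> hT y) \<bullet> P a" using PbH PaH Ty by (simp add: \<zeta>_def mul_assoc)
    then show ?thesis using PbH hecke_mul by blast
  next
    case True
    then have m: "m = Suc n0" by (simp add: m_def)
    have n0r: "n0 \<le> r" using n0a a by simp
    have PnH: "P n0 \<in> H" using n0r by (rule hecke_P)
    have "neut b a y0"
      using True n0a n0b small[of 1] unfolding neut_def by (intro exI[of _ 1]) auto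
    then have \<delta>: "\<not> \<delta>" using ad(4) by blast
    \<comment> \<open>\<open>\<rho>\<close> holds the factors of \<open>P b\<close> beyond
      \<open>n0\<close>. Applying \<open>star\<close> puts \<open>P n0\<close> last, next to
      \<open>hT y\<close>.\<close>
    define \<rho> where "\<rho> = pprod r q m (Suc b) (hT 1 :: int perm \<Rightarrow> 'a)"
    have \<rho>H: "\<rho> \<in> H" unfolding \<rho>_def using m2 b(2) by (intro hecke_pprod) (auto simp: hecke_hT)
    have "P b = pprod r q m (Suc b) (P n0)"
      unfolding hpi_pprod m using True n0b by (simp add: pprod_append)
    also have "\<dots> = P n0 \<bullet> \<rho>"
      unfolding \<rho>_def using mul_pprod[OF PnH, of "hT 1" m "Suc b"] m2 b(2) by (simp add: hecke_hT)
    finally have "star (P b) = star \<rho> \<bullet> star (P n0)" using PnH \<rho>H by (simp add: star_mul)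
    then have Pb: "P b = star \<rho> \<bullet> P n0" using b n0r by (simp add: star_P)
    have s\<rho>: "star \<rho> \<in> H" using \<rho>H by (rule hecke_star)
    have comm: "P n0 \<bullet> hT y = hT y \<bullet> P n0"
    proof (rule P_mul_commute_T[OF yD n0r])
      show "y \<langle>$\<rangle> i = i" if "2 \<le> i" "i \<le> int n0" for i
        using yy[of i] small[of i] that by (simp add: apply_tw)
      show "\<bar>y \<langle>$\<rangle> 1\<bar> = 1" if "2 \<le> n0" using absy[of 1] small[of 1] that by simp
    qed
    have "\<zeta> = pprod r q m (Suc a) (P b \<bullet> hT y)"
      unfolding \<zeta>_def g_def using mul_pprod[OF PbH Ty m2, of "Suc a"] a(2) by simp
    also have "P b \<bullet> hT y = (star \<rho> \<bullet> hT y) \<bullet> P n0"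
      unfolding Pb using s\<rho> PnH Ty comm by (simp add: mul_assoc)
    also have "pprod r q m (Suc a) \<dots> = (star \<rho> \<bullet> hT y) \<bullet> pprod r q m (Suc a) (P n0)"
      using hecke_mul[OF s\<rho>] PnH m2 a(2) by (intro mul_pprod) auto
    also have "pprod r q m (Suc a) (P n0) = P a"
      unfolding hpi_pprod m using True n0a by (simp add: pprod_append)
    finally show ?thesis using hecke_mul[OF s\<rho>] by blast
  qed
  moreover have "\<zeta> \<in> V b a"
  proof -
    obtain h where "h \<in> H" "\<zeta> = h \<bullet> P a" using calculation by blast
    then have "KR a \<zeta>" using KR_mul_P[OF a] by simp
    moreover have "KR b (star \<zeta>)" unfolding s\<zeta>' using KR_mul_P[OF b sg] .
    ultimately show ?thesis using \<zeta>H by (simp add: V_def)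
  qed
  ultimately have \<zeta>W: "\<zeta> \<in> W b a" by (simp add: W_def)
  \<comment> \<open>Only the constants of the factors contribute at \<open>y\<close>, so the
    coefficient is a power of \<open>q\<close> and can be scaled to \<open>1\<close>.\<close>
  define N where "N = (\<Sum>i = 2..<Suc b. i - 1) + (\<Sum>i = m..<Suc a. i - 1)"
  have \<zeta>N: "\<zeta> y = q ^ N" by (simp add: \<zeta>y gy N_def power_add)
  have "0 \<in> W b a"
    unfolding W_def using V_zero hecke_0 mul_zero_left by (metis (mono_tags, lifting) mem_Collect_eq)
  then have "hscale (qi ^ N) (\<zeta> - hscale 0 0) \<in> W b a" using \<zeta>W by (intro W_diff_scale)
  then have "hscale (qi ^ N) \<zeta> \<in> W b a" by simp
  moreover have "dual_at b a y (hscale (qi ^ N) \<zeta>)"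
    using \<zeta>t \<zeta>N qi_power[of N] by (auto simp: dual_at_def hscale_apply)
  ultimately show ?thesis by blast
qed

text \<open>Descents of the normalised element at allowed generators \<open>k \<ge> 1\<close> lead
  to lower representatives with the same twists, down to the sorted ones. The measure is taken on
  the normalised element because there the moves are by plain generators.\<close>

theorem V_dual:
  assumes a: "a = 0 \<or> 2 \<le> a" "a \<le> r" and b: "b = 0 \<or> 2 \<le> b" "b \<le> r" and y: "y \<in> Yset r b a"
  shows "\<exists>z\<in>W b a. dual_at b a y z"
proof -
  obtain \<epsilon> \<delta> where "tri b a \<epsilon> \<delta> y" using y by (auto simp: Yset_def)
  then show ?thesis using y
  proof (induction "card (Inv r (tw \<epsilon> * y * tw \<delta>))" arbitrary: y rule: less_induct)
    case less
    let ?w = "tw \<epsilon> * y * tw \<delta>"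
    have ys: "y \<in> signed r" using less.prems by (auto simp: Yset_def dgroup_signed)
    have y0s: "?w \<in> signed r" by (intro times_signed tw_signed ys)
    consider k where "1 \<le> k" "k < r" "k \<noteq> a" "\<not> up ?w k"
      | k where "1 \<le> k" "k < r" "k \<noteq> b" "\<not> up (inverse ?w) k"
      | "\<And>k. 1 \<le> k \<Longrightarrow> k < r \<Longrightarrow> k \<noteq> a \<Longrightarrow> up ?w k" "\<And>k. 1 \<le> k \<Longrightarrow> k < r \<Longrightarrow> k \<noteq> b \<Longrightarrow> up (inverse ?w) k"
      by blast
    then show ?case
    proof cases
      case (1 k)
      let ?y = "y * gen (tk \<delta> k)"
      have eq: "tw \<epsilon> * ?y * tw \<delta> = ?w * gen k"
        by (simp only: mult.assoc gen_tw(1)[OF 1(1)])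
      have "card (Inv r (tw \<epsilon> * ?y * tw \<delta>)) < card (Inv r ?w)"
        unfolding eq using card_Inv_down[OF y0s 1(2) r2 1(4)] by simp
      then have "\<exists>z\<in>W b a. dual_at b a ?y z"
        using less.hyps tri_right[OF less.prems(1) 1(1,3)] Yset_right[OF less.prems(2,1) 1(1-3)]
          by blast
      then show ?thesis using dual_right[OF a less.prems(2,1) 1(1-3)] by blast
    next
      case (2 k)
      let ?y = "gen (tk \<epsilon> k) * y"
      have eq: "tw \<epsilon> * ?y * tw \<delta> = gen k * ?w"
        by (simp only: mult.assoc[symmetric] gen_tw(2)[OF 2(1)])
      have "card (Inv r (gen k * ?w)) = card (Inv r (inverse ?w * gen k))"
        using card_Inv_inverse[OF times_signed[OF gen_signed[OF 2(2) r2] y0s]]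
        by (simp only: perm.inverse_distrib_swap inverse_gen)
      then have "card (Inv r (tw \<epsilon> * ?y * tw \<delta>)) < card (Inv r ?w)"
        unfolding eq using card_Inv_down[OF inverse_signed[OF y0s] 2(2) r2 2(4)] card_Inv_inverse[OF
          y0s] by simp
      then have "\<exists>z\<in>W b a. dual_at b a ?y z"
        using less.hyps tri_left[OF less.prems(1) 2(1,3)] Yset_left[OF less.prems(2,1) 2(1-3)] by blast
      then show ?thesis using dual_left[OF less.prems(2,1) 2(1-3)] by blast
    next
      case 3
      then show ?thesis using dual_sorted[OF a b less.prems(2,1)] by blast
    qed
  qed
qed

end

section \<open>Young subgroups and invariant solutions\<close>

definition yg :: "nat set \<Rightarrow> int perm set" where
  "yg J = generated (gen ` J)"

lemma one_yg [simp]: "1 \<in> yg J"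
  unfolding yg_def generated_def by (rule image_eqI[of _ _ "[]"]) auto

lemma yg_times_gen: "w \<in> yg J \<Longrightarrow> k \<in> J \<Longrightarrow> w * gen k \<in> yg J"
  unfolding yg_def generated_def
  by (clarsimp, rule_tac x = "x @ [gen k]" in image_eqI) auto

lemma yg_induct [consumes 1, case_names one step]:
  assumes "w \<in> yg J" "Q 1" "\<And>v k. v \<in> yg J \<Longrightarrow> Q v \<Longrightarrow> k \<in> J \<Longrightarrow> Q (v * gen k)"
  shows "Q w"
proof -
  obtain xs where xs: "xs \<in> lists (gen ` J)" "w = prod_list xs"
    using assms(1) by (auto simp: yg_def generated_def)
  have "prod_list xs \<in> yg J \<and> Q (prod_list xs)" using xs(1)
  proof (induction xs rule: rev_induct)
    case (snoc y ys)
    then show ?case using assms(3) yg_times_gen by auto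
  qed (use assms(2) in auto)
  then show ?thesis using xs(2) by simp
qed

lemma yg_gen_times: "w \<in> yg J \<Longrightarrow> k \<in> J \<Longrightarrow> gen k * w \<in> yg J"
proof (induction rule: yg_induct)
  case one
  then show ?case using yg_times_gen[of 1 J k] by simp
next
  case (step v j)
  then show ?case using yg_times_gen[of "gen k * v" J j] by (simp add: mult.assoc)
qed

lemma inverse_yg: "w \<in> yg J \<Longrightarrow> inverse w \<in> yg J"
  by (induction rule: yg_induct) (auto intro: yg_gen_times)

lemma yg_times_gen_iff: "k \<in> J \<Longrightarrow> w * gen k \<in> yg J \<longleftrightarrow> w \<in> yg J"
  by (metis gen_gen_right yg_times_gen)

lemma yg_pos:
  assumes "w \<in> yg J" "0 \<notin> J" "0 < i"
  shows "0 < w \<langle>$\<rangle> i"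
  using assms
proof (induction arbitrary: i rule: yg_induct)
  case (step v k)
  have "k \<noteq> 0" using step by metis
  then have "0 < gen k \<langle>$\<rangle> i"
    using step.prems by (auto simp: apply_gen lo_def hi_def)
  then show ?case using step by (simp add: apply_times)
qed simp

lemma yg_initial:
  assumes "w \<in> yg J" "0 \<notin> J" "p \<notin> J" "1 \<le> i" "i \<le> int p"
  shows "w \<langle>$\<rangle> i \<le> int p"
  using assms
proof (induction arbitrary: i rule: yg_induct)
  case (step v k)
  then have "k \<noteq> p" "1 \<le> k" by (auto intro: Suc_leI gr0I)
  then show ?case using step gen_positive[of k p i] by (simp add: apply_times)
qed simp

lemma chain_less:
  fixes f :: "int \<Rightarrow> int"
  assumes "\<And>p. i \<le> p \<Longrightarrow> p < j \<Longrightarrow> f p < f (p + 1)" "i < j"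
  shows "f i < f j"
proof -
  have "i + 1 + int n \<le> j \<Longrightarrow> f i < f (i + 1 + int n)" for n
  proof (induction n)
    case 0
    then show ?case using assms(1)[of i] by simp
  next
    case (Suc n)
    have "f (i + 1 + int n) < f (i + 1 + int n + 1)" using Suc.prems by (intro assms(1)) auto
    then show ?case using Suc by (simp add: algebra_simps)
  qed
  from this[of "nat (j - i - 1)"] assms(2) show ?thesis by simp
qed

lemma tw_lo_hi':
  "1 \<le> k \<Longrightarrow> tw c \<langle>$\<rangle> (lo k) = lo (tk c k)" "1 \<le> k \<Longrightarrow> tw c \<langle>$\<rangle> (hi k) = hi (tk c k)"
  by (auto simp: apply_tw tk_def lo_def hi_def)

definition xJ :: "nat set \<Rightarrow> int perm \<Rightarrow> 'a::comm_ring_1" where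
  "xJ J = (\<Sum>w\<in>yg J. hT w)"

text \<open>The Young subgroups of the two sides move the points of \<open>Yset\<close> by
  generators twisted according to the point; by \<open>tri_right\<close> and \<open>tri_left\<close>
  the twists do not change along an orbit.\<close>

definition orbit_step :: "nat \<Rightarrow> nat \<Rightarrow> nat set \<Rightarrow> nat \<Rightarrow> nat set \<Rightarrow> int perm rel" where
  "orbit_step r b M a J = {(y, t). y \<in> Yset r b a \<and> (\<exists>\<epsilon> \<delta>. tri b a \<epsilon> \<delta> y \<and>
     ((\<exists>k\<in>J. t = y * gen (tk \<delta> k)) \<or> (\<exists>k\<in>M. t = gen (tk \<epsilon> k) * y)))}"

definition orbit_rel :: "nat \<Rightarrow> nat \<Rightarrow> nat set \<Rightarrow> nat \<Rightarrow> nat set \<Rightarrow> int perm rel" where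
  "orbit_rel r b M a J = (orbit_step r b M a J \<union> (orbit_step r b M a J)\<inverse>)\<^sup>*"

text \<open>Any choice of representatives will do as long as it does not depend on the coefficients:
  the same \<open>Yrep\<close> then gives coordinates over every ring.\<close>

definition orbit_rep :: "nat \<Rightarrow> nat \<Rightarrow> nat set \<Rightarrow> nat \<Rightarrow> nat set \<Rightarrow> int perm \<Rightarrow> int perm" where
  "orbit_rep r b M a J y = (SOME t. (y, t) \<in> orbit_rel r b M a J)"

definition Yrep :: "nat \<Rightarrow> nat \<Rightarrow> nat set \<Rightarrow> nat \<Rightarrow> nat set \<Rightarrow> int perm set" where
  "Yrep r b M a J = orbit_rep r b M a J ` Yset r b a"

lemma orbit_rep_eq:
  assumes "(y, t) \<in> orbit_rel r b M a J"
  shows "orbit_rep r b M a J y = orbit_rep r b M a J t"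
proof -
  let ?E = "orbit_rel r b M a J"
  have "sym ?E" unfolding orbit_rel_def by (intro sym_rtrancl) (auto simp: sym_def)
  then have "(t, y) \<in> ?E" using assms by (simp add: symD)
  then have "(y, s) \<in> ?E \<longleftrightarrow> (t, s) \<in> ?E" for s
    using assms unfolding orbit_rel_def by (meson rtrancl_trans)
  then show ?thesis by (simp add: orbit_rep_def)
qed

lemma orbit_rep_rel: "(y, orbit_rep r b M a J y) \<in> orbit_rel r b M a J"
  unfolding orbit_rep_def by (rule someI[of _ y]) (simp add: orbit_rel_def)

section \<open>Orbit sums and solutions invariant under Young subgroups\<close>

context hecke_D_unit
begin

lemma yg_dgroup: "J \<subseteq> {..<r} \<Longrightarrow> w \<in> yg J \<Longrightarrow> w \<in> dgroup r"
  by (rotate_tac, induction rule: yg_induct) auto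

lemma finite_yg: "J \<subseteq> {..<r} \<Longrightarrow> finite (yg J)"
  by (rule finite_subset[of _ "dgroup r"]) (auto simp: yg_dgroup)

lemma xJ_apply: "J \<subseteq> {..<r} \<Longrightarrow> xJ J x = (if x \<in> yg J then 1 else 0)"
  by (simp add: xJ_def sum_fun_apply hT_apply finite_yg)

lemma xJ_hecke: "J \<subseteq> {..<r} \<Longrightarrow> xJ J \<in> H"
  unfolding xJ_def by (intro hecke_sum hecke_hT yg_dgroup) auto

lemma star_xJ: "J \<subseteq> {..<r} \<Longrightarrow> star (xJ J) = xJ J"
  using inverse_yg by (fastforce simp: fun_eq_iff star_def xJ_apply dest: inverse_yg)

lemma R_xJ: "J \<subseteq> {..<r} \<Longrightarrow> k \<in> J \<Longrightarrow> R k (xJ J) = hscale q (xJ J)"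
  by (auto simp: fun_eq_iff Rop_apply xJ_apply yg_times_gen_iff hscale_apply)

text \<open>Elements of the Young subgroup keep positive places positive and map
  \<open>{1..p}\<close> to itself for \<open>p\<close> outside \<open>J\<close>, so they cannot
  descend at a generator outside \<open>J\<close>.\<close>

lemma yg_descent:
  assumes J: "J \<subseteq> {1..<r}" and w: "w \<in> yg J" "w \<noteq> 1"
  obtains k where "k \<in> J" "\<not> up w k"
proof -
  have J': "J \<subseteq> {..<r}" "0 \<notin> J" using J by auto
  have wD: "w \<in> dgroup r" using J'(1) w(1) by (rule yg_dgroup)
  have ws: "w \<in> signed r" using wD by (rule dgroup_signed)
  obtain k where k: "k < r" "\<not> up w k" using descent_exists wD w(2) by metis
  have "k \<in> J"
  proof (rule ccontr)
    assume kJ: "k \<notin> J"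
    show False
    proof (cases "k = 0")
      case True
      have "0 < w \<langle>$\<rangle> 1" "0 < w \<langle>$\<rangle> 2" using yg_pos[OF w(1) J'(2)] by auto
      then show False using k True signed_minus[OF ws, of 1] by (simp add: up_def lo_def hi_def)
    next
      case False
      have "w \<langle>$\<rangle> (int k) \<le> int k" using yg_initial[OF w(1) J'(2) kJ] False by simp
      moreover have "\<not> w \<langle>$\<rangle> (int k + 1) \<le> int k"
      proof
        assume "w \<langle>$\<rangle> (int k + 1) \<le> int k"
        moreover have "0 < w \<langle>$\<rangle> (int k + 1)" using yg_pos[OF w(1) J'(2)] by simp
        ultimately have "inverse w \<langle>$\<rangle> (w \<langle>$\<rangle> (int k + 1)) \<le> int k"
          using yg_initial[OF inverse_yg[OF w(1)] J'(2) kJ, of "w \<langle>$\<rangle> (int k + 1)"] by linarith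
        then show False by simp
      qed
      ultimately show False using k False by (simp add: up_def lo_def hi_def)
    qed
  qed
  then show thesis using k that by blast
qed

text \<open>Every \<open>hT w\<close> in the sum is a product along letters of \<open>J\<close>,
  each of which commutes with \<open>P a\<close> because \<open>a\<close> is not in
  \<open>J\<close>.\<close>

lemma P_comm_xJ:
  assumes a: "a \<le> r" and J: "J \<subseteq> {1..<r} - {a}"
  shows "P a \<bullet> xJ J = xJ J \<bullet> P a"
proof -
  have J': "J \<subseteq> {..<r}" "J \<subseteq> {1..<r}" using J by auto
  have PH: "P a \<in> H" using a by (rule hecke_P)
  have "P a \<bullet> hT w = hT w \<bullet> P a" if "w \<in> yg J" for w
    using that
  proof (induction "dlength r w" arbitrary: w rule: less_induct)
    case less
    have wD: "w \<in> dgroup r" using J'(1) less.prems by (rule yg_dgroup)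
    show ?case
    proof (cases "w = 1")
      case False
      then obtain k where kJ: "k \<in> J" and k: "\<not> up w k" using yg_descent[OF J'(2) less.prems] by blast
      have k': "1 \<le> k" "k < r" "a \<noteq> k" using kJ J by auto
      let ?v = "w * gen k"
      have v: "?v \<in> yg J" "?v \<in> dgroup r" using less.prems kJ yg_times_gen wD k' by auto
      have vH: "hT ?v \<in> H" using v(2) by (rule hecke_hT)
      have "dlength r ?v < dlength r w" using dlength_gen[OF wD k'(2)] k by simp
      then have IH: "P a \<bullet> hT ?v = hT ?v \<bullet> P a" using less.hyps v by blast
      have Tw: "hT w = R k (hT ?v)" using k by (simp add: Rop_hT up_gen_iff)
      have "P a \<bullet> hT w = R k (hT ?v \<bullet> P a)"
        unfolding Tw mul_R[OF PH vH k'(2)] IH ..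
      also have "\<dots> = hT ?v \<bullet> L k (P a)"
        unfolding mul_R[OF vH PH k'(2), symmetric] P_comm[OF k'(1,2) a k'(3)] ..
      also have "\<dots> = hT w \<bullet> P a"
        unfolding Tw using vH PH k'(2) by (rule mul_L_eq_R_mul)
      finally show ?thesis .
    qed (use PH in simp)
  qed
  then show ?thesis by (simp add: xJ_def mul_sum_left mul_sum_right)
qed

lemma R_dual_up:
  assumes z: "z \<in> V b a" "dual_at b a y z" and y: "y \<in> Yset r b a" and t: "tri b a \<epsilon> \<delta> y"
    and k: "1 \<le> k" "k < r" "k \<noteq> a" and u: "up y (tk \<delta> k)"
  shows "dual_at b a (y * gen (tk \<delta> k)) (R k z)"
  unfolding dual_at_def
proof
  let ?y = "y * gen (tk \<delta> k)"
  have y': "?y \<in> Yset r b a" using y t k by (rule Yset_right)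
  fix s assume s: "s \<in> Yset r b a"
  then obtain \<epsilon>' \<delta>' where t': "tri b a \<epsilon>' \<delta>' s" by (auto simp: Yset_def)
  let ?s = "s * gen (tk \<delta>' k)"
  have s': "?s \<in> Yset r b a" using s t' k by (rule Yset_right)
  have val: "R k z s = R (tk \<delta>' k) z s" using z(1) t' by (rule tri_V_R)
  have zs: "z s = (if s = y then 1 else 0)" "z ?s = (if ?s = y then 1 else 0)"
    using z(2) s s' by (auto simp: dual_at_def)
  have ys: "y \<in> signed r" "?y \<in> signed r" using y y' unfolding Yset_def
    by (auto simp only: mem_Collect_eq dgroup_signed)
  show "R k z s = (if s = ?y then 1 else 0)"
  proof (cases "s = ?y \<or> s = y")
    case True
    then have "\<delta>' = \<delta>"
      using tri_unique(2)[OF ys(1)] tri_unique(2)[OF ys(2)] t t' tri_right[OF t k(1,3)] by blast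
    then show ?thesis
      using True val zs u by (auto simp: Rop_apply up_gen_iff)
  next
    case False
    have "?s \<noteq> y"
    proof
      assume eq: "?s = y"
      have "tri b a \<epsilon>' \<delta>' y" using tri_right[OF t' k(1,3)] eq by simp
      then have "\<delta>' = \<delta>" using tri_unique(2)[OF ys(1)] t by blast
      then have "y * gen (tk \<delta> k) = s" using eq gen_gen_right[of s "tk \<delta> k"] by (simp only:)
      then show False using False by (simp only: simp_thms)
    qed
    then have "R (tk \<delta>' k) z s = 0" using zs False by (simp add: Rop_apply)
    then have "R k z s = 0" by (rule trans[OF val])
    then show ?thesis using False by simp
  qed
qed

text \<open>At an ascent both sides of the equation carry the factor \<open>q\<close>, which can be
  cancelled; at a descent the terms in \<open>q - 1\<close> combine. What remains is constancy along
  the move, in which \<open>q\<close> no longer occurs.\<close>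

lemma eigen_iff_right:
  assumes z: "z \<in> V b a" and y: "tri b a \<epsilon> \<delta> y"
  shows "R k z y = q * z y \<longleftrightarrow> z (y * gen (tk \<delta> k)) = z y"
proof -
  have "q * (z (y * gen (tk \<delta> k)) - z y) = 0 \<longleftrightarrow> z (y * gen (tk \<delta> k)) - z y = 0"
    using q_cancel[of "z (y * gen (tk \<delta> k)) - z y"] by (metis mult_zero_right)
  then show ?thesis
    by (subst tri_V_R[OF z y]) (auto simp: Rop_apply algebra_simps)
qed

lemma eigen_iff_left:
  assumes z: "z \<in> V b a" and y: "tri b a \<epsilon> \<delta> y"
  shows "L k z y = q * z y \<longleftrightarrow> z (gen (tk \<epsilon> k) * y) = z y"
proof -
  have "q * (z (gen (tk \<epsilon> k) * y) - z y) = 0 \<longleftrightarrow> z (gen (tk \<epsilon> k) * y) - z y = 0"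
    using q_cancel[of "z (gen (tk \<epsilon> k) * y) - z y"] by (metis mult_zero_right)
  then show ?thesis
    by (subst tri_V_L[OF z y]) (auto simp: Lop_apply algebra_simps)
qed

lemma finite_Yset [simp]: "finite (Yset r b a)"
  by (rule finite_subset[of _ "dgroup r"]) (auto simp: Yset_def)

text \<open>The point \<open>y\<close> is lowest in its orbit under the twisted Young subgroup, so
  multiplying along a reduced word of \<open>w\<close> meets only ascents, and
  \<open>R_dual_up\<close> applies at every letter.\<close>

lemma dual_mul_T:
  assumes J: "J \<subseteq> {1..<r} - {a}" and z: "z \<in> V b a" "dual_at b a y z" and y: "y \<in> Yset r b a"
    and t: "tri b a \<epsilon> \<delta> y" and u: "\<And>k. k \<in> J \<Longrightarrow> up y (tk \<delta> k)" and w: "w \<in> yg J"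
  shows "z \<bullet> hT w \<in> V b a \<and> dual_at b a (y * tw \<delta> * w * tw \<delta>) (z \<bullet> hT w) \<and>
    y * tw \<delta> * w * tw \<delta> \<in> Yset r b a \<and> tri b a \<epsilon> \<delta> (y * tw \<delta> * w * tw \<delta>)"
  using w
proof (induction "dlength r w" arbitrary: w rule: less_induct)
  case less
  have J': "J \<subseteq> {..<r}" "J \<subseteq> {1..<r}" "0 \<notin> J" using J by auto
  have wD: "w \<in> dgroup r" using J'(1) less.prems by (rule yg_dgroup)
  show ?case
  proof (cases "w = 1")
    case True
    then show ?thesis using z y t by (simp add: mult.assoc)
  next
    case False
    then obtain k where kJ: "k \<in> J" and k: "\<not> up w k" using yg_descent[OF J'(2) less.prems] by blast
    have k': "1 \<le> k" "k < r" "k \<noteq> a" using kJ J by auto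
    let ?v = "w * gen k"
    let ?y = "y * tw \<delta> * ?v * tw \<delta>"
    have v: "?v \<in> yg J" "?v \<in> dgroup r" using less.prems kJ yg_times_gen wD k' by auto
    have "dlength r ?v < dlength r w" using dlength_gen[OF wD k'(2)] k by simp
    then have IH: "z \<bullet> hT ?v \<in> V b a" "dual_at b a ?y (z \<bullet> hT ?v)" "?y \<in> Yset r b a" "tri b a \<epsilon> \<delta> ?y"
      using less.hyps v by blast+
    have zw: "z \<bullet> hT w = R k (z \<bullet> hT ?v)"
    proof -
      have "hT w = R k (hT ?v)" using k by (simp add: Rop_hT up_gen_iff)
      then show ?thesis using V_hecke[OF z(1)] v k'(2) by (simp add: mul_R hecke_hT)
    qed
    have yw: "?y * gen (tk \<delta> k) = y * tw \<delta> * w * tw \<delta>"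
      using gen_tw(2)[OF k'(1), of \<delta>] by (simp add: mult.assoc)
    have upv: "?v \<langle>$\<rangle> (int k) < ?v \<langle>$\<rangle> (int k + 1)"
      using k k' up_gen_iff[of w k] by (simp add: up_def lo_def hi_def)
    \<comment> \<open>The two values lie in one block of \<open>J\<close>: an index \<open>p\<close>
      outside \<open>J\<close> separating them would be a boundary preserved by \<open>?v\<close>,
      forcing \<open>p = k\<close>.\<close>
    have inJ: "nat p \<in> J" if p: "?v \<langle>$\<rangle> (int k) \<le> p" "p < ?v \<langle>$\<rangle> (int k + 1)" for p
    proof (rule ccontr)
      assume nJ: "nat p \<notin> J"
      have pv: "0 < ?v \<langle>$\<rangle> (int k)" using yg_pos[OF v(1) J'(3)] k' by simp
      then have ip: "int (nat p) = p" using p by simp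
      have "inverse ?v \<langle>$\<rangle> (?v \<langle>$\<rangle> (int k)) \<le> int (nat p)"
        using yg_initial[OF inverse_yg[OF v(1)] J'(3) nJ, of "?v \<langle>$\<rangle> (int k)"] p pv ip by linarith
      then have "int k \<le> p" by (simp only: inverse_apply ip)
      moreover have "\<not> int k + 1 \<le> p"
      proof
        assume "int k + 1 \<le> p"
        then have "?v \<langle>$\<rangle> (int k + 1) \<le> int (nat p)"
          using yg_initial[OF v(1) J'(3) nJ, of "int k + 1"] ip by linarith
        then show False using p ip by simp
      qed
      ultimately have "p = int k" by simp
      then show False using nJ kJ by simp
    qed
    have "up ?y (tk \<delta> k)"
    proof -
      let ?f = "\<lambda>i. (y * tw \<delta>) \<langle>$\<rangle> i"
      have "?f (?v \<langle>$\<rangle> (int k)) < ?f (?v \<langle>$\<rangle> (int k + 1))"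
      proof (rule chain_less[OF _ upv])
        fix p assume p: "?v \<langle>$\<rangle> (int k) \<le> p" "p < ?v \<langle>$\<rangle> (int k + 1)"
        have pJ: "nat p \<in> J" using p by (rule inJ)
        then have np: "1 \<le> nat p" using J'(2) by auto
        have "up y (tk \<delta> (nat p))" using u[OF pJ] .
        then have "?f (lo (nat p)) < ?f (hi (nat p))"
          by (simp only: up_def apply_times o_apply tw_lo_hi'[OF np])
        moreover have "lo (nat p) = p" "hi (nat p) = p + 1" using np by (auto simp: lo_def hi_def)
        ultimately show "?f p < ?f (p + 1)" by (simp only:)
      qed
      then show ?thesis
        using tw_lo_hi[OF k'(1), of \<delta>] k' by (simp add: up_def apply_times) (simp add: lo_def hi_def)
    qed
    from R_dual_up[OF IH(1,2,3,4) k' this] V_R[OF IH(1) k'(2,3)]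
      Yset_right[OF IH(3,4) k'] tri_right[OF IH(4) k'(1,3)]
    show ?thesis unfolding zw yw by blast
  qed
qed

text \<open>
  Subtracting orbit sums \<open>z \<bullet> xJ J\<close> one at a time, each at a shortest element of the support,
  exhausts an invariant.
\<close>

lemma invariant_right:
  assumes a: "a = 0 \<or> 2 \<le> a" "a \<le> r" and J: "J \<subseteq> {1..<r} - {a}"
    and z: "z \<in> V 0 a" and inv: "\<And>k. k \<in> J \<Longrightarrow> R k z = hscale q z"
  shows "\<exists>h\<in>H. z = h \<bullet> (P a \<bullet> xJ J)"
  using z inv
proof (induction "card {t \<in> Yset r 0 a. z t \<noteq> 0}" arbitrary: z rule: less_induct)
  case less
  let ?Y = "Yset r 0 a"
  let ?S = "{t \<in> ?Y. z t \<noteq> 0}"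
  have J': "J \<subseteq> {..<r}" "J \<subseteq> {1..<r}" "0 \<notin> J" using J by auto
  have PH: "P a \<in> H" using a(2) by (rule hecke_P)
  have xH: "xJ J \<in> H" using J'(1) by (rule xJ_hecke)
  have PxH: "P a \<bullet> xJ J \<in> H" using PH by (rule hecke_mul)
  show ?case
  proof (cases "?S = {}")
    case True
    then have "z = 0" using V_determined[of a 0 z] a less.prems by auto
    then show ?thesis by (intro bexI[of _ 0]) auto
  next
    case False
    have finS: "finite ?S" using finite_Yset by (rule finite_subset[rotated]) auto
    define y where "y = arg_min_on (dlength r) ?S"
    have yS: "y \<in> ?S" and ymin: "\<And>t. t \<in> ?S \<Longrightarrow> dlength r y \<le> dlength r t"
      unfolding y_def using arg_min_if_finite[OF finS False, of "dlength r"] by (auto simp: not_less)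
    then have y: "y \<in> ?Y" by simp
    then obtain \<epsilon> \<delta> where t: "tri 0 a \<epsilon> \<delta> y" by (auto simp: Yset_def)
    have yD: "y \<in> dgroup r" using y by (simp add: Yset_def)
    have zinv: "z (s * gen (tk \<delta>' k)) = z s" if "k \<in> J" "tri 0 a \<epsilon>' \<delta>' s" for s k \<epsilon>' \<delta>'
    proof -
      have "R k z s = q * z s" using less.prems(2)[OF that(1)] by (simp add: hscale_apply)
      then show ?thesis using eigen_iff_right[OF less.prems(1) that(2), of k] by blast
    qed
    \<comment> \<open>Otherwise the neighbour would be a shorter point of the support, as
      \<open>z\<close> is constant along the orbit.\<close>
    have u: "up y (tk \<delta> k)" if "k \<in> J" for k
    proof (rule ccontr)
      assume nu: "\<not> up y (tk \<delta> k)"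
      have k: "1 \<le> k" "k < r" "k \<noteq> a" using that J by auto
      have "y * gen (tk \<delta> k) \<in> ?S" using Yset_right[OF y t k] zinv[OF that t] yS by simp
      then have "dlength r y \<le> dlength r (y * gen (tk \<delta> k))" by (rule ymin)
      then show False using dlength_gen[OF yD tk_less[OF k(2)], of \<delta>] nu by simp
    qed
    obtain v where v: "v \<in> W 0 a" "dual_at 0 a y v" using V_dual[OF a _ _ y] by auto
    then obtain g where g: "g \<in> H" "v = g \<bullet> P a" and vV: "v \<in> V 0 a" unfolding W_def by blast
    define o' where "o' = v \<bullet> xJ J"
    have osum: "o' = (\<Sum>w\<in>yg J. v \<bullet> hT w)" by (simp add: o'_def xJ_def mul_sum_right)
    let ?h = "\<lambda>w. y * tw \<delta> * w * tw \<delta>"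
    have dm: "v \<bullet> hT w \<in> V 0 a" "dual_at 0 a (?h w) (v \<bullet> hT w)" "?h w \<in> ?Y" "tri 0 a \<epsilon> \<delta> (?h w)"
      if "w \<in> yg J" for w
      using dual_mul_T[OF J vV v(2) y t u that] by auto
    have hinj: "w = w'" if "?h w = ?h w'" for w w'
      using arg_cong[OF that, of "\<lambda>x. tw \<delta> * inverse y * x * tw \<delta>"] by (simp add: mult.assoc)
    \<comment> \<open>On \<open>Yset\<close> the orbit sum is the indicator of the orbit of
      \<open>y\<close>. No multiplicities occur, because the action from one side only is
      free.\<close>
    have oval: "o' s = (if s \<in> ?h ` yg J then 1 else 0)" if "s \<in> ?Y" for s
    proof -
      have "o' s = (\<Sum>w\<in>yg J. if s = ?h w then 1 else 0)"
        unfolding osum sum_fun_apply using dm(2) that by (intro sum.cong) (auto simp: dual_at_def)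
      also have "\<dots> = (if s \<in> ?h ` yg J then 1 else 0)"
      proof (cases "s \<in> ?h ` yg J")
        case True
        then obtain w0 where w0: "w0 \<in> yg J" "s = ?h w0" by blast
        then have "(\<Sum>w\<in>yg J. if s = ?h w then 1 else 0) = (\<Sum>w\<in>yg J. if w = w0 then 1 else (0::'a))"
          using hinj by (intro sum.cong) (auto simp del: mult.assoc)
        then show ?thesis using w0 finite_yg[OF J'(1)] True by simp
      next
        case False
        then have "(\<Sum>w\<in>yg J. if s = ?h w then 1 else 0) = (0::'a)" by (intro sum.neutral) auto
        then show ?thesis using False by simp
      qed
      finally show ?thesis .
    qed
    have zorb: "z (?h w) = z y" if "w \<in> yg J" for w
      using that
    proof (induction rule: yg_induct)
      case one
      then show ?case by (simp add: mult.assoc)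
    next
      case (step w k)
      have "?h (w * gen k) = ?h w * gen (tk \<delta> k)"
        using gen_tw(2)[of k \<delta>] subsetD[OF J'(2) step.hyps(2)] by (simp add: mult.assoc)
      then show ?case using zinv[OF step.hyps(2) dm(4)[OF step.hyps(1)]] step.IH by simp
    qed
    define z' where "z' = z - hscale (z y) o'"
    have oV: "o' \<in> V 0 a" unfolding osum by (intro V_sum dm)
    have z'V: "z' \<in> V 0 a" unfolding z'_def using less.prems(1) oV by (intro V_diff V_scale)
    have "R k o' = hscale q o'" if "k \<in> J" for k
      unfolding o'_def using V_hecke[OF vV] xH that J'(1) R_xJ[OF J'(1) that]
      by (subst mul_R[symmetric]) (auto simp: mul_scale_right)
    then have z'inv: "R k z' = hscale q z'" if "k \<in> J" for k
      unfolding z'_def linop_diff[OF linop_Rop] linop_scale[OF linop_Rop]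
      using less.prems(2) that by (simp add: hscale_diff mult.commute)
    have z'val: "z' s = (if s \<in> ?h ` yg J then 0 else z s)" if "s \<in> ?Y" for s
      using oval[OF that] zorb by (auto simp: z'_def hscale_apply)
    have "y = ?h 1" by (simp add: mult.assoc)
    then have "y \<in> ?h ` yg J" using one_yg by blast
    then have "{t \<in> ?Y. z' t \<noteq> 0} \<subseteq> ?S" "y \<notin> {t \<in> ?Y. z' t \<noteq> 0}"
      using z'val y by (auto split: if_splits)
    then have "{t \<in> ?Y. z' t \<noteq> 0} \<subset> ?S" using yS by blast
    then have "card {t \<in> ?Y. z' t \<noteq> 0} < card ?S" using finS by (rule psubset_card_mono[rotated])
    then obtain h where h: "h \<in> H" "z' = h \<bullet> (P a \<bullet> xJ J)" using less.hyps z'V z'inv by blast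
    have "o' = g \<bullet> (P a \<bullet> xJ J)" using g PH xH by (simp add: o'_def mul_assoc)
    then have "z = (h + hscale (z y) g) \<bullet> (P a \<bullet> xJ J)"
      using h(2) unfolding mul_add_left mul_scale_left by (simp add: z'_def algebra_simps)
    moreover have "h + hscale (z y) g \<in> H" using h(1) g(1) by (intro hecke_add hecke_scale)
    ultimately show ?thesis by blast
  qed
qed

text \<open>Model of the homomorphisms between two summands: \<open>a\<close> and \<open>J\<close>
  belong to the source, \<open>b\<close> and \<open>M\<close> to the target, and \<open>z\<close> is
  the image of the generator of the source.\<close>

definition Cset :: "nat \<Rightarrow> nat set \<Rightarrow> nat \<Rightarrow> nat set \<Rightarrow> (int perm \<Rightarrow> 'a) set" where
  "Cset b M a J = {z \<in> V b a. (\<forall>k\<in>J. R k z = hscale q z) \<and> (\<forall>k\<in>M. L k z = hscale q z)}"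

lemma orbit_step_Yset:
  assumes J: "J \<subseteq> {1..<r} - {a}" and M: "M \<subseteq> {1..<r} - {b}" and yt: "(y, t) \<in> orbit_step r b M a J"
  shows "y \<in> Yset r b a" "t \<in> Yset r b a"
proof -
  obtain \<epsilon> \<delta> where y: "y \<in> Yset r b a" "tri b a \<epsilon> \<delta> y"
    and "(\<exists>k\<in>J. t = y * gen (tk \<delta> k)) \<or> (\<exists>k\<in>M. t = gen (tk \<epsilon> k) * y)"
    using yt unfolding orbit_step_def by blast
  then consider k where "k \<in> J" "t = y * gen (tk \<delta> k)" | k where "k \<in> M" "t = gen (tk \<epsilon> k) * y"
    by blast
  then show "t \<in> Yset r b a"
  proof cases
    case (1 k)
    then have "1 \<le> k" "k < r" "k \<noteq> a" using J by auto
    then show ?thesis unfolding 1(2) by (rule Yset_right[OF y])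
  next
    case (2 k)
    then have "1 \<le> k" "k < r" "k \<noteq> b" using M by auto
    then show ?thesis unfolding 2(2) by (rule Yset_left[OF y])
  qed
  show "y \<in> Yset r b a" by (rule y(1))
qed

lemma orbit_rel_Yset:
  assumes J: "J \<subseteq> {1..<r} - {a}" and M: "M \<subseteq> {1..<r} - {b}"
    and "(y, t) \<in> orbit_rel r b M a J" "y \<in> Yset r b a"
  shows "t \<in> Yset r b a"
  using assms(3,4) unfolding orbit_rel_def
  by (induction rule: rtrancl_induct) (auto dest: orbit_step_Yset[OF J M])

lemma Yrep_subset:
  assumes "J \<subseteq> {1..<r} - {a}" "M \<subseteq> {1..<r} - {b}"
  shows "Yrep r b M a J \<subseteq> Yset r b a"
  unfolding Yrep_def using orbit_rep_rel orbit_rel_Yset[OF assms] by blast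

text \<open>The defects \<open>R k z - hscale q z\<close> and \<open>L k z - hscale q z\<close> lie
  again in \<open>V b a\<close>, so it suffices to test them on \<open>Yset\<close>, where they
  express constancy along the moves.\<close>

lemma Cset_iff:
  assumes a: "a = 0 \<or> 2 \<le> a" "a \<le> r" and b: "b = 0 \<or> 2 \<le> b" "b \<le> r"
    and J: "J \<subseteq> {1..<r} - {a}" and M: "M \<subseteq> {1..<r} - {b}" and z: "z \<in> V b a"
  shows "z \<in> Cset b M a J \<longleftrightarrow> (\<forall>(y, t)\<in>orbit_step r b M a J. z t = z y)"
proof
  assume zC: "z \<in> Cset b M a J"
  show "\<forall>(y, t)\<in>orbit_step r b M a J. z t = z y"
  proof (clarify)
    fix y t assume "(y, t) \<in> orbit_step r b M a J"
    then obtain \<epsilon> \<delta> where t: "tri b a \<epsilon> \<delta> y"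
      and "(\<exists>k\<in>J. t = y * gen (tk \<delta> k)) \<or> (\<exists>k\<in>M. t = gen (tk \<epsilon> k) * y)"
      unfolding orbit_step_def by blast
    then consider k where "k \<in> J" "t = y * gen (tk \<delta> k)" | k where "k \<in> M" "t = gen (tk \<epsilon> k) * y"
      by blast
    then show "z t = z y"
    proof cases
      case (1 k)
      then have "R k z y = q * z y" using zC by (simp add: Cset_def hscale_apply)
      then show ?thesis using eigen_iff_right[OF z t, of k] 1 by blast
    next
      case (2 k)
      then have "L k z y = q * z y" using zC by (simp add: Cset_def hscale_apply)
      then show ?thesis using eigen_iff_left[OF z t, of k] 2 by blast
    qed
  qed
next
  assume const: "\<forall>(y, t)\<in>orbit_step r b M a J. z t = z y"
  have "R k z - hscale q z = 0" if k: "k \<in> J" for k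
  proof (rule V_determined[of a b])
    show "R k z - hscale q z \<in> V b a"
      using z k J by (intro V_diff V_R V_scale) auto
    fix y assume y: "y \<in> Yset r b a"
    then obtain \<epsilon> \<delta> where t: "tri b a \<epsilon> \<delta> y" by (auto simp: Yset_def)
    then have "(y, y * gen (tk \<delta> k)) \<in> orbit_step r b M a J" using y k unfolding orbit_step_def by blast
    then have "z (y * gen (tk \<delta> k)) = z y" using const by blast
    then have "R k z y = q * z y" using eigen_iff_right[OF z t, of k] by blast
    then show "(R k z - hscale q z) y = 0" by (simp add: hscale_apply)
  qed (use a b in auto)
  moreover have "L k z - hscale q z = 0" if k: "k \<in> M" for k
  proof (rule V_determined[of a b])
    show "L k z - hscale q z \<in> V b a"
      using z k M by (intro V_diff V_L V_scale) auto
    fix y assume y: "y \<in> Yset r b a"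
    then obtain \<epsilon> \<delta> where t: "tri b a \<epsilon> \<delta> y" by (auto simp: Yset_def)
    then have "(y, gen (tk \<epsilon> k) * y) \<in> orbit_step r b M a J" using y k unfolding orbit_step_def by blast
    then have "z (gen (tk \<epsilon> k) * y) = z y" using const by blast
    then have "L k z y = q * z y" using eigen_iff_left[OF z t, of k] by blast
    then show "(L k z - hscale q z) y = 0" by (simp add: hscale_apply)
  qed (use a b in auto)
  ultimately show "z \<in> Cset b M a J" using z by (simp add: Cset_def)
qed

lemma Cset_orbit_rep:
  assumes a: "a = 0 \<or> 2 \<le> a" "a \<le> r" and b: "b = 0 \<or> 2 \<le> b" "b \<le> r"
    and J: "J \<subseteq> {1..<r} - {a}" and M: "M \<subseteq> {1..<r} - {b}" and z: "z \<in> Cset b M a J"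
  shows "z (orbit_rep r b M a J y) = z y"
proof -
  have zV: "z \<in> V b a" using z by (simp add: Cset_def)
  have "z t = z y" if "(y, t) \<in> orbit_rel r b M a J" for t
    using that unfolding orbit_rel_def
  proof (induction rule: rtrancl_induct)
    case (step s t)
    then show ?case using z Cset_iff[OF a b J M zV] by force
  qed simp
  then show ?thesis using orbit_rep_rel by blast
qed

theorem Cset_determined:
  assumes a: "a = 0 \<or> 2 \<le> a" "a \<le> r" and b: "b = 0 \<or> 2 \<le> b" "b \<le> r"
    and J: "J \<subseteq> {1..<r} - {a}" and M: "M \<subseteq> {1..<r} - {b}" and z: "z \<in> Cset b M a J"
    and 0: "\<And>y. y \<in> Yrep r b M a J \<Longrightarrow> z y = 0"
  shows "z = 0"
proof (rule V_determined[of a b])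
  fix y assume "y \<in> Yset r b a"
  then have "z (orbit_rep r b M a J y) = 0" by (intro 0) (simp add: Yrep_def)
  then show "z y = 0" using Cset_orbit_rep[OF a b J M z] by simp
qed (use a b z in \<open>auto simp: Cset_def\<close>)

text \<open>Dual solutions are added up over the points of an orbit. Multiplying by
  \<open>xJ\<close> on both sides instead would bring in stabilisers, whose weights need not be
  units.\<close>

theorem Cset_dual:
  assumes a: "a = 0 \<or> 2 \<le> a" "a \<le> r" and b: "b = 0 \<or> 2 \<le> b" "b \<le> r"
    and J: "J \<subseteq> {1..<r} - {a}" and M: "M \<subseteq> {1..<r} - {b}" and y: "y \<in> Yrep r b M a J"
  shows "\<exists>z\<in>Cset b M a J. \<forall>t\<in>Yrep r b M a J. z t = (if t = y then 1 else 0)"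
proof -
  let ?rep = "orbit_rep r b M a J"
  let ?Y = "Yset r b a"
  define d where "d t = (SOME z. z \<in> W b a \<and> dual_at b a t z)" for t
  have d: "d t \<in> W b a \<and> dual_at b a t (d t)" if "t \<in> ?Y" for t
    unfolding d_def using someI_ex[of "\<lambda>z. z \<in> W b a \<and> dual_at b a t z"] V_dual[OF a b that] by blast
  define z where "z = (\<Sum>t\<in>{t \<in> ?Y. ?rep t = y}. d t)"
  have zV: "z \<in> V b a" unfolding z_def using d by (intro V_sum) (auto simp: W_def)
  have zval: "z s = (if ?rep s = y then 1 else 0)" if "s \<in> ?Y" for s
  proof -
    have "z s = (\<Sum>t\<in>{t \<in> ?Y. ?rep t = y}. if t = s then 1 else 0)"
      unfolding z_def sum_fun_apply using d that by (intro sum.cong) (auto simp: dual_at_def)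
    then show ?thesis using that by (simp add: sum.delta)
  qed
  have "z \<in> Cset b M a J"
    unfolding Cset_iff[OF a b J M zV]
  proof (clarify)
    fix s t assume st: "(s, t) \<in> orbit_step r b M a J"
    then have "(s, t) \<in> orbit_rel r b M a J" unfolding orbit_rel_def by blast
    then have "?rep s = ?rep t" by (rule orbit_rep_eq)
    then show "z t = z s" using zval orbit_step_Yset[OF J M st] by simp
  qed
  moreover have "z t = (if t = y then 1 else 0)" if t: "t \<in> Yrep r b M a J" for t
  proof -
    obtain s where s: "s \<in> ?Y" "t = ?rep s" using t by (auto simp: Yrep_def)
    then have "?rep t = t" using orbit_rep_eq[OF orbit_rep_rel[of s r b M a J]] by simp
    then show ?thesis using zval[of t] Yrep_subset[OF J M] t by auto
  qed
  ultimately show ?thesis by blast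
qed

end

section \<open>Coordinates of endomorphisms\<close>

definition blk :: "nat \<Rightarrow> bicomp \<Rightarrow> nat set" where
  "blk r l = {1..<r} - (\<lambda>k. sum_list (take k (fst l @ snd l))) ` {..length (fst l @ snd l)}"

abbreviation am :: "bicomp \<Rightarrow> nat" where
  "am l \<equiv> sum_list (fst l)"

definition inj_fam :: "bicomp \<Rightarrow> (int perm \<Rightarrow> 'a::comm_ring_1) \<Rightarrow> 'a family" where
  "inj_fam l v = (\<lambda>k. if k = l then v else 0)"

lemma young_eq: "young r (fst l @ snd l) = yg (blk r l)"
proof -
  have "sgen ` blk r l = gen ` blk r l" by (rule image_cong) (auto simp: blk_def gen_def)
  then show ?thesis by (simp add: young_def yg_def blk_def)
qed

lemma xbar_eq: "xbar r l = xJ (blk r l)"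
  by (simp add: xbar_def xJ_def young_eq)

lemma finite_compositions: "finite (compositions m k)"
proof (rule finite_subset)
  show "compositions m k \<subseteq> {xs. set xs \<subseteq> {..k} \<and> length xs = m}"
    using member_le_sum_list by (fastforce simp: compositions_def)
qed (rule finite_lists_length_eq, simp)

lemma finite_Pi15: "finite (Pi15 n r)"
proof -
  have "finite {(r1, r2). r1 + r2 = r}"
    by (rule finite_subset[of _ "{..r} \<times> {..r}"]) auto
  then have "finite (Pi2 n r)"
    unfolding Pi2_def by (intro finite_UN_I) (auto simp: finite_compositions)
  then show ?thesis unfolding Pi15_def by (rule finite_subset[rotated]) auto
qed

lemma Pi15_am:
  assumes "4 \<le> r" "l \<in> Pi15 n r"
  shows "am l = 0 \<or> 2 \<le> am l" "2 \<le> am l" "am l \<le> r" "blk r l \<subseteq> {1..<r} - {am l}"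
proof -
  have "am l + sum_list (snd l) = r" "sum_list (snd l) \<le> am l"
    using assms(2) by (auto simp: Pi15_def Pi2_def compositions_def)
  then show "2 \<le> am l" "am l \<le> r" using assms(1) by auto
  then show "am l = 0 \<or> 2 \<le> am l" by simp
  have "am l \<in> (\<lambda>k. sum_list (take k (fst l @ snd l))) ` {..length (fst l @ snd l)}"
    by (rule image_eqI[of _ _ "length (fst l)"]) auto
  then show "blk r l \<subseteq> {1..<r} - {am l}" by (auto simp: blk_def)
qed

definition coord_index :: "nat \<Rightarrow> nat \<Rightarrow> (bicomp \<times> bicomp \<times> int perm) set" where
  "coord_index n r = (SIGMA l:Pi15 n r. SIGMA m:Pi15 n r. Yrep r (am m) (blk r m) (am l) (blk r l))"

definition coord :: "nat \<Rightarrow> 'a::comm_ring_1 \<Rightarrow> 'a endo \<Rightarrow> bicomp \<times> bicomp \<times> int perm \<Rightarrow> 'a" where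
  "coord r q F = (\<lambda>(l, m, y). F (inj_fam l (xcheck r q l)) m y)"

lemma fam_scale_apply: "fam_scale c v l = hscale c (v l)"
  by (simp add: fam_scale_def)

lemma fam_act_apply: "fam_act r q v h l = hmult r q (v l) h"
  by (simp add: fam_act_def)

section \<open>Factorisation of solutions, and homomorphisms as solutions\<close>

context hecke_D_unit
begin

lemma mul_fold_R:
  assumes "g \<in> H" "h \<in> H" "ws \<in> lists {..<r}"
  shows "fold R ws (g \<bullet> h) = g \<bullet> fold R ws h"
  using assms(2,3)
proof (induction ws arbitrary: h)
  case (Cons k ws)
  then have "k < r" "R k h \<in> H" by (auto intro: hecke_R)
  then show ?case using Cons mul_R[OF assms(1), of h k] Cons.IH[of "R k h"] by simp
qed simp

lemma PxJ:
  assumes a: "a = 0 \<or> 2 \<le> a" "a \<le> r" and J: "J \<subseteq> {1..<r} - {a}"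
  shows "P a \<bullet> xJ J \<in> H" "star (P a \<bullet> xJ J) = P a \<bullet> xJ J"
    "h \<in> H \<Longrightarrow> KR a (h \<bullet> (P a \<bullet> xJ J))"
    "h \<in> H \<Longrightarrow> k \<in> J \<Longrightarrow> R k (h \<bullet> (P a \<bullet> xJ J)) = hscale q (h \<bullet> (P a \<bullet> xJ J))"
proof -
  have J': "J \<subseteq> {..<r}" using J by auto
  have PH: "P a \<in> H" using a(2) by (rule hecke_P)
  have xH: "xJ J \<in> H" using J' by (rule xJ_hecke)
  have comm: "P a \<bullet> xJ J = xJ J \<bullet> P a" using a(2) J by (rule P_comm_xJ)
  show "P a \<bullet> xJ J \<in> H" using PH by (rule hecke_mul)
  show "star (P a \<bullet> xJ J) = P a \<bullet> xJ J"
    using PH xH a(2) J' by (simp add: star_mul star_P star_xJ comm)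
  show "KR a (h \<bullet> (P a \<bullet> xJ J))" if "h \<in> H"
    using KR_mul_P[OF a hecke_mul[OF that, of "xJ J"]] that xH PH by (simp add: comm mul_assoc)
  show "R k (h \<bullet> (P a \<bullet> xJ J)) = hscale q (h \<bullet> (P a \<bullet> xJ J))" if "h \<in> H" "k \<in> J"
  proof -
    have k: "k < r" using that J' by auto
    have "R k (h \<bullet> (P a \<bullet> xJ J)) = h \<bullet> (P a \<bullet> R k (xJ J))"
      using k that PH xH hecke_mul[OF PH] by (simp add: mul_R)
    then show ?thesis using R_xJ[OF J' that(2)] by (simp add: mul_scale_right)
  qed
qed

text \<open>The factorisation from the other side, applied to \<open>star z\<close>; the larger
  space \<open>V 0 b\<close> retains only the equations for \<open>b\<close>.\<close>

lemma Cset_left_factor: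
  assumes b: "b = 0 \<or> 2 \<le> b" "b \<le> r" and M: "M \<subseteq> {1..<r} - {b}" and z: "z \<in> Cset b M a J"
  obtains h where "h \<in> H" "z = P b \<bullet> xJ M \<bullet> h"
proof -
  have zV: "z \<in> V b a" and inv: "\<And>k. k \<in> M \<Longrightarrow> L k z = hscale q z" using z by (auto simp: Cset_def)
  have "star z \<in> V 0 b" using V_star[OF zV] by (simp add: V_def KR_def)
  moreover have "R k (star z) = hscale q (star z)" if "k \<in> M" for k
    using inv[OF that] by (metis star_Lop linop_scale[OF linop_star])
  ultimately obtain h where h: "h \<in> H" "star z = h \<bullet> (P b \<bullet> xJ M)"
    using invariant_right[OF b M] by blast
  have "z = star (h \<bullet> (P b \<bullet> xJ M))" using h(2) by (metis star_star)
  also have "\<dots> = P b \<bullet> xJ M \<bullet> star h"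
    using star_mul[OF h(1) PxJ(1)[OF b M]] PxJ(2)[OF b M] by simp
  finally show thesis using that hecke_star[OF h(1)] by blast
qed

lemma Cset_right_factor:
  assumes a: "a = 0 \<or> 2 \<le> a" "a \<le> r" and J: "J \<subseteq> {1..<r} - {a}" and z: "z \<in> Cset b M a J"
  obtains h where "h \<in> H" "z = h \<bullet> (P a \<bullet> xJ J)"
proof -
  have "z \<in> V 0 a" using z by (auto simp: Cset_def V_def KR_def)
  then show thesis using invariant_right[OF a J] z that by (auto simp: Cset_def)
qed

text \<open>Each equation for \<open>a\<close> and \<open>J\<close> says that two right multiples
  coincide, and it holds for the generator \<open>P a \<bullet> xJ J\<close>. By \<open>ann\<close>
  such coincidences pass to \<open>z\<close>. The equations for \<open>b\<close> and
  \<open>M\<close> come from the left factor of \<open>z\<close>.\<close>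

lemma CsetI:
  assumes a: "a = 0 \<or> 2 \<le> a" "a \<le> r" and b: "b = 0 \<or> 2 \<le> b" "b \<le> r"
    and J: "J \<subseteq> {1..<r} - {a}" and M: "M \<subseteq> {1..<r} - {b}"
    and z: "h \<in> H" "z = P b \<bullet> xJ M \<bullet> h"
    and ann: "\<And>g g'. g \<in> H \<Longrightarrow> g' \<in> H \<Longrightarrow> P a \<bullet> xJ J \<bullet> g = P a \<bullet> xJ J \<bullet> g' \<Longrightarrow> z \<bullet> g = z \<bullet> g'"
  shows "z \<in> Cset b M a J"
proof -
  let ?x = "P a \<bullet> xJ J"
  have xH: "?x \<in> H" using PxJ(1)[OF a J] .
  have zH: "z \<in> H" unfolding z(2) using PxJ(1)[OF b M] by (rule hecke_mul)
  have r: "0 < r" "1 < r" using r2 by auto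
  have T1: "hT 1 \<in> H" by (simp add: hecke_hT)
  have "KR a z"
  proof (rule KR_I)
    fix ws assume ws: "a \<noteq> 0" "ws \<in> lists ({..<r} - {a})"
    have ws': "ws \<in> lists {..<r}" using ws by auto
    let ?f = "fold R ws (hT 1)"
    have fH: "?f \<in> H" using T1 ws' by (rule fold_R_hecke)
    have *: "R k (fold R ws y) = y \<bullet> R k ?f" if "k < r" "y \<in> H" for k y
      using mul_fold_R[OF that(2) T1 ws'] mul_R[OF that(2) fH that(1)] by simp
    have "R 0 (fold R ws ?x) = R 1 (fold R ws ?x)"
      using KR_D[OF PxJ(3)[OF a J T1] ws] xH by simp
    then have "z \<bullet> R 0 ?f = z \<bullet> R 1 ?f"
      unfolding *[OF r(1) xH] *[OF r(2) xH] by (intro ann hecke_R r fH)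
    then show "R 0 (fold R ws z) = R 1 (fold R ws z)"
      unfolding *[OF r(1) zH] *[OF r(2) zH] .
  qed
  moreover have "R k z = hscale q z" if "k \<in> J" for k
  proof -
    have k: "k < r" using that J by auto
    have "?x \<bullet> R k (hT 1) = ?x \<bullet> hscale q (hT 1)"
      using PxJ(4)[OF a J T1 that] mul_R[OF xH T1 k] xH by (simp add: mul_scale_right)
    then have "z \<bullet> R k (hT 1) = z \<bullet> hscale q (hT 1)"
      by (intro ann hecke_R k T1 hecke_scale)
    then show ?thesis using mul_R[OF zH T1 k] by (simp add: mul_scale_right)
  qed
  moreover have sz: "star z = star h \<bullet> (P b \<bullet> xJ M)"
    unfolding z(2) using star_mul[OF PxJ(1)[OF b M] z(1)] PxJ(2)[OF b M] by simp
  moreover have "KR b (star z)"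
    unfolding sz using PxJ(3)[OF b M] hecke_star[OF z(1)] by blast
  moreover have "L k z = hscale q z" if "k \<in> M" for k
  proof -
    have "star (L k z) = star (hscale q z)"
      using PxJ(4)[OF b M hecke_star[OF z(1)] that]
      by (simp only: star_Lop sz linop_scale[OF linop_star])
    then show ?thesis by (metis star_star)
  qed
  ultimately show ?thesis using zH by (simp add: Cset_def V_def)
qed

lemma Cset_diff_scale:
  assumes "y \<in> Cset b M a J" "z \<in> Cset b M a J"
  shows "y - z \<in> Cset b M a J"
  using assms
  by (auto simp: Cset_def V_diff linop_diff[OF linop_Rop] linop_diff[OF linop_Lop] hscale_diff)

end

section \<open>The endomorphism algebra and its coordinates\<close>

locale schur = hecke_D_unit r q qi for r and q qi :: "'a::comm_ring_1" +
  fixes n :: nat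
  assumes r4: "4 \<le> r"
begin

abbreviation PI :: "bicomp set" where
  "PI \<equiv> Pi15 n r"

abbreviation X :: "bicomp \<Rightarrow> int perm \<Rightarrow> 'a" where
  "X \<equiv> xcheck r q"

abbreviation M :: "'a family set" where
  "M \<equiv> xsum n r q"

abbreviation E :: "'a endo set" where
  "E \<equiv> endos n r q"

abbreviation C :: "bicomp \<Rightarrow> bicomp \<Rightarrow> (int perm \<Rightarrow> 'a) set" where
  "C m l \<equiv> Cset (am m) (blk r m) (am l) (blk r l)"

abbreviation unit_vec :: "bicomp \<Rightarrow> 'a family" where
  "unit_vec l \<equiv> inj_fam l (X l)"

lemma X_eq: "X l = P (am l) \<bullet> xJ (blk r l)"
  by (simp add: xcheck_def xbar_eq)

lemmas am = Pi15_am[OF r4]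

lemma X_hecke: "l \<in> PI \<Longrightarrow> X l \<in> H"
  unfolding X_eq by (intro PxJ(1) am)

lemma MI: "(\<And>l. l \<in> PI \<Longrightarrow> \<exists>h\<in>H. v l = X l \<bullet> h) \<Longrightarrow> (\<And>l. l \<notin> PI \<Longrightarrow> v l = 0) \<Longrightarrow> v \<in> M"
  unfolding xsum_def by blast

lemma M_D: "v \<in> M \<Longrightarrow> l \<in> PI \<Longrightarrow> \<exists>h\<in>H. v l = X l \<bullet> h" "v \<in> M \<Longrightarrow> l \<notin> PI \<Longrightarrow> v l = 0"
  unfolding xsum_def by blast+

lemma M_hecke: "v \<in> M \<Longrightarrow> v l \<in> H"
  using M_D[of v l] X_hecke hecke_mul by (cases "l \<in> PI") fastforce+

lemma M_zero: "0 \<in> M"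
  by (rule MI) (auto intro!: bexI[of _ 0])

lemma M_add:
  assumes "v \<in> M" "w \<in> M"
  shows "v + w \<in> M"
proof (rule MI)
  fix l assume l: "l \<in> PI"
  obtain g h where "g \<in> H" "h \<in> H" "v l = X l \<bullet> g" "w l = X l \<bullet> h"
    using M_D(1)[OF assms(1) l] M_D(1)[OF assms(2) l] by blast
  then show "\<exists>h\<in>H. (v + w) l = X l \<bullet> h"
    by (intro bexI[of _ "g + h"]) (simp_all only: plus_fun_apply mul_add_right hecke_add)
qed (use assms M_D(2) in \<open>simp only: plus_fun_apply, simp\<close>)

lemma M_scale:
  assumes "v \<in> M"
  shows "fam_scale c v \<in> M"
proof (rule MI)
  fix l assume l: "l \<in> PI"
  obtain g where "g \<in> H" "v l = X l \<bullet> g" using M_D(1)[OF assms l] by blast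
  then show "\<exists>h\<in>H. fam_scale c v l = X l \<bullet> h"
    by (intro bexI[of _ "hscale c g"]) (simp_all only: fam_scale_apply mul_scale_right hecke_scale)
qed (simp only: fam_scale_apply M_D(2)[OF assms] hscale_simps not_False_eq_True)

lemma M_act:
  assumes "v \<in> M" "h \<in> H"
  shows "fam_act r q v h \<in> M"
proof (rule MI)
  fix l assume l: "l \<in> PI"
  obtain g where "g \<in> H" "v l = X l \<bullet> g" using M_D(1)[OF assms(1) l] by blast
  then show "\<exists>k\<in>H. fam_act r q v h l = X l \<bullet> k"
    using X_hecke[OF l] assms(2)
      by (intro bexI[of _ "g \<bullet> h"]) (simp_all add: fam_act_apply mul_assoc hecke_mul)
qed (simp only: fam_act_apply M_D(2)[OF assms(1)] mul_zero_left not_False_eq_True)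

lemma inj_fam_M: "l \<in> PI \<Longrightarrow> h \<in> H \<Longrightarrow> inj_fam l (X l \<bullet> h) \<in> M"
  by (rule MI) (auto simp: inj_fam_def intro: bexI[of _ 0])

lemma unit_vec_M: "l \<in> PI \<Longrightarrow> unit_vec l \<in> M"
  using inj_fam_M[of l "hT 1"] by (simp add: hecke_hT)

lemma act_unit_vec: "fam_act r q (unit_vec l) h = inj_fam l (X l \<bullet> h)"
  by (auto simp: fun_eq_iff fam_act_apply inj_fam_def)

lemma M_expand:
  assumes "v \<in> M"
  shows "v = (\<Sum>l\<in>PI. inj_fam l (v l))"
proof
  fix k
  have "(\<Sum>l\<in>PI. inj_fam l (v l)) k = (\<Sum>l\<in>PI. if l = k then v k else 0)"
    unfolding sum_fun_apply[of _ PI k] by (rule sum.cong) (auto simp: inj_fam_def)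
  also have "\<dots> = v k" using M_D(2)[OF assms] finite_Pi15 by (auto simp: sum.delta)
  finally show "v k = (\<Sum>l\<in>PI. inj_fam l (v l)) k" by simp
qed

lemma E_D:
  assumes "F \<in> E"
  shows "v \<in> M \<Longrightarrow> F v \<in> M" "v \<in> M \<Longrightarrow> w \<in> M \<Longrightarrow> F (v + w) = F v + F w"
    "v \<in> M \<Longrightarrow> h \<in> H \<Longrightarrow> F (fam_act r q v h) = fam_act r q (F v) h" "v \<notin> M \<Longrightarrow> F v = 0"
  using assms unfolding endos_def by blast+

lemma E_zero_arg: "F \<in> E \<Longrightarrow> F 0 = 0"
  using E_D(2)[of F 0 0] M_zero by (metis add_cancel_right_left add_0)

lemma E_sum_arg: "F \<in> E \<Longrightarrow> (\<And>i. i \<in> A \<Longrightarrow> f i \<in> M) \<Longrightarrow> (\<Sum>i\<in>A. f i) \<in> M \<and> F (\<Sum>i\<in>A. f i) = (\<Sum>i\<in>A. F (f i))"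
proof (induction A rule: infinite_finite_induct)
  case (insert x A)
  then have "f x \<in> M" "sum f A \<in> M" "F (sum f A) = (\<Sum>i\<in>A. F (f i))" by blast+
  then show ?case
    unfolding sum.insert[OF insert.hyps] using E_D(2)[OF insert.prems(1)] M_add by metis
qed (simp_all only: sum.infinite sum.empty E_zero_arg M_zero simp_thms)

lemma E_scale_arg:
  assumes F: "F \<in> E" and v: "v \<in> M"
  shows "F (fam_scale c v) = fam_scale c (F v)"
proof -
  have "fam_act r q w (hscale c (hT 1)) = fam_scale c w" for w :: "'a family"
    by (rule ext) (simp only: fam_act_apply fam_scale_apply mul_scale_right mul_one_right)
  then show ?thesis using E_D(3)[OF F v, of "hscale c (hT 1)"] by (simp add: hecke_scale hecke_hT)
qed

lemma E_eqI:
  assumes F: "F \<in> E" "G \<in> E" and eq: "\<And>l. l \<in> PI \<Longrightarrow> F (unit_vec l) = G (unit_vec l)"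
  shows "F = G"
proof
  fix v
  show "F v = G v"
  proof (cases "v \<in> M")
    case True
    have "inj_fam l (v l) \<in> M \<and> F (inj_fam l (v l)) = G (inj_fam l (v l))" if l: "l \<in> PI" for l
    proof -
      obtain h where h: "h \<in> H" "v l = X l \<bullet> h" using M_D(1)[OF True l] by blast
      have "F (fam_act r q (unit_vec l) h) = G (fam_act r q (unit_vec l) h)"
        using E_D(3)[OF F(1) unit_vec_M[OF l] h(1)] E_D(3)[OF F(2) unit_vec_M[OF l] h(1)] eq[OF l]
          by simp
      then show ?thesis using inj_fam_M[OF l h(1)] by (simp add: act_unit_vec h(2))
    qed
    then have "F (\<Sum>l\<in>PI. inj_fam l (v l)) = G (\<Sum>l\<in>PI. inj_fam l (v l))"
      using E_sum_arg[OF F(1), of PI "\<lambda>l. inj_fam l (v l)"] E_sum_arg[OF F(2), of PI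
        "\<lambda>l. inj_fam l (v l)"]
      by (metis (mono_tags, lifting) sum.cong)
    then show ?thesis using M_expand[OF True] by metis
  next
    case False
    then show ?thesis using E_D(4) F by metis
  qed
qed

lemma fam_act_add: "fam_act r q (v + w) h = fam_act r q v h + fam_act r q w h"
  by (rule ext) (simp only: fam_act_apply plus_fun_apply mul_add_left)

lemma fam_act_scale: "fam_act r q (fam_scale c v) h = fam_scale c (fam_act r q v h)"
  by (rule ext) (simp only: fam_act_apply fam_scale_apply mul_scale_left)

lemma fam_scale_add: "fam_scale c (v + w) = fam_scale c v + fam_scale c w"
  for v w :: "'a family"
  by (rule ext) (simp only: fam_scale_apply plus_fun_apply hscale_add)

lemma fam_scale_zero: "fam_scale c 0 = (0 :: 'a family)"
  by (rule ext) (simp add: fam_scale_apply)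

lemma fam_act_zero: "fam_act r q 0 h = 0"
  by (rule ext) (simp add: fam_act_apply)

lemma E_zero: "0 \<in> E"
  unfolding endos_def using M_zero fam_act_zero
  by (simp only: mem_Collect_eq zero_fun_apply[of "_ :: 'a family"] add_0) simp

lemma E_add:
  assumes F: "F \<in> E" "G \<in> E"
  shows "F + G \<in> E"
proof -
  have app: "(F + G) v = F v + G v" for v by (rule plus_fun_apply)
  have "(F + G) v \<in> M" if "v \<in> M" for v
    unfolding app using E_D(1)[OF F(1) that] E_D(1)[OF F(2) that] by (rule M_add)
  moreover have "(F + G) (v + w) = (F + G) v + (F + G) w" if "v \<in> M" "w \<in> M" for v w
    unfolding app E_D(2)[OF F(1) that] E_D(2)[OF F(2) that] by (simp only: add_ac)
  moreover have "(F + G) (fam_act r q v h) = fam_act r q ((F + G) v) h" if "v \<in> M" "h \<in> H" for v h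
    unfolding app E_D(3)[OF F(1) that] E_D(3)[OF F(2) that] fam_act_add ..
  moreover have "(F + G) v = 0" if "v \<notin> M" for v
    unfolding app E_D(4)[OF F(1) that] E_D(4)[OF F(2) that] by (simp only: add_0)
  ultimately show ?thesis unfolding endos_def by blast
qed

lemma E_scale:
  assumes F: "F \<in> E"
  shows "endo_scale c F \<in> E"
proof -
  have app: "endo_scale c F v = fam_scale c (F v)" for v by (simp only: endo_scale_def)
  have "endo_scale c F v \<in> M" if "v \<in> M" for v
    unfolding app using E_D(1)[OF F that] by (rule M_scale)
  moreover have "endo_scale c F (v + w) = endo_scale c F v + endo_scale c F w" if "v \<in> M" "w \<in> M"
    for v w
    unfolding app E_D(2)[OF F that] by (rule fam_scale_add)
  moreover have "endo_scale c F (fam_act r q v h) = fam_act r q (endo_scale c F v) h" if "v \<in> M" "h \<in> H"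
    for v h
    unfolding app E_D(3)[OF F that] fam_act_scale ..
  moreover have "endo_scale c F v = 0" if "v \<notin> M" for v
    unfolding app E_D(4)[OF F that] by (rule fam_scale_zero)
  ultimately show ?thesis unfolding endos_def by blast
qed

lemma E_sum: "(\<And>i. i \<in> A \<Longrightarrow> f i \<in> E) \<Longrightarrow> (\<Sum>i\<in>A. f i) \<in> E"
proof (induction A rule: infinite_finite_induct)
  case (insert x A)
  then have "f x \<in> E" "sum f A \<in> E" by blast+
  then show ?case unfolding sum.insert[OF insert.hyps] by (rule E_add)
qed (simp_all only: sum.infinite sum.empty E_zero simp_thms)

lemma E_comp:
  assumes F: "F \<in> E" "G \<in> E"
  shows "F \<circ> G \<in> E"
proof -
  have "F (G v) = 0" if "v \<notin> M" for v
    unfolding E_D(4)[OF F(2) that] by (rule E_zero_arg[OF F(1)])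
  then show ?thesis
    unfolding endos_def mem_Collect_eq o_apply
    by (intro conjI ballI allI impI) (simp_all only: E_D(1-3)[OF F(1)] E_D(1-3)[OF F(2)])
qed

lemma E_one: "(\<lambda>v. if v \<in> M then v else 0) \<in> E"
  unfolding endos_def mem_Collect_eq
  by (intro conjI ballI allI impI) (simp_all only: M_add M_act if_True if_False)

lemma E_value_C:
  assumes F: "F \<in> E" and l: "l \<in> PI" and m: "m \<in> PI"
  shows "F (unit_vec l) m \<in> C m l"
proof -
  have uM: "unit_vec l \<in> M" using l by (rule unit_vec_M)
  obtain h where h: "h \<in> H" "F (unit_vec l) m = X m \<bullet> h"
    using M_D(1)[OF E_D(1)[OF F uM] m] by blast
  show ?thesis
  proof (rule CsetI[OF am(1,3)[OF l] am(1,3)[OF m] am(4)[OF l] am(4)[OF m] h(1) h(2)[unfolded X_eq[of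
    m]]])
    fix g g' assume g: "g \<in> H" "g' \<in> H" "P (am l) \<bullet> xJ (blk r l) \<bullet> g = P (am l) \<bullet> xJ (blk r l) \<bullet> g'"
    have "fam_act r q (unit_vec l) g = fam_act r q (unit_vec l) g'"
      unfolding act_unit_vec using g(3) by (simp add: X_eq)
    then have "fam_act r q (F (unit_vec l)) g = fam_act r q (F (unit_vec l)) g'"
      using E_D(3)[OF F uM] g by metis
    then show "F (unit_vec l) m \<bullet> g = F (unit_vec l) m \<bullet> g'"
      by (metis fam_act_apply)
  qed
qed

definition hom_of :: "bicomp \<Rightarrow> bicomp \<Rightarrow> (int perm \<Rightarrow> 'a) \<Rightarrow> 'a endo" where
  "hom_of l m g = (\<lambda>v. if v \<in> M then inj_fam m (g \<bullet> v l) else 0)"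

text \<open>The left factorisation of \<open>g \<bullet> X l\<close> puts the image into the summand
  generated by \<open>X m\<close>; compatibility with the action is associativity.\<close>

lemma hom_of_E:
  assumes l: "l \<in> PI" and m: "m \<in> PI" and g: "g \<in> H" and C: "g \<bullet> X l \<in> C m l"
  shows "hom_of l m g \<in> E"
proof -
  obtain k where k: "k \<in> H" "g \<bullet> X l = X m \<bullet> k"
    using Cset_left_factor[OF am(1,3)[OF m] am(4)[OF m] C] unfolding X_eq by blast
  have "inj_fam m (g \<bullet> v l) \<in> M" if v: "v \<in> M" for v
  proof -
    obtain h where h: "h \<in> H" "v l = X l \<bullet> h" using M_D(1)[OF v l] by blast
    have "g \<bullet> v l = X m \<bullet> k \<bullet> h" unfolding h(2) k(2)[symmetric] using g X_hecke[OF l] h(1)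
      by (simp add: mul_assoc)
    also have "\<dots> = X m \<bullet> (k \<bullet> h)" using X_hecke[OF m] k(1) h(1) by (simp add: mul_assoc)
    finally show ?thesis using inj_fam_M[OF m hecke_mul[OF k(1), of h]] by simp
  qed
  moreover have "inj_fam m (g \<bullet> (v + w) l) = inj_fam m (g \<bullet> v l) + inj_fam m (g \<bullet> w l)" for v w
  proof (rule ext)
    fix j
    show "inj_fam m (g \<bullet> (v + w) l) j = (inj_fam m (g \<bullet> v l) + inj_fam m (g \<bullet> w l)) j"
      unfolding plus_fun_apply[of "inj_fam m (g \<bullet> v l)"] plus_fun_apply[of v]
      by (cases "j = m") (simp_all only: inj_fam_def simp_thms if_True if_False mul_add_right add_0)
  qed
  moreover have "inj_fam m (g \<bullet> fam_act r q v h l) = fam_act r q (inj_fam m (g \<bullet> v l)) h"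
    if "v \<in> M" "h \<in> H" for v h
    using g M_hecke[OF that(1), of l] that(2)
      by (auto simp: fun_eq_iff inj_fam_def fam_act_apply mul_assoc)
  ultimately show ?thesis
    unfolding endos_def hom_of_def mem_Collect_eq
    by (intro conjI ballI allI impI) (simp_all only: M_add M_act if_True if_False)
qed

lemma coord_add: "coord r q (F + G) i = coord r q F i + coord r q G i"
  by (cases i) (simp only: coord_def prod.case plus_fun_apply)

lemma coord_scale: "coord r q (endo_scale c F) i = c * coord r q F i"
  by (cases i) (simp only: coord_def prod.case endo_scale_def fam_scale_def hscale_def)

lemma coord_zero: "coord r q 0 i = 0"
  by (cases i) (simp only: coord_def prod.case zero_fun_apply)

lemma coord_sum: "coord r q (\<Sum>j\<in>A. f j) i = (\<Sum>j\<in>A. coord r q (f j) i)"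
  by (induction A rule: infinite_finite_induct)
    (simp_all only: sum.infinite sum.empty coord_zero sum.insert coord_add simp_thms)

lemma finite_coord_index: "finite (coord_index n r)"
proof -
  have "finite (Yrep r b A a J)" for b A a J unfolding Yrep_def by simp
  then show ?thesis unfolding coord_index_def using finite_Pi15 by (intro finite_SigmaI) auto
qed

lemma coord_eqI:
  assumes F: "F \<in> E" "G \<in> E" and eq: "\<And>i. i \<in> coord_index n r \<Longrightarrow> coord r q F i = coord r q G i"
  shows "F = G"
proof (rule E_eqI[OF F])
  fix l assume l: "l \<in> PI"
  show "F (unit_vec l) = G (unit_vec l)"
  proof
    fix m
    show "F (unit_vec l) m = G (unit_vec l) m"
    proof (cases "m \<in> PI")
      case True
      have "F (unit_vec l) m - G (unit_vec l) m = 0"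
      proof (rule Cset_determined[OF am(1,3)[OF l] am(1,3)[OF True] am(4)[OF l] am(4)[OF True]])
        show "F (unit_vec l) m - G (unit_vec l) m \<in> C m l"
          using E_value_C[OF F(1) l True] E_value_C[OF F(2) l True] by (rule Cset_diff_scale)
        fix y assume "y \<in> Yrep r (am m) (blk r m) (am l) (blk r l)"
        then have "(l, m, y) \<in> coord_index n r" using l True by (simp add: coord_index_def)
        then show "(F (unit_vec l) m - G (unit_vec l) m) y = 0"
          using eq by (fastforce simp: coord_def)
      qed
      then show ?thesis by (simp only: right_minus_eq)
    next
      case False
      then show ?thesis
        using M_D(2)[OF E_D(1)[OF F(1) unit_vec_M[OF l]] False] M_D(2)[OF E_D(1)[OF F(2) unit_vec_M[OF
          l]] False]
        by (simp only:)
    qed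
  qed
qed

text \<open>The multiplier \<open>g\<close> is a choice, but \<open>g \<bullet> X l\<close> is
  determined by its values on the representatives, and with it the endomorphism.\<close>

definition base :: "bicomp \<times> bicomp \<times> int perm \<Rightarrow> 'a endo" where
  "base = (\<lambda>(l, m, y). hom_of l m (SOME g. g \<in> H \<and> g \<bullet> X l \<in> C m l \<and>
     (\<forall>t\<in>Yrep r (am m) (blk r m) (am l) (blk r l). (g \<bullet> X l) t = (if t = y then 1 else 0))))"

lemma base_props:
  assumes "l \<in> PI" "m \<in> PI" "y \<in> Yrep r (am m) (blk r m) (am l) (blk r l)"
  obtains g where "base (l, m, y) = hom_of l m g" "g \<in> H" "g \<bullet> X l \<in> C m l"
    "\<And>t. t \<in> Yrep r (am m) (blk r m) (am l) (blk r l) \<Longrightarrow> (g \<bullet> X l) t = (if t = y then 1 else 0)"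
proof -
  let ?Q = "\<lambda>g. g \<in> H \<and> g \<bullet> X l \<in> C m l \<and>
     (\<forall>t\<in>Yrep r (am m) (blk r m) (am l) (blk r l). (g \<bullet> X l) t = (if t = y then 1 else 0))"
  obtain z where z: "z \<in> C m l"
    "\<forall>t\<in>Yrep r (am m) (blk r m) (am l) (blk r l). z t = (if t = y then 1 else 0)"
    using Cset_dual[OF am(1,3)[OF assms(1)] am(1,3)[OF assms(2)] am(4)[OF assms(1)] am(4)[OF assms(2)]
      assms(3)]
    by blast
  obtain g where "g \<in> H" "z = g \<bullet> X l"
    using Cset_right_factor[OF am(1,3)[OF assms(1)] am(4)[OF assms(1)] z(1)] unfolding X_eq by blast
  then have "?Q g" using z by blast
  then have "?Q (SOME g. ?Q g)" by (rule someI[where P = ?Q])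
  moreover have "base (l, m, y) = hom_of l m (SOME g. ?Q g)" by (simp only: base_def prod.case)
  ultimately show thesis using that by blast
qed

lemma base_E:
  assumes "i \<in> coord_index n r"
  shows "base i \<in> E"
proof -
  obtain l m y where i: "i = (l, m, y)" "l \<in> PI" "m \<in> PI" "y \<in> Yrep r (am m) (blk r m) (am l) (blk r l)"
    using assms unfolding coord_index_def by blast
  obtain g where "base (l, m, y) = hom_of l m g" "g \<in> H" "g \<bullet> X l \<in> C m l" using i(2-4)
    by (rule base_props)
  then show ?thesis using hom_of_E[OF i(2,3)] i(1) by simp
qed

lemma coord_base:
  assumes i: "i \<in> coord_index n r" and j: "j \<in> coord_index n r"
  shows "coord r q (base i) j = (if j = i then 1 else 0)"
proof -
  obtain l m y where i: "i = (l, m, y)" "l \<in> PI" "m \<in> PI" "y \<in> Yrep r (am m) (blk r m) (am l) (blk r l)"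
    using i unfolding coord_index_def by blast
  obtain l' m' t where j: "j = (l', m', t)" "l' \<in> PI" "m' \<in> PI"
    "t \<in> Yrep r (am m') (blk r m') (am l') (blk r l')"
    using j unfolding coord_index_def by blast
  obtain g where g: "base (l, m, y) = hom_of l m g" "g \<in> H"
    "\<And>t. t \<in> Yrep r (am m) (blk r m) (am l) (blk r l) \<Longrightarrow> (g \<bullet> X l) t = (if t = y then 1 else 0)"
    using i(2-4) by (rule base_props) blast
  have "coord r q (base i) j = inj_fam m (g \<bullet> inj_fam l' (X l') l) m' t"
    using unit_vec_M[OF j(2)] by (simp add: coord_def i(1) j(1) g(1) hom_of_def)
  then show ?thesis
    using i j g(3)[of t] by (auto simp: inj_fam_def)
qed

lemma coord_expand:
  assumes F: "F \<in> E"
  shows "F = (\<Sum>i\<in>coord_index n r. endo_scale (coord r q F i) (base i))"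
proof (rule coord_eqI[OF F])
  show "(\<Sum>i\<in>coord_index n r. endo_scale (coord r q F i) (base i)) \<in> E"
    by (intro E_sum E_scale base_E)
  fix j assume j: "j \<in> coord_index n r"
  have "coord r q (\<Sum>i\<in>coord_index n r. endo_scale (coord r q F i) (base i)) j
    = (\<Sum>i\<in>coord_index n r. if i = j then coord r q F i else 0)"
    unfolding coord_sum coord_scale using coord_base j by (intro sum.cong) auto
  then show "coord r q F j = coord r q (\<Sum>i\<in>coord_index n r. endo_scale (coord r q F i) (base i)) j"
    using j finite_coord_index by (simp add: sum.delta)
qed

lemma coord_comb:
  assumes j: "j \<in> coord_index n r"
  shows "coord r q (\<Sum>i\<in>coord_index n r. endo_scale (c i) (base i)) j = c j"
proof -
  have "coord r q (\<Sum>i\<in>coord_index n r. endo_scale (c i) (base i)) j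
    = (\<Sum>i\<in>coord_index n r. if i = j then c i else 0)"
    unfolding coord_sum coord_scale using coord_base j by (intro sum.cong) auto
  then show ?thesis using j finite_coord_index by (simp add: sum.delta)
qed

theorem E_free:
  "\<exists>B. \<not> Modules.module.dependent (endo_scale :: 'a \<Rightarrow> 'a endo \<Rightarrow> 'a endo) B \<and>
    Modules.module.span endo_scale B = E"
proof (intro exI conjI)
  interpret mod: Modules.module "endo_scale :: 'a \<Rightarrow> 'a endo \<Rightarrow> 'a endo" by (rule module_endo_scale)
  let ?I = "coord_index n r"
  \<comment> \<open>Independence concerns the set of basis elements, so different indices have to
    give different elements.\<close>
  have inj: "inj_on base ?I"
  proof (rule inj_onI)
    fix i j assume ij: "i \<in> ?I" "j \<in> ?I" "base i = base j"
    then show "i = j" using coord_base[of i i] coord_base[of j i] by (auto split: if_splits)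
  qed
  have sub: "mod.subspace E"
    by (rule mod.subspaceI) (auto intro: E_zero E_add E_scale simp del: plus_fun_apply zero_fun_apply)
  show "mod.span (base ` ?I) = E"
  proof
    show "mod.span (base ` ?I) \<subseteq> E"
      using sub base_E by (intro mod.span_minimal) auto
    show "E \<subseteq> mod.span (base ` ?I)"
    proof
      fix F assume "F \<in> E"
      then have "F = (\<Sum>i\<in>?I. endo_scale (coord r q F i) (base i))" by (rule coord_expand)
      also have "\<dots> \<in> mod.span (base ` ?I)"
        by (intro mod.span_sum mod.span_scale mod.span_base imageI)
      finally show "F \<in> mod.span (base ` ?I)" .
    qed
  qed
  show "\<not> mod.dependent (base ` ?I)"
    unfolding mod.dependent_finite[OF finite_imageI[OF finite_coord_index]]
  proof (clarify)
    fix u i assume i: "i \<in> ?I" "u (base i) \<noteq> 0"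
      and u: "(\<Sum>v\<in>base ` ?I. endo_scale (u v) v) = 0"
    have "(\<Sum>j\<in>?I. endo_scale (u (base j)) (base j)) = 0"
      using u unfolding sum.reindex[OF inj] o_def .
    then have "coord r q (\<Sum>j\<in>?I. endo_scale (u (base j)) (base j)) i = 0"
      by (simp only: coord_zero)
    then show False using i coord_comb[OF i(1), of "\<lambda>j. u (base j)"] by simp
  qed
qed

end

section \<open>Base change\<close>

definition frag_eval :: "('b \<Rightarrow> 'a::comm_ring_1) \<Rightarrow> ('b \<Rightarrow>\<^sub>0 int) \<Rightarrow> 'a" where
  "frag_eval f Z = (\<Sum>p\<in>Poly_Mapping.keys Z. of_int (Poly_Mapping.lookup Z p) * f p)"

lemma frag_eval_superset:
  assumes "finite A" "Poly_Mapping.keys Z \<subseteq> A"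
  shows "frag_eval f Z = (\<Sum>p\<in>A. of_int (Poly_Mapping.lookup Z p) * f p)"
  unfolding frag_eval_def using assms by (intro sum.mono_neutral_left) (auto simp: in_keys_iff)

lemma frag_eval_zero [simp]: "frag_eval f 0 = 0"
  by (simp add: frag_eval_def)

lemma frag_eval_of [simp]: "frag_eval f (frag_of p) = f p"
  by (simp add: frag_eval_def keys_frag_of)

lemma frag_eval_diff: "frag_eval f (Y - Z) = frag_eval f Y - frag_eval f Z"
proof -
  let ?A = "Poly_Mapping.keys Y \<union> Poly_Mapping.keys Z"
  have "Poly_Mapping.keys (Y - Z) \<subseteq> ?A" by (rule keys_diff)
  then show ?thesis
    by (simp add: frag_eval_superset[of ?A] lookup_minus left_diff_distrib sum_subtractf)
qed

lemma frag_eval_add: "frag_eval f (Y + Z) = frag_eval f Y + frag_eval f Z"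
  using frag_eval_diff[of f "Y + Z" Z] by simp

lemma frag_eval_sum: "frag_eval f (\<Sum>i\<in>A. g i) = (\<Sum>i\<in>A. frag_eval f (g i))"
  by (induction A rule: infinite_finite_induct) (auto simp: frag_eval_add)

lemma group_closure_sum:
  "(\<And>i. i \<in> A \<Longrightarrow> f i \<in> group_closure S) \<Longrightarrow> (\<Sum>i\<in>A. f i) \<in> group_closure S"
  by (induction A rule: infinite_finite_induct) (auto intro: group_closure_add)

section \<open>Compatibility of solutions and bases with a ring homomorphism\<close>

locale schur_change = A: schur r q qi n
  for r and q qi :: "'z::comm_ring_1" and n +
  fixes \<phi> :: "'z \<Rightarrow> 'a::comm_ring_1"
  assumes phi_1: "\<phi> 1 = 1" and phi_add: "\<And>x y. \<phi> (x + y) = \<phi> x + \<phi> y"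
    and phi_mult: "\<And>x y. \<phi> (x * y) = \<phi> x * \<phi> y"
begin

sublocale B: schur r "\<phi> q" "\<phi> qi" n
  by unfold_locales (simp_all add: A.r4 A.q_qi phi_1 flip: phi_mult)

lemma phi_0: "\<phi> 0 = 0"
  using phi_add[of 0 0] by simp

lemma phi_diff: "\<phi> (x - y) = \<phi> x - \<phi> y"
  using phi_add[of "x - y" y] by simp

lemma phi_sum: "\<phi> (\<Sum>i\<in>I. f i) = (\<Sum>i\<in>I. \<phi> (f i))"
  by (induction I rule: infinite_finite_induct) (auto simp: phi_0 phi_add)

lemma phi_mul: "\<phi> \<circ> hmult r q g h = hmult r (\<phi> q) (\<phi> \<circ> g) (\<phi> \<circ> h)"
  using phi_1 phi_add phi_mult by (rule hmult_base_change)

lemma phi_R: "\<phi> \<circ> Rop q k f = Rop (\<phi> q) k (\<phi> \<circ> f)"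
  by (auto simp: fun_eq_iff Rop_apply phi_mult phi_add phi_diff phi_1)

lemma phi_star: "\<phi> \<circ> star f = star (\<phi> \<circ> f)"
  by (auto simp: fun_eq_iff star_def)

lemma phi_L: "\<phi> \<circ> Lop q k f = Lop (\<phi> q) k (\<phi> \<circ> f)"
  by (simp add: Lop_def phi_star phi_R)

lemma phi_fold: "\<phi> \<circ> fold (Rop q) ws f = fold (Rop (\<phi> q)) ws (\<phi> \<circ> f)"
  by (induction ws arbitrary: f) (simp_all add: phi_R)

lemma phi_hecke: "f \<in> hecke r \<Longrightarrow> \<phi> \<circ> f \<in> hecke r"
  by (simp add: hecke_def phi_0)

lemma phi_hscale: "\<phi> \<circ> hscale c f = hscale (\<phi> c) (\<phi> \<circ> f)"
  by (auto simp: fun_eq_iff hscale_apply phi_mult)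

lemma phi_hT: "\<phi> \<circ> hT w = hT w"
  by (auto simp: fun_eq_iff hT_apply phi_0 phi_1)

lemma phi_plus: "\<phi> \<circ> (f + g) = (\<phi> \<circ> f) + (\<phi> \<circ> g)" for f g :: "'i \<Rightarrow> 'z"
  by (auto simp: fun_eq_iff phi_add)

lemma phi_power: "\<phi> (q ^ k) = \<phi> q ^ k"
  by (induction k) (simp_all add: phi_1 phi_mult)

lemma phi_hpi: "\<phi> \<circ> hpi r q a = hpi r (\<phi> q) a"
proof -
  have "\<phi> \<circ> foldl (\<lambda>h i. hmult r q h (hscale (q ^ (i - 1)) (hT 1) + hT (uelt i))) h js =
    foldl (\<lambda>h i. hmult r (\<phi> q) h (hscale (\<phi> q ^ (i - 1)) (hT 1) + hT (uelt i))) (\<phi> \<circ> h) js" for h js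
    by (induction js arbitrary: h) (simp_all only: foldl_Nil foldl_Cons phi_mul phi_plus phi_hscale
      phi_hT phi_power)
  then show ?thesis by (simp only: hpi_def phi_hT)
qed

lemma phi_xbar: "\<phi> \<circ> xbar r l = xbar r l"
proof
  fix w show "(\<phi> \<circ> xbar r l) w = xbar r l w"
    by (simp only: xbar_def o_apply sum_fun_apply phi_sum phi_hT[THEN fun_cong, unfolded o_apply])
qed

lemma phi_X: "\<phi> \<circ> A.X l = B.X l"
  by (simp only: xcheck_def phi_mul phi_hpi phi_xbar)

lemma phi_KR:
  assumes "A.KR a z"
  shows "B.KR a (\<phi> \<circ> z)"
proof (rule B.KR_I)
  fix ws assume "a \<noteq> 0" "ws \<in> lists ({..<r} - {a})"
  then have "A.R 0 (fold A.R ws z) = A.R 1 (fold A.R ws z)" using A.KR_D[OF assms] by blast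
  then have "\<phi> \<circ> A.R 0 (fold A.R ws z) = \<phi> \<circ> A.R 1 (fold A.R ws z)" by (rule arg_cong)
  then show "B.R 0 (fold B.R ws (\<phi> \<circ> z)) = B.R 1 (fold B.R ws (\<phi> \<circ> z))"
    by (simp only: phi_R phi_fold)
qed

lemma phi_Cset:
  assumes "z \<in> A.Cset b M a J"
  shows "\<phi> \<circ> z \<in> B.Cset b M a J"
proof -
  have z: "z \<in> hecke r" "A.KR a z" "A.KR b (star z)" "\<forall>k\<in>J. A.R k z = hscale q z"
    "\<forall>k\<in>M. A.L k z = hscale q z"
    using assms by (auto simp: A.Cset_def A.V_def)
  have "B.R k (\<phi> \<circ> z) = hscale (\<phi> q) (\<phi> \<circ> z)" if "k \<in> J" for k
    using z(4) that by (simp flip: phi_R phi_hscale)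
  moreover have "B.L k (\<phi> \<circ> z) = hscale (\<phi> q) (\<phi> \<circ> z)" if "k \<in> M" for k
    using z(5) that by (simp flip: phi_L phi_hscale)
  ultimately show ?thesis
    unfolding B.Cset_def B.V_def
    using phi_hecke[OF z(1)] phi_KR[OF z(2)] phi_KR[OF z(3)] by (simp add: phi_star)
qed

lemma fam_map_apply: "fam_map \<phi> v l = \<phi> \<circ> v l"
  by (simp add: fam_map_def fun_eq_iff)

lemma phi_zero_fun: "\<phi> \<circ> 0 = (0 :: 'i \<Rightarrow> 'a)"
  by (simp add: fun_eq_iff phi_0)

lemma fam_map_M:
  assumes "v \<in> A.M"
  shows "fam_map \<phi> v \<in> B.M"
proof (rule B.MI)
  fix l assume "l \<in> A.PI"
  then obtain h where h: "h \<in> hecke r" "v l = hmult r q (A.X l) h" using A.M_D(1)[OF assms] by blast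
  have "fam_map \<phi> v l = hmult r (\<phi> q) (B.X l) (\<phi> \<circ> h)"
    by (simp only: fam_map_apply h(2) phi_mul phi_X)
  then show "\<exists>h\<in>hecke r. fam_map \<phi> v l = hmult r (\<phi> q) (B.X l) h"
    using phi_hecke[OF h(1)] by blast
next
  fix l assume "l \<notin> A.PI"
  then have "v l = 0" using A.M_D(2)[OF assms] by blast
  then show "fam_map \<phi> v l = 0" by (simp only: fam_map_apply phi_zero_fun)
qed

lemma fam_map_unit_vec: "fam_map \<phi> (A.unit_vec l) = B.unit_vec l"
proof
  fix k show "fam_map \<phi> (A.unit_vec l) k = B.unit_vec l k"
    by (cases "k = l") (simp_all only: fam_map_apply inj_fam_def simp_thms if_True if_False phi_X
      phi_zero_fun)
qed

lemma fam_map_scale: "fam_map \<phi> (fam_scale c v) = fam_scale (\<phi> c) (fam_map \<phi> v)"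
  by (rule ext) (simp only: fam_map_apply fam_scale_apply phi_hscale)

text \<open>Over the new ring the image of \<open>g \<bullet> X l\<close> and the chosen
  \<open>g' \<bullet> X l\<close> are solutions with the same coordinates, hence equal. The
  multipliers themselves, being choices, need not correspond.\<close>

lemma fam_map_base:
  assumes v: "v \<in> A.M" and i: "i \<in> coord_index n r"
  shows "fam_map \<phi> (A.base i v) = B.base i (fam_map \<phi> v)"
proof -
  obtain l m y where i: "i = (l, m, y)" "l \<in> A.PI" "m \<in> A.PI"
    "y \<in> Yrep r (am m) (blk r m) (am l) (blk r l)"
    using i unfolding coord_index_def by blast
  let ?Y = "Yrep r (am m) (blk r m) (am l) (blk r l)"
  obtain g where g: "A.base (l, m, y) = A.hom_of l m g" "g \<in> hecke r" "hmult r q g (A.X l) \<in> A.C m l"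
    "\<And>t. t \<in> ?Y \<Longrightarrow> hmult r q g (A.X l) t = (if t = y then 1 else 0)"
    using i(2-4) by (rule A.base_props) blast
  obtain g' where g': "B.base (l, m, y) = B.hom_of l m g'" "g' \<in> hecke r"
    "hmult r (\<phi> q) g' (B.X l) \<in> B.C m l"
    "\<And>t. t \<in> ?Y \<Longrightarrow> hmult r (\<phi> q) g' (B.X l) t = (if t = y then 1 else 0)"
    using i(2-4) by (rule B.base_props) blast
  have eq: "hmult r (\<phi> q) (\<phi> \<circ> g) (B.X l) = hmult r (\<phi> q) g' (B.X l)"
  proof -
    have "\<phi> \<circ> hmult r q g (A.X l) \<in> B.C m l" using g(3) by (rule phi_Cset)
    then have "(\<phi> \<circ> hmult r q g (A.X l)) - hmult r (\<phi> q) g' (B.X l) \<in> B.C m l"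
      using g'(3) by (rule B.Cset_diff_scale)
    then have "(\<phi> \<circ> hmult r q g (A.X l)) - hmult r (\<phi> q) g' (B.X l) = 0"
    proof (rule B.Cset_determined[rotated -2])
      fix t assume "t \<in> ?Y"
      then show "((\<phi> \<circ> hmult r q g (A.X l)) - hmult r (\<phi> q) g' (B.X l)) t = 0"
        using g(4) g'(4) phi_0 phi_1 by simp
    qed (use B.am i in auto)
    then show ?thesis by (simp only: right_minus_eq phi_mul phi_X)
  qed
  obtain h where h: "h \<in> hecke r" "v l = hmult r q (A.X l) h" using A.M_D(1)[OF v i(2)] by blast
  have "\<phi> \<circ> hmult r q g (v l) = hmult r (\<phi> q) (\<phi> \<circ> g) (hmult r (\<phi> q) (B.X l) (\<phi> \<circ> h))"
    by (simp only: h(2) phi_mul phi_X)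
  also have "\<dots> = hmult r (\<phi> q) (hmult r (\<phi> q) g' (B.X l)) (\<phi> \<circ> h)"
    using B.mul_assoc[OF phi_hecke[OF g(2)] B.X_hecke[OF i(2)] phi_hecke[OF h(1)]] eq by simp
  also have "\<dots> = hmult r (\<phi> q) g' (\<phi> \<circ> v l)"
    using B.mul_assoc[OF g'(2) B.X_hecke[OF i(2)] phi_hecke[OF h(1)]] by (simp only: h(2) phi_mul phi_X)
  finally have *: "\<phi> \<circ> hmult r q g (v l) = hmult r (\<phi> q) g' (\<phi> \<circ> v l)" .
  show ?thesis
  proof
    fix k
    show "fam_map \<phi> (A.base i v) k = B.base i (fam_map \<phi> v) k"
      unfolding i(1) g(1) g'(1) A.hom_of_def B.hom_of_def
      using v fam_map_M[OF v]
      by (cases "k = m") (simp_all only: if_True simp_thms fam_map_apply inj_fam_def if_False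
        phi_zero_fun *)
  qed
qed

text \<open>Given by coordinates rather than by transport along \<open>fam_map\<close>, which need
  not reach all families over the new ring.\<close>

definition change :: "'z endo \<Rightarrow> 'a endo" where
  "change F = (\<Sum>i\<in>coord_index n r. endo_scale (\<phi> (coord r q F i)) (B.base i))"

lemma change_E: "change F \<in> B.E"
  unfolding change_def by (intro B.E_sum B.E_scale B.base_E)

lemma coord_change: "i \<in> coord_index n r \<Longrightarrow> coord r (\<phi> q) (change F) i = \<phi> (coord r q F i)"
  unfolding change_def by (rule B.coord_comb)

lemma fam_map_sum: "fam_map \<phi> (\<Sum>i\<in>I. f i) = (\<Sum>i\<in>I. fam_map \<phi> (f i))"
  by (rule ext, rule ext) (simp only: fam_map_def sum_fun_apply phi_sum)

text \<open>As the generators lie in the image of \<open>fam_map\<close>, this formula characterises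
  \<open>change F\<close>. Multiplicativity follows from it without computing structure
  constants.\<close>

lemma change_fam_map:
  assumes F: "F \<in> A.E" and v: "v \<in> A.M"
  shows "change F (fam_map \<phi> v) = fam_map \<phi> (F v)"
proof -
  have "F v = (\<Sum>i\<in>coord_index n r. endo_scale (coord r q F i) (A.base i)) v"
    using A.coord_expand[OF F] by (rule fun_cong)
  then have "F v = (\<Sum>i\<in>coord_index n r. fam_scale (coord r q F i) (A.base i v))"
    by (simp only: sum_fun_apply endo_scale_def)
  then have "fam_map \<phi> (F v) = (\<Sum>i\<in>coord_index n r. fam_scale (\<phi> (coord r q F i)) (fam_map \<phi> (A.base i
    v)))"
    by (simp only: fam_map_sum fam_map_scale)
  also have "\<dots> = (\<Sum>i\<in>coord_index n r. fam_scale (\<phi> (coord r q F i)) (B.base i (fam_map \<phi> v)))"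
    by (rule sum.cong[OF refl]) (simp only: fam_map_base[OF v])
  also have "\<dots> = change F (fam_map \<phi> v)"
    by (simp only: change_def sum_fun_apply endo_scale_def)
  finally show ?thesis by simp
qed

lemma change_comp:
  assumes F: "F \<in> A.E" and G: "G \<in> A.E"
  shows "change (F \<circ> G) = change F \<circ> change G"
proof (rule B.E_eqI)
  show "change (F \<circ> G) \<in> B.E" "change F \<circ> change G \<in> B.E"
    by (intro change_E B.E_comp)+
  fix l assume "l \<in> B.PI"
  then have u: "A.unit_vec l \<in> A.M" by (rule A.unit_vec_M)
  show "change (F \<circ> G) (B.unit_vec l) = (change F \<circ> change G) (B.unit_vec l)"
    unfolding fam_map_unit_vec[symmetric] o_apply change_fam_map[OF G u]
      change_fam_map[OF F A.E_D(1)[OF G u]] change_fam_map[OF A.E_comp[OF F G] u] ..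
qed

lemma change_one: "change (\<lambda>v. if v \<in> A.M then v else 0) = (\<lambda>v. if v \<in> B.M then v else 0)"
proof (rule B.E_eqI[OF change_E B.E_one])
  fix l assume l: "l \<in> B.PI"
  have u: "A.unit_vec l \<in> A.M" "B.unit_vec l \<in> B.M" using l A.unit_vec_M B.unit_vec_M by auto
  show "change (\<lambda>v. if v \<in> A.M then v else 0) (B.unit_vec l) = (if B.unit_vec l \<in> B.M then B.unit_vec l
    else 0)"
    unfolding fam_map_unit_vec[symmetric] change_fam_map[OF A.E_one u(1)]
    using u by (simp only: fam_map_unit_vec if_True)
qed

section \<open>The tensor product with the new coefficient ring\<close>

definition ev :: "('z endo \<times> 'a \<Rightarrow>\<^sub>0 int) \<Rightarrow> bicomp \<times> bicomp \<times> int perm \<Rightarrow> 'a" where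
  "ev Z i = frag_eval (\<lambda>(F, a). a * \<phi> (coord r q F i)) Z"

text \<open>The additive map sending the pair of \<open>F\<close> and \<open>a\<close> to
  \<open>a\<close> times \<open>change F\<close>. In coordinates its compatibility with the relators
  becomes an identity in the ring.\<close>

definition theta :: "('z endo \<times> 'a \<Rightarrow>\<^sub>0 int) \<Rightarrow> 'a endo" where
  "theta Z = (\<Sum>i\<in>coord_index n r. endo_scale (ev Z i) (B.base i))"

lemma theta_E: "theta Z \<in> B.E"
  unfolding theta_def by (intro B.E_sum B.E_scale B.base_E)

lemma coord_theta: "i \<in> coord_index n r \<Longrightarrow> coord r (\<phi> q) (theta Z) i = ev Z i"
  unfolding theta_def by (rule B.coord_comb)

lemma theta_eqI:
  assumes "G \<in> B.E" "\<And>i. i \<in> coord_index n r \<Longrightarrow> ev Z i = coord r (\<phi> q) G i"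
  shows "theta Z = G"
  using theta_E assms(1) by (rule B.coord_eqI) (simp only: coord_theta assms(2))

lemma theta_of: "theta (frag_of (F, a)) = endo_scale a (change F)"
  by (rule theta_eqI[OF B.E_scale[OF change_E]]) (simp add: ev_def B.coord_scale coord_change)

lemma theta_zero: "theta 0 = 0"
  by (rule theta_eqI[OF B.E_zero]) (simp only: ev_def frag_eval_zero B.coord_zero)

lemma theta_add: "theta (Y + Z) = theta Y + theta Z"
  by (rule theta_eqI[OF B.E_add[OF theta_E theta_E]])
    (simp only: B.coord_add coord_theta ev_def frag_eval_add)

lemma theta_diff: "theta (Y - Z) = theta Y - theta Z"
  using theta_add[of "Y - Z" Z] by (simp only: diff_add_cancel add_diff_cancel_right')

abbreviation S where "S \<equiv> schur15 n r q"

lemma S_simps: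
  "carrier S = A.E" "mult S = (\<circ>)" "one S = (\<lambda>v. if v \<in> A.M then v else 0)"
  "add S = (+)" "smult S = endo_scale"
  by (simp_all only: schur15_def partial_object.simps monoid.simps ring.simps module.simps)

lemma ev_relators:
  assumes "Z \<in> tensor_relators \<phi> S"
  shows "ev Z i = 0"
  using assms unfolding tensor_relators_def S_simps Un_iff mem_Collect_eq ev_def
  by (elim disjE exE conjE)
    (simp_all only: frag_eval_diff frag_eval_of prod.case A.coord_add A.coord_scale phi_add phi_mult,
     simp_all add: algebra_simps)

lemma ev_group_closure: "Z \<in> group_closure (tensor_relators \<phi> S) \<Longrightarrow> ev Z i = 0"
proof (induction rule: group_closure.induct)
  case (base s)
  then consider "s = 0" | "s \<in> tensor_relators \<phi> S" by blast
  then show ?case by cases (simp add: ev_def, rule ev_relators)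
next
  case (diff s t)
  then show ?case by (simp add: ev_def frag_eval_diff)
qed

lemma ev_cong: "(Y, Z) \<in> tensor_cong \<phi> S \<Longrightarrow> ev Y i = ev Z i"
  using ev_group_closure[of "Y - Z" i] by (auto simp: tensor_cong_def ev_def frag_eval_diff)

lemma theta_cong: "(Y, Z) \<in> tensor_cong \<phi> S \<Longrightarrow> theta Y = theta Z"
  by (simp only: theta_def ev_cong)

lemma equiv_cong: "equiv (tensor_free S) (tensor_cong \<phi> S)"
proof (rule equivI)
  let ?G = "group_closure (tensor_relators \<phi> S)"
  show "tensor_cong \<phi> S \<subseteq> tensor_free S \<times> tensor_free S"
    by (auto simp: tensor_cong_def)
  show "refl_on (tensor_free S) (tensor_cong \<phi> S)"
    by (auto simp: refl_on_def tensor_cong_def)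
  show "sym (tensor_cong \<phi> S)"
  proof (rule symI)
    fix X Y assume "(X, Y) \<in> tensor_cong \<phi> S"
    moreover have "Y - X \<in> ?G \<longleftrightarrow> X - Y \<in> ?G" by (metis group_closure_minus_iff minus_diff_eq)
    ultimately show "(Y, X) \<in> tensor_cong \<phi> S" by (simp add: tensor_cong_def)
  qed
  show "trans (tensor_cong \<phi> S)"
  proof (rule transI)
    fix X Y Z assume "(X, Y) \<in> tensor_cong \<phi> S" "(Y, Z) \<in> tensor_cong \<phi> S"
    moreover from this have "(X - Y) + (Y - Z) \<in> ?G"
      by (intro group_closure_add) (simp_all add: tensor_cong_def)
    ultimately show "(X, Z) \<in> tensor_cong \<phi> S" by (simp add: tensor_cong_def)
  qed
qed

lemma tensor_free_iff: "Z \<in> tensor_free S \<longleftrightarrow> Poly_Mapping.keys Z \<subseteq> A.E \<times> UNIV"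
  by (simp add: tensor_free_def S_simps)

lemma tensor_free_induct [consumes 1, case_names zero of diff]:
  assumes "Z \<in> tensor_free S" "Q 0" "\<And>F a. F \<in> A.E \<Longrightarrow> Q (frag_of (F, a))"
    "\<And>Y Z. Y \<in> tensor_free S \<Longrightarrow> Z \<in> tensor_free S \<Longrightarrow> Q Y \<Longrightarrow> Q Z \<Longrightarrow> Q (Y - Z)"
  shows "Q Z"
proof -
  have "Z \<in> tensor_free S \<and> Q Z"
    using assms(1)[unfolded tensor_free_iff]
  proof (induction rule: frag_induction)
    case (one x)
    then show ?case using assms(3) by (cases x) (auto simp: tensor_free_iff keys_frag_of)
  next
    case (diff a b)
    then show ?case using assms(4) keys_diff[of a b] by (auto simp: tensor_free_iff)
  qed (use assms(2) in \<open>auto simp: tensor_free_iff\<close>)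
  then show ?thesis ..
qed

text \<open>A class is evaluated at an arbitrary member; by \<open>theta_cong\<close> all members
  give the same value.\<close>

definition Theta :: "('z endo \<times> 'a \<Rightarrow>\<^sub>0 int) set \<Rightarrow> 'a endo" where
  "Theta Q = theta (SOME Z. Z \<in> Q)"

lemma ThetaI:
  assumes "Q \<noteq> {}" "\<And>Z. Z \<in> Q \<Longrightarrow> theta Z = G"
  shows "Theta Q = G"
  unfolding Theta_def using assms by (metis someI_ex ex_in_conv)

lemma Theta_class: "Z \<in> tensor_free S \<Longrightarrow> Theta (tensor_cong \<phi> S `` {Z}) = theta Z"
  by (rule ThetaI) (use equiv_class_self[OF equiv_cong] theta_cong in auto)

lemma free_mult_diff_left: "free_mult S (Y - Y') Z = free_mult S Y Z - free_mult S Y' Z"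
  by (simp only: free_mult_def frag_extend_diff)

lemma free_mult_of: "free_mult S (frag_of (F, a)) Z = frag_extend (\<lambda>(G, b). frag_of (F \<circ> G, a * b)) Z"
  by (simp add: free_mult_def S_simps)

text \<open>\<open>F\<close> is additive only on \<open>B.M\<close>. The values of \<open>G\<close>
  and \<open>G'\<close> lie there at every argument, because outside \<open>B.M\<close> they are
  zero.\<close>

lemma endo_comp_diff_right:
  assumes F: "F \<in> B.E" and G: "G \<in> B.E" "G' \<in> B.E"
  shows "F \<circ> (G - G') = (F \<circ> G) - (F \<circ> G')"
proof
  fix v
  have in_M: "K v \<in> B.M" if "K \<in> B.E" for K
    using B.E_D(1,4)[OF that, of v] B.M_zero by (cases "v \<in> B.M") auto
  have "fam_scale (- 1) w = - w" for w :: "'a family"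
    by (rule ext, rule ext) (simp add: fam_scale_def hscale_def)
  then have neg: "- G' v \<in> B.M" "F (- G' v) = - F (G' v)"
    using B.M_scale[OF in_M[OF G(2)], of "- 1"] B.E_scale_arg[OF F in_M[OF G(2)], of "- 1"] by simp_all
  have "(G - G') v = G v - G' v" by (rule minus_apply)
  also have "\<dots> = G v + - G' v" by (rule diff_conv_add_uminus)
  finally have "F ((G - G') v) = F (G v) + - F (G' v)"
    using B.E_D(2)[OF F in_M[OF G(1)] neg(1)] neg(2) by (simp only:)
  then show "(F \<circ> (G - G')) v = ((F \<circ> G) - (F \<circ> G')) v"
    unfolding o_apply minus_apply[of "\<lambda>x. F (G x)"] o_def
      by (simp only: diff_conv_add_uminus[of "F (G v)"])
qed

lemma endo_scale_comp:
  assumes F: "F \<in> B.E" and G: "G \<in> B.E"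
  shows "endo_scale (a * b) (F \<circ> G) = endo_scale a F \<circ> endo_scale b G"
proof
  fix v
  have "G v \<in> B.M" using B.E_D(1,4)[OF G, of v] B.M_zero by (cases "v \<in> B.M") auto
  then show "endo_scale (a * b) (F \<circ> G) v = (endo_scale a F \<circ> endo_scale b G) v"
    using B.E_scale_arg[OF F, of "G v" b]
    by (simp add: endo_scale_def fam_scale_def)
qed

lemma theta_mult:
  assumes Y: "Y \<in> tensor_free S" and Z: "Z \<in> tensor_free S"
  shows "theta (free_mult S Y Z) = theta Y \<circ> theta Z" "free_mult S Y Z \<in> tensor_free S"
proof -
  have one: "theta (free_mult S (frag_of (F, a)) Z) = theta (frag_of (F, a)) \<circ> theta Z" if F: "F \<in> A.E"
    for F a
    using Z
  proof (induction rule: tensor_free_induct)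
    case zero
    have z: "theta (frag_of (F, a)) \<circ> 0 = 0"
      by (rule ext) (simp only: o_apply zero_fun_apply B.E_zero_arg[OF theta_E])
    show ?case by (simp only: free_mult_of frag_extend_0 theta_zero z)
  next
    case (of G b)
    have "theta (free_mult S (frag_of (F, a)) (frag_of (G, b))) = endo_scale (a * b) (change F \<circ> change
      G)"
      by (simp only: free_mult_of frag_extend_of prod.case theta_of change_comp[OF F of])
    then show ?case by (simp only: theta_of endo_scale_comp[OF change_E change_E])
  next
    case (diff Y Z)
    then show ?case
      by (simp only: free_mult_of frag_extend_diff theta_diff endo_comp_diff_right[OF theta_E theta_E
        theta_E])
  qed
  show "theta (free_mult S Y Z) = theta Y \<circ> theta Z"
    using Y
  proof (induction rule: tensor_free_induct)
    case zero
    have z: "0 \<circ> theta Z = 0" by (rule ext) (simp only: o_apply zero_fun_apply)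
    show ?case by (simp only: free_mult_def frag_extend_0 theta_zero z)
  next
    case (of F a)
    then show ?case by (rule one)
  next
    case (diff Y Y')
    have "(theta Y - theta Y') \<circ> theta Z = (theta Y \<circ> theta Z) - (theta Y' \<circ> theta Z)"
      by (rule ext) (simp only: o_apply minus_apply)
    then show ?case using diff by (simp only: free_mult_diff_left theta_diff)
  qed
  show "free_mult S Y Z \<in> tensor_free S"
  proof -
    have "Poly_Mapping.keys (frag_extend (\<lambda>(G, b). frag_of (F \<circ> G, a * b)) Z) \<subseteq> A.E \<times> UNIV"
      if "F \<in> A.E" for F and a :: 'a
    proof (rule order_trans[OF keys_frag_extend], rule UN_least)
      fix x assume "x \<in> Poly_Mapping.keys Z"
      then have "fst x \<in> A.E" using Z by (auto simp: tensor_free_iff)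
      then show "Poly_Mapping.keys (case x of (G, b) \<Rightarrow> frag_of (F \<circ> G, a * b)) \<subseteq> A.E \<times> UNIV"
        using A.E_comp[OF that, of "fst x"] by (cases x) (simp add: keys_frag_of)
    qed
    then show ?thesis
      unfolding tensor_free_iff free_mult_def S_simps
      using Y by (intro order_trans[OF keys_frag_extend] UN_least) (auto simp: tensor_free_iff dest!:
        subsetD)
  qed
qed

lemma theta_smult:
  assumes "Z \<in> tensor_free S"
  shows "theta (free_smult c Z) = endo_scale c (theta Z)" "free_smult c Z \<in> tensor_free S"
proof -
  show "theta (free_smult c Z) = endo_scale c (theta Z)"
    using assms
  proof (induction rule: tensor_free_induct)
    case zero
    have "endo_scale c 0 = (0 :: 'a endo)"
      by (rule ext) (simp only: endo_scale_def zero_fun_apply B.fam_scale_zero)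
    then show ?case by (simp only: free_smult_def frag_extend_0 theta_zero)
  next
    case (of F a)
    show ?case
      by (simp add: free_smult_def theta_of) (simp add: endo_scale_def fam_scale_def)
  next
    case (diff Y Z)
    have "endo_scale c (F - G) = endo_scale c F - endo_scale c G" for F G :: "'a endo"
      by (rule ext, rule ext, rule ext)
        (simp only: endo_scale_def fam_scale_def hscale_def minus_apply right_diff_distrib)
    then show ?case using diff by (simp only: free_smult_def frag_extend_diff theta_diff)
  qed
  show "free_smult c Z \<in> tensor_free S"
    unfolding tensor_free_iff free_smult_def
    by (rule order_trans[OF keys_frag_extend], rule UN_least)
      (use assms in \<open>auto simp: tensor_free_iff keys_frag_of dest!: subsetD\<close>)
qed

text \<open>
  Modulo the relators every element of the free group is congruent to \<open>normal_form Z\<close>, which is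
  determined by the coordinates \<open>ev Z\<close>; this gives injectivity of \<open>Theta\<close>.
\<close>

definition normal_form :: "('z endo \<times> 'a \<Rightarrow>\<^sub>0 int) \<Rightarrow> 'z endo \<times> 'a \<Rightarrow>\<^sub>0 int" where
  "normal_form Z = (\<Sum>i\<in>coord_index n r. frag_of (A.base i, ev Z i))"

lemma normal_cong:
  assumes "Z \<in> tensor_free S"
  shows "Z - normal_form Z \<in> group_closure (tensor_relators \<phi> S)"
  using assms
proof (induction rule: tensor_free_induct)
  let ?G = "group_closure (tensor_relators \<phi> S)"
  let ?I = "coord_index n r"
  have rel: "frag_of (x + y, a) - frag_of (x, a) - frag_of (y, a) \<in> ?G" if "x \<in> A.E" "y \<in> A.E" for x y a
    by (rule group_closure.base, rule insertI2) (use that in \<open>unfold tensor_relators_def S_simps,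
      blast\<close>)
  have rel2: "frag_of (x, a + b) - frag_of (x, a) - frag_of (x, b) \<in> ?G" if "x \<in> A.E" for x a b
    by (rule group_closure.base, rule insertI2) (use that in \<open>unfold tensor_relators_def S_simps,
      blast\<close>)
  have rel3: "frag_of (endo_scale c x, a) - frag_of (x, \<phi> c * a) \<in> ?G" if "x \<in> A.E" for x c a
    by (rule group_closure.base, rule insertI2) (use that in \<open>unfold tensor_relators_def S_simps,
      blast\<close>)
  have G_add: "u + v \<in> ?G" if "u \<in> ?G" "v \<in> ?G" for u v using that by (rule group_closure_add)
  \<comment> \<open>The relator for \<open>0 + 0\<close> is the negative of this element.\<close>
  have z2: "frag_of (x, 0) \<in> ?G" if "x \<in> A.E" for x
    using rel2[OF that, of 0 0] by simp
  have z1: "frag_of (0, a) \<in> ?G" for a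
    using rel[OF A.E_zero A.E_zero, of a] by (simp only: add_0 diff_self diff_0 group_closure_minus_iff)
  {
    case zero
    have "normal_form 0 \<in> ?G"
      unfolding normal_form_def by (intro group_closure_sum) (simp add: ev_def z2 A.base_E)
    then show ?case by simp
  next
    case (of F a)
    have alg: "t - u - v + (v - w) = t - (u + w)" for t u v w :: "'z endo \<times> 'a \<Rightarrow>\<^sub>0 int"
      by simp
    \<comment> \<open>Additivity relators are chained, so that the first component can be expanded
      in the basis.\<close>
    have sums: "frag_of (\<Sum>i\<in>J. f i, a) - (\<Sum>i\<in>J. frag_of (f i, a)) \<in> ?G"
      if "\<And>i. i \<in> J \<Longrightarrow> f i \<in> A.E" for J :: "(bicomp \<times> bicomp \<times> int perm) set" and f
      using that
    proof (induction J rule: infinite_finite_induct)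
      case (insert i J)
      have E: "f i \<in> A.E" "(\<Sum>i\<in>J. f i) \<in> A.E" using insert by (auto intro: A.E_sum)
      have "frag_of (f i + (\<Sum>i\<in>J. f i), a) - frag_of (f i, a) - frag_of (\<Sum>i\<in>J. f i, a) +
        (frag_of (\<Sum>i\<in>J. f i, a) - (\<Sum>i\<in>J. frag_of (f i, a))) \<in> ?G"
        using insert by (intro G_add rel E) auto
      then show ?case
        unfolding sum.insert[OF insert.hyps] by (simp only: alg)
    qed (simp_all only: sum.infinite sum.empty z1 diff_0_right simp_thms)
    let ?c = "coord r q F"
    have "frag_of (\<Sum>i\<in>?I. endo_scale (?c i) (A.base i), a) - (\<Sum>i\<in>?I. frag_of (endo_scale (?c i) (A.base
      i), a)) \<in> ?G"
      by (intro sums A.E_scale A.base_E)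
    moreover have "(\<Sum>i\<in>?I. frag_of (endo_scale (?c i) (A.base i), a) - frag_of (A.base i,
      \<phi> (?c i) * a)) \<in> ?G"
      by (intro group_closure_sum rel3 A.base_E)
    ultimately have "frag_of (\<Sum>i\<in>?I. endo_scale (?c i) (A.base i), a) - (\<Sum>i\<in>?I. frag_of (endo_scale (?c
      i) (A.base i), a))
      + (\<Sum>i\<in>?I. frag_of (endo_scale (?c i) (A.base i), a) - frag_of (A.base i, \<phi> (?c i) * a)) \<in> ?G"
      by (rule G_add)
    then have "frag_of (\<Sum>i\<in>?I. endo_scale (?c i) (A.base i), a) - (\<Sum>i\<in>?I. frag_of (A.base i,
      \<phi> (?c i) * a)) \<in> ?G"
      unfolding sum_subtractf by (simp only: diff_add_cancel add_diff_eq)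
    then show ?case
      unfolding A.coord_expand[OF of, symmetric] by (simp add: normal_form_def ev_def mult.commute)
  next
    case (diff Y Z)
    have "frag_of (A.base i, ev Y i) - frag_of (A.base i, ev Z i) - frag_of (A.base i,
      ev (Y - Z) i) \<in> ?G" if "i \<in> ?I" for i
    proof -
      have "ev Y i = ev (Y - Z) i + ev Z i" by (simp add: ev_def frag_eval_diff)
      then show ?thesis using rel2[OF A.base_E[OF that], of "ev (Y - Z) i" "ev Z i"]
        by (simp add: algebra_simps)
    qed
    then have "(\<Sum>i\<in>?I. frag_of (A.base i, ev Y i) - frag_of (A.base i, ev Z i) - frag_of (A.base i,
      ev (Y - Z) i)) \<in> ?G"
      by (rule group_closure_sum)
    then have "normal_form Y - normal_form Z - normal_form (Y - Z) \<in> ?G"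
      by (simp add: normal_form_def sum_subtractf)
    with group_closure.diff[OF diff(3,4)]
    have "(Y - normal_form Y) - (Z - normal_form Z) + (normal_form Y - normal_form Z - normal_form (Y -
      Z)) \<in> ?G"
      by (rule G_add)
    then show ?case by (simp add: algebra_simps)
  }
qed

text \<open>The third claim ties the isomorphism to the modules: a pure tensor acts on images of
  families over the old ring as the endomorphism followed by base change, so the map is the natural
  one.\<close>

theorem Theta_iso:
  shows "Theta \<in> ring_iso (base_change \<phi> S) (schur15 n r (\<phi> q))"
    and "P \<in> carrier (base_change \<phi> S) \<Longrightarrow>
      Theta (c \<odot>\<^bsub>base_change \<phi> S\<^esub> P) = c \<odot>\<^bsub>schur15 n r (\<phi> q)\<^esub> Theta P"
    and "F \<in> carrier S \<Longrightarrow> v \<in> A.M \<Longrightarrow>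
      Theta (pure_tensor \<phi> S F a) (fam_map \<phi> v) = fam_scale a (fam_map \<phi> (F v))"
proof -
  let ?R = "tensor_cong \<phi> S"
  let ?T = "tensor_free S"
  let ?B = "base_change \<phi> S"
  let ?S = "schur15 n r (\<phi> q)"
  have S': "carrier ?S = B.E" "mult ?S = (\<circ>)" "one ?S = (\<lambda>v. if v \<in> B.M then v else 0)"
    "add ?S = (+)" "smult ?S = endo_scale"
    by (simp_all only: schur15_def partial_object.simps monoid.simps ring.simps module.simps)
  have B': "carrier ?B = ?T // ?R" "mult ?B = (\<lambda>P Q. \<Union>X\<in>P. \<Union>Y\<in>Q. ?R `` {free_mult S X Y})"
    "one ?B = pure_tensor \<phi> S \<one>\<^bsub>S\<^esub> 1" "add ?B = (\<lambda>P Q. \<Union>X\<in>P. \<Union>Y\<in>Q. ?R `` {X + Y})"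
    "smult ?B = (\<lambda>c P. \<Union>X\<in>P. ?R `` {free_smult c X})"
    by (simp_all only: base_change_def partial_object.simps monoid.simps ring.simps module.simps)
  have el: "\<exists>Z. Z \<in> P" "\<And>Z. Z \<in> P \<Longrightarrow> Z \<in> ?T \<and> theta Z = Theta P" if "P \<in> ?T // ?R" for P
  proof -
    obtain X where X: "X \<in> ?T" "P = ?R `` {X}" using \<open>P \<in> ?T // ?R\<close> by (rule quotientE)
    show "\<exists>Z. Z \<in> P" using equiv_class_self[OF equiv_cong X(1)] X(2) by blast
    show "Z \<in> ?T \<and> theta Z = Theta P" if "Z \<in> P" for Z
      using that theta_cong[of X Z] Theta_class[OF X(1)] unfolding X(2) by (auto simp: tensor_cong_def)
  qed
  have self: "Z \<in> ?R `` {Z}" if "Z \<in> ?T" for Z using that by (rule equiv_class_self[OF equiv_cong])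
  have Tadd: "X + Y \<in> ?T" if "X \<in> ?T" "Y \<in> ?T" for X Y
    using that keys_add[of X Y] unfolding tensor_free_iff by blast
  have hom_add: "Theta (\<Union>X\<in>P. \<Union>Y\<in>Q. ?R `` {X + Y}) = Theta P + Theta Q"
    if P: "P \<in> ?T // ?R" and Q: "Q \<in> ?T // ?R" for P Q
  proof (rule ThetaI)
    obtain X Y where "X \<in> P" "Y \<in> Q" using el(1)[OF P] el(1)[OF Q] by blast
    then show "(\<Union>X\<in>P. \<Union>Y\<in>Q. ?R `` {X + Y}) \<noteq> {}"
      using self[OF Tadd] el(2)[OF P] el(2)[OF Q] by blast
    fix Z assume "Z \<in> (\<Union>X\<in>P. \<Union>Y\<in>Q. ?R `` {X + Y})"
    then obtain X Y where XY: "X \<in> P" "Y \<in> Q" "(X + Y, Z) \<in> ?R" by blast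
    then show "theta Z = Theta P + Theta Q"
      using theta_cong[OF XY(3)] el(2)[OF P XY(1)] el(2)[OF Q XY(2)] by (simp only: theta_add)
  qed
  have hom_mult: "Theta (\<Union>X\<in>P. \<Union>Y\<in>Q. ?R `` {free_mult S X Y}) = Theta P \<circ> Theta Q"
    if P: "P \<in> ?T // ?R" and Q: "Q \<in> ?T // ?R" for P Q
  proof (rule ThetaI)
    obtain X Y where "X \<in> P" "Y \<in> Q" using el(1)[OF P] el(1)[OF Q] by blast
    then show "(\<Union>X\<in>P. \<Union>Y\<in>Q. ?R `` {free_mult S X Y}) \<noteq> {}"
      using self[OF theta_mult(2)] el(2)[OF P] el(2)[OF Q] by blast
    fix Z assume "Z \<in> (\<Union>X\<in>P. \<Union>Y\<in>Q. ?R `` {free_mult S X Y})"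
    then obtain X Y where XY: "X \<in> P" "Y \<in> Q" "(free_mult S X Y, Z) \<in> ?R" by blast
    then show "theta Z = Theta P \<circ> Theta Q"
      using theta_cong[OF XY(3)] el(2)[OF P XY(1)] el(2)[OF Q XY(2)] theta_mult(1)[of X Y] by simp
  qed
  have pure: "Theta (pure_tensor \<phi> S F a) = endo_scale a (change F)" if "F \<in> A.E" for F a
    using that Theta_class[of "frag_of (F, a)"]
    by (simp add: pure_tensor_def tensor_free_iff keys_frag_of theta_of)
  have one: "Theta (one ?B) = one ?S"
  proof -
    have "endo_scale 1 G = G" for G :: "'a endo"
      by (rule ext, rule ext) (simp only: endo_scale_def fam_scale_def hscale_simps)
    then show ?thesis unfolding B' S' S_simps using pure[OF A.E_one] change_one by simp
  qed
  have "Theta \<in> ring_hom ?B ?S"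
  proof (rule ring_hom_memI)
    show "Theta P \<in> carrier ?S" if "P \<in> carrier ?B" for P
      using theta_E by (simp only: S' Theta_def)
    show "Theta (P \<otimes>\<^bsub>?B\<^esub> Q) = Theta P \<otimes>\<^bsub>?S\<^esub> Theta Q" if "P \<in> carrier ?B" "Q \<in> carrier ?B" for P Q
      using that hom_mult unfolding B' S' by blast
    show "Theta (P \<oplus>\<^bsub>?B\<^esub> Q) = Theta P \<oplus>\<^bsub>?S\<^esub> Theta Q" if "P \<in> carrier ?B" "Q \<in> carrier ?B" for P Q
      using that hom_add unfolding B' S' by blast
    show "Theta \<one>\<^bsub>?B\<^esub> = \<one>\<^bsub>?S\<^esub>" by (rule one)
  qed
  moreover have "bij_betw Theta (carrier ?B) (carrier ?S)"
    unfolding bij_betw_def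
  proof
    show "inj_on Theta (carrier ?B)"
    proof (rule inj_onI)
      fix P Q assume PQ: "P \<in> carrier ?B" "Q \<in> carrier ?B" "Theta P = Theta Q"
      obtain X where X: "X \<in> ?T" "P = ?R `` {X}" using PQ(1) unfolding B' by (rule quotientE)
      obtain Y where Y: "Y \<in> ?T" "Q = ?R `` {Y}" using PQ(2) unfolding B' by (rule quotientE)
      have "theta X = theta Y" using PQ(3) Theta_class X Y by metis
      then have "ev X i = ev Y i" if "i \<in> coord_index n r" for i
        using coord_theta[OF that] by metis
      then have "normal_form X = normal_form Y" by (simp add: normal_form_def)
      \<comment> \<open>Equal coordinates give equal normal forms, so the normal forms cancel and
        two elements of the relator group remain.\<close>
      then have "X - Y = (X - normal_form X) - (Y - normal_form Y)" by simp
      also have "\<dots> \<in> group_closure (tensor_relators \<phi> S)"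
        using normal_cong[OF X(1)] normal_cong[OF Y(1)] by (rule group_closure.diff)
      finally have "(X, Y) \<in> ?R" using X Y by (simp add: tensor_cong_def)
      then show "P = Q" unfolding X(2) Y(2) by (rule equiv_class_eq[OF equiv_cong])
    qed
    show "Theta ` carrier ?B = carrier ?S"
    proof
      show "Theta ` carrier ?B \<subseteq> carrier ?S" using theta_E by (auto simp: S' Theta_def)
      show "carrier ?S \<subseteq> Theta ` carrier ?B"
      proof
        fix G assume "G \<in> carrier ?S"
        then have G: "G \<in> B.E" by (simp only: S')
        \<comment> \<open>The preimage is written in normal form, with the coordinates of
          \<open>G\<close> as scalars.\<close>
        define Z where "Z = (\<Sum>i\<in>coord_index n r. frag_of (A.base i, coord r (\<phi> q) G i))"
        have "finite J \<Longrightarrow> J \<subseteq> coord_index n r \<Longrightarrow> (\<Sum>i\<in>J. frag_of (A.base i, coord r (\<phi> q) G i)) \<in> ?T" for J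
        proof (induction J rule: finite_induct)
          case (insert i J)
          then have "frag_of (A.base i, coord r (\<phi> q) G i) \<in> ?T"
            by (simp add: tensor_free_iff keys_frag_of A.base_E)
          then show ?case using insert Tadd by simp
        qed (simp add: tensor_free_iff)
        then have Z: "Z \<in> ?T" unfolding Z_def using A.finite_coord_index by blast
        have "theta Z = G"
        proof (rule theta_eqI[OF G])
          fix i assume i: "i \<in> coord_index n r"
          have "ev Z i = (\<Sum>j\<in>coord_index n r. if j = i then coord r (\<phi> q) G j else 0)"
            unfolding ev_def Z_def frag_eval_sum frag_eval_of prod.case
            by (rule sum.cong) (use A.coord_base i in \<open>auto simp: phi_0 phi_1\<close>)
          then show "ev Z i = coord r (\<phi> q) G i" using i A.finite_coord_index by (simp add: sum.delta)
        qed
        then have "G = Theta (?R `` {Z})" using Theta_class[OF Z] by simp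
        then show "G \<in> Theta ` carrier ?B" using quotientI[OF Z, of ?R] unfolding B' by blast
      qed
    qed
  qed
  ultimately show "Theta \<in> ring_iso ?B ?S" by (simp add: ring_iso_def)
  show "Theta (c \<odot>\<^bsub>?B\<^esub> P) = c \<odot>\<^bsub>?S\<^esub> Theta P" if "P \<in> carrier ?B"
  proof -
    have P: "P \<in> ?T // ?R" using that by (simp only: B')
    show ?thesis
      unfolding B' S'
    proof (rule ThetaI)
      obtain X where "X \<in> P" using el(1)[OF P] by blast
      then show "(\<Union>X\<in>P. ?R `` {free_smult c X}) \<noteq> {}"
        using self[OF theta_smult(2)] el(2)[OF P] by blast
      fix Z assume "Z \<in> (\<Union>X\<in>P. ?R `` {free_smult c X})"
      then obtain X where X: "X \<in> P" "(free_smult c X, Z) \<in> ?R" by blast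
      then show "theta Z = endo_scale c (Theta P)"
        using theta_cong[OF X(2)] el(2)[OF P X(1)] theta_smult(1)[of X c] by simp
    qed
  qed
  show "Theta (pure_tensor \<phi> S F a) (fam_map \<phi> v) = fam_scale a (fam_map \<phi> (F v))"
    if "F \<in> carrier S" "v \<in> A.M"
  proof -
    have F: "F \<in> A.E" using that by (simp only: S_simps)
    show ?thesis unfolding pure[OF F] endo_scale_def change_fam_map[OF F that(2)] ..
  qed
qed

end

theorem theorem7p1:
  fixes n r :: nat and \<phi> :: "laurent \<Rightarrow> 'a::comm_ring_1"
  assumes "n \<ge> 1" and "r \<ge> 4"
    and "\<phi> 1 = 1" and "\<And>x y. \<phi> (x + y) = \<phi> x + \<phi> y" and "\<And>x y. \<phi> (x * y) = \<phi> x * \<phi> y"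
    and "(2::'a) dvd 1"
  defines "S \<equiv> schur15 n r laurent_q"
    and "S' \<equiv> schur15 n r (\<phi> laurent_q)"
  shows "(\<exists>B. \<not> Modules.module.dependent endo_scale B \<and>
              Modules.module.span endo_scale B = carrier S') \<and>
         (\<exists>\<Theta> \<in> ring_iso (base_change \<phi> S) S'.
            (\<forall>c. \<forall>X \<in> carrier (base_change \<phi> S).
               \<Theta> (c \<odot>\<^bsub>base_change \<phi> S\<^esub> X) = c \<odot>\<^bsub>S'\<^esub> \<Theta> X) \<and>
            (\<forall>F \<in> carrier S. \<forall>a. \<forall>v \<in> xsum n r laurent_q.
               \<Theta> (pure_tensor \<phi> S F a) (fam_map \<phi> v) = fam_scale a (fam_map \<phi> (F v))))"
proof -
  have "laurent_q * Poly_Mapping.single (- 1) 1 = 1"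
    by (simp add: laurent_q_def mult_single)
  then interpret schur_change r laurent_q "Poly_Mapping.single (- 1) 1" n \<phi>
    by unfold_locales (use assms(2-5) in auto)
  have "carrier S' = B.E" by (simp add: S'_def schur15_def)
  then show ?thesis
    unfolding S_def S'_def[symmetric]
    using B.E_free Theta_iso[folded S'_def] by (intro conjI bexI[of _ Theta]) auto
qed

end
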